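(* Let $\mathscr C\subseteq\mathbb N=\{0,1,2,\ldots\}$ be a non-empty set of natural numbers, let $\mathcal{IB}=\mathcal{IB}(\mathscr C)$ be the partial braid category over $\mathscr C$, let $\xi$ be the least cardinal strictly greater than every element of $\mathscr C$, and let $I_r=\{\alpha\in\mathcal{IB}:\operatorname{rank}(\alpha)\le r\}$ for $0\le r<\xi$, with $I_\omega=\mathcal{IB}$ if $\xi=\omega$. Then for any $r\ge0$ (i.e. $0\le r<\xi$, and also $r=\omega$ if $\xi=\omega$), the congruences on $I_r$ are precisely the universal congruence $\widetilde\nabla_{I_r}$ and those of the form $$R^{I_r}_{I_q,\mathbf N}\qquad\text{for some }0\le q<r\text{ and some }\mathbf N=(N_{q+1}^\natural,N_{q+2}^\natural,\ldots)$$ (indices running over all finite $p$ with $q+1\le p\le r$), where - $N_p\unlhd\mathcal B_p$ for all $p\ge q+1$, - $N_p\le\mathcal P_p$ for all $p\ge q+2$, - $N_p{\restriction}_{p-1}\le N_{p-1}$ for all $p\ge q+2$.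
   Context: **Partial braids.** Write $[n]=\{1,\ldots,n\}$. A string is a smooth embedding $s:[0,1]\to\mathbb R^3$ such that the $z$-coordinate of $s(t)$ is $1-t$. A partial braid is a homotopy class of a finite collection $\alpha=(s_{i_1},\ldots,s_{i_k})$, $1\le i_1<\cdots<i_k$, of pairwise non-intersecting strings with $s_{i_l}(0)=(i_l,0,1)$ and $s_{i_l}(1)=(j_l,0,0)$, the $j_l$ being positive integers (homotopies are through such collections, with endpoints fixed). $\operatorname{dom}(\alpha)=\{i_1,\ldots,i_k\}$, $\operatorname{codom}(\alpha)=\{j_1,\ldots,j_k\}$, $\operatorname{rank}(\alpha)=k$. The product $\alpha\beta$ is formed by placing $\beta$ below $\alpha$, joining strings, deleting every string of $\alpha$ or $\beta$ that does not become joined to a string of the other, and rescaling to $0\le z\le1$. For $m,n\in\mathbb N$, $\mathcal{IB}_{m,n}$ is the set of partial braids with $\operatorname{dom}\subseteq[m]$, $\operatorname{codom}\subseteq[n]$. $\mathcal{IB}(\mathscr C)$ has object set $\mathscr C$ and morphisms $(m,\alpha,n)$ with $m,n\in\mathscr C$, $\alpha\in\mathcal{IB}_{m,n}$; $\mathbf d(m,\alpha,n)=m$, $\mathbf r(m,\alpha,n)=n$, $(m,\alpha,n)(n,\beta,p)=(m,\alpha\beta,p)$. The $\mathscr J=\mathscr D$-classes of $\mathcal{IB}$ are $D_q=\{\alpha:\operatorname{rank}(\alpha)=q\}$, $0\le q<\xi$, all stable and regular. The braid group $\mathcal B_n$ consists of the partial braids with domain and codomain $[n]$; the pure braid group $\mathcal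 P_n\unlhd\mathcal B_n$ is the kernel of the natural map $\mathcal B_n\to\mathcal S_n$ sending a braid to the permutation given by the endpoints of its strings. For $\alpha\in\mathcal P_n$ and $m\le n$, $\alpha{\restriction}_m\in\mathcal P_m$ consists of the first $m$ strings of $\alpha$, and $\Omega{\restriction}_m=\{\alpha{\restriction}_m:\alpha\in\Omega\}$ for $\Omega\subseteq\mathcal P_n$. **Groups.** For each $0\le q<\xi$ fix $n_q\in\mathscr C$ with $n_q\ge q$. For $\alpha\in\mathcal B_q$, $\alpha^\natural\in\mathcal{IB}_{n_q,n_q}$ is the partial braid with the same strings as $\alpha$; $N^\natural=\{\alpha^\natural:\alpha\in N\}$. $\mathcal B_q^\natural$ is a group $\mathscr H$-class in $D_q$. **Congruences.** For a partial semigroup (category without necessarily having identities) $S$ with domain/range maps $\mathbf d,\mathbf r$, write $x\sim y$ if $\mathbf d(x)=\mathbf d(y)$ and $\mathbf r(x)=\mathbf r(y)$. A congruence on $S$ is an equivalence contained in $\sim$ and compatible with all defined left and right multiplications by elements of $S$. $\Delta_S$ is equality, $\widetilde\nabla_S=\{(x,y)\in S\times S:x\sim y\}$; for an ideal $I$ of $S$, $R_I^S=\widetilde\nabla_I\cup\Delta_S$. For $N\unlhd\mathcal B_p$, $\nu_{N^\natural}=\{(axb,ayb):x,y\in N^\natural,\ a,b\in\mathcal{IB},\ axb,ayb\in D_p\}$. For $\mathbf N=(N_{q+1}^\natural,N_{q+2}^\natural,\ldots)$, $R^{I_r}_{I_q,\mathbf N}=R^{I_r}_{I_q}\cup\bigcup_p\nu_{N_p^\natural}$.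 *)

theory Defs
  imports
    "HOL-Analysis.Analysis"
    "HOL-Algebra.Sym_Groups"
    "HOL-Library.Extended_Nat"
begin

section \<open>Strings and partial braids\<close>

type_synonym point = "real \<times> real \<times> real"
type_synonym curve = "real \<Rightarrow> point"

text \<open>Smoothness on the closed interval means that derivatives of all orders exist there, one-sided
  at the end points; \<open>g k\<close> is the derivative of order \<open>k\<close>.\<close>

definition smooth_curve :: "curve \<Rightarrow> bool" where
  "smooth_curve s \<longleftrightarrow>
     (\<exists>g :: nat \<Rightarrow> curve. (\<forall>t\<in>{0..1}. g 0 t = s t) \<and>
        (\<forall>k. \<forall>t\<in>{0..1}. (g k has_vector_derivative g (Suc k) t) (at t within {0..1})))"

definition smooth_embedding :: "curve \<Rightarrow> bool" where
  "smooth_embedding s \<longleftrightarrow> smooth_curve s \<and> inj_on s {0..1} \<and>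
     (\<forall>t\<in>{0..1}. vector_derivative s (at t within {0..1}) \<noteq> 0)"

definition is_string :: "curve \<Rightarrow> bool" where
  "is_string s \<longleftrightarrow> smooth_embedding s \<and> (\<forall>t\<in>{0..1}. snd (snd (s t)) = 1 - t)"

text \<open>A finite collection of strings is a finite map sending the index of the upper end point of each
  string to that string.  Only the values of a string on the unit interval matter; other values are
  absorbed by passing to homotopy classes.\<close>

type_synonym string_system = "nat \<rightharpoonup> curve"

definition is_string_system :: "string_system \<Rightarrow> bool" where
  "is_string_system a \<longleftrightarrow>
     finite (dom a) \<and> 0 \<notin> dom a \<and>
     (\<forall>i s. a i = Some s \<longrightarrow> is_string s \<and> s 0 = (real i, 0, 1) \<and>
        (\<exists>j\<ge>1. s 1 = (real j, 0, 0))) \<and>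
     (\<forall>i i' s s'. a i = Some s \<longrightarrow> a i' = Some s' \<longrightarrow> i \<noteq> i' \<longrightarrow>
        s ` {0..1} \<inter> s' ` {0..1} = {})"

definition string_end :: "curve \<Rightarrow> nat" where
  "string_end s = (THE j. s 1 = (real j, 0, 0))"

definition homotopic_systems :: "string_system \<Rightarrow> string_system \<Rightarrow> bool" where
  "homotopic_systems a b \<longleftrightarrow>
     (\<exists>H :: real \<Rightarrow> string_system.
        H 0 = a \<and> H 1 = b \<and>
        (\<forall>u\<in>{0..1}. is_string_system (H u) \<and> dom (H u) = dom a \<and>
           (\<forall>i\<in>dom a. the (H u i) 0 = the (a i) 0 \<and> the (H u i) 1 = the (a i) 1)) \<and>
        (\<forall>i\<in>dom a. continuous_on ({0..1} \<times> {0..1}) (\<lambda>(u, t). the (H u i) t)))"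

type_synonym pbraid = "string_system set"

definition homotopy_class :: "string_system \<Rightarrow> pbraid" where
  "homotopy_class a = {b. homotopic_systems a b}"

definition partial_braids :: "pbraid set" where
  "partial_braids = homotopy_class ` Collect is_string_system"

definition pb_rep :: "pbraid \<Rightarrow> string_system" where
  "pb_rep A = (SOME a. a \<in> A)"

definition pb_dom :: "pbraid \<Rightarrow> nat set" where
  "pb_dom A = dom (pb_rep A)"

definition pb_codom :: "pbraid \<Rightarrow> nat set" where
  "pb_codom A = string_end ` ran (pb_rep A)"

definition pb_rank :: "pbraid \<Rightarrow> nat" where
  "pb_rank A = card (pb_dom A)"

text \<open>The first string occupies the upper half \<open>1/2 \<le> z \<le> 1\<close>, the second the lower half.\<close>

definition join_strings :: "curve \<Rightarrow> curve \<Rightarrow> curve" where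
  "join_strings s s' t =
     (if t \<le> 1/2 then (case s (2 * t) of (x, y, z) \<Rightarrow> (x, y, (z + 1) / 2))
      else (case s' (2 * t - 1) of (x, y, z) \<Rightarrow> (x, y, z / 2)))"

definition stack :: "string_system \<Rightarrow> string_system \<Rightarrow> string_system" where
  "stack a b i =
     (case a i of None \<Rightarrow> None
      | Some s \<Rightarrow> map_option (join_strings s) (b (string_end s)))"

text \<open>Joined strings need not be smooth where they meet, so the product uses those representatives
  whose joined strings are smooth (any strings that are flat near their ends qualify).  The
  resulting homotopy class does not depend on the choice.\<close>

definition pb_mult :: "pbraid \<Rightarrow> pbraid \<Rightarrow> pbraid" where
  "pb_mult A B =
     \<Union> {homotopy_class (stack a b) | a b. a \<in> A \<and> b \<in> B \<and> is_string_system (stack a b)}"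


section \<open>Braid groups and pure braid groups\<close>

definition identity_braid :: "nat \<Rightarrow> pbraid" where
  "identity_braid n = homotopy_class
     (\<lambda>i. if i \<in> {1..n} then Some (\<lambda>t. (real i, 0, 1 - t)) else None)"

definition braid_group :: "nat \<Rightarrow> pbraid monoid" where
  "braid_group n =
     \<lparr>carrier = {A \<in> partial_braids. pb_dom A = {1..n} \<and> pb_codom A = {1..n}},
      mult = pb_mult, one = identity_braid n\<rparr>"

definition braid_perm :: "pbraid \<Rightarrow> nat \<Rightarrow> nat" where
  "braid_perm A i = (case pb_rep A i of None \<Rightarrow> i | Some s \<Rightarrow> string_end s)"

text \<open>Braids are multiplied from top to bottom, that is, permutations from left to right, whereas
  \<^const>\<open>sym_group\<close> composes functions from right to left.  The kernel is the same for
  either convention.\<close>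

definition pure_braids :: "nat \<Rightarrow> pbraid set" where
  "pure_braids n = kernel (braid_group n) (sym_group n) braid_perm"

definition pb_restrict :: "nat \<Rightarrow> pbraid \<Rightarrow> pbraid" where
  "pb_restrict m A = \<Union> {homotopy_class (a |` {1..m}) | a. a \<in> A}"


section \<open>Congruences on partial semigroups\<close>

text \<open>The product \<open>cmp S x y\<close> is only meaningful if \<open>tgt S x = src S y\<close>.\<close>

record ('a, 'o) partial_semigroup =
  arrows :: "'a set"
  src :: "'a \<Rightarrow> 'o"
  tgt :: "'a \<Rightarrow> 'o"
  cmp :: "'a \<Rightarrow> 'a \<Rightarrow> 'a"

definition parallel :: "('a, 'o) partial_semigroup \<Rightarrow> 'a \<Rightarrow> 'a \<Rightarrow> bool" where
  "parallel S x y \<longleftrightarrow> src S x = src S y \<and> tgt S x = tgt S y"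

definition universal_congruence :: "('a, 'o) partial_semigroup \<Rightarrow> ('a \<times> 'a) set" where
  "universal_congruence S = {(x, y) \<in> arrows S \<times> arrows S. parallel S x y}"

definition is_congruence :: "('a, 'o) partial_semigroup \<Rightarrow> ('a \<times> 'a) set \<Rightarrow> bool" where
  "is_congruence S \<sigma> \<longleftrightarrow>
     equiv (arrows S) \<sigma> \<and> (\<forall>(x, y)\<in>\<sigma>. parallel S x y) \<and>
     (\<forall>(x, y)\<in>\<sigma>. \<forall>a\<in>arrows S.
        (tgt S a = src S x \<longrightarrow> (cmp S a x, cmp S a y) \<in> \<sigma>) \<and>
        (tgt S x = src S a \<longrightarrow> (cmp S x a, cmp S y a) \<in> \<sigma>))"

definition rees_congruence ::
  "('a, 'o) partial_semigroup \<Rightarrow> 'a set \<Rightarrow> ('a \<times> 'a) set" where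
  "rees_congruence S I = universal_congruence (S\<lparr>arrows := I\<rparr>) \<union> Id_on (arrows S)"


section \<open>The partial braid category\<close>

type_synonym pb_arrow = "nat \<times> pbraid \<times> nat"

definition IB_hom :: "nat \<Rightarrow> nat \<Rightarrow> pbraid set" where
  "IB_hom m n = {A \<in> partial_braids. pb_dom A \<subseteq> {1..m} \<and> pb_codom A \<subseteq> {1..n}}"

definition IB :: "nat set \<Rightarrow> (pb_arrow, nat) partial_semigroup" where
  "IB C =
     \<lparr>arrows = {(m, A, n) | m A n. m \<in> C \<and> n \<in> C \<and> A \<in> IB_hom m n},
      src = (\<lambda>(m, A, n). m),
      tgt = (\<lambda>(m, A, n). n),
      cmp = (\<lambda>(m, A, n) (n', B, p). (m, pb_mult A B, p))\<rparr>"

definition arrow_rank :: "pb_arrow \<Rightarrow> nat" where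
  "arrow_rank = (\<lambda>(m, A, n). pb_rank A)"

text \<open>\<open>\<xi>\<close> is either finite or \<open>\<omega>\<close>, and the latter is represented by \<open>\<infinity>\<close>.\<close>

definition xi :: "nat set \<Rightarrow> enat" where
  "xi C = (LEAST k. \<forall>n\<in>C. enat n < k)"

definition D_class :: "nat set \<Rightarrow> nat \<Rightarrow> pb_arrow set" where
  "D_class C q = {x \<in> arrows (IB C). arrow_rank x = q}"

definition rank_ideal :: "nat set \<Rightarrow> enat \<Rightarrow> pb_arrow set" where
  "rank_ideal C r = {x \<in> arrows (IB C). enat (arrow_rank x) \<le> r}"

definition IB_ideal :: "nat set \<Rightarrow> enat \<Rightarrow> (pb_arrow, nat) partial_semigroup" where
  "IB_ideal C r = (IB C)\<lparr>arrows := rank_ideal C r\<rparr>"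

text \<open>In the next three definitions \<open>nq\<close> is the chosen function \<open>q \<mapsto> n\<^sub>q\<close>.\<close>

definition natural_copy :: "(nat \<Rightarrow> nat) \<Rightarrow> nat \<Rightarrow> pbraid set \<Rightarrow> pb_arrow set" where
  "natural_copy nq q N = {(nq q, A, nq q) | A. A \<in> N}"

definition nu :: "nat set \<Rightarrow> (nat \<Rightarrow> nat) \<Rightarrow> nat \<Rightarrow> pbraid set \<Rightarrow> (pb_arrow \<times> pb_arrow) set" where
  "nu C nq p N =
     {(cmp (IB C) (cmp (IB C) a x) b, cmp (IB C) (cmp (IB C) a y) b) | x y a b.
        x \<in> natural_copy nq p N \<and> y \<in> natural_copy nq p N \<and>
        a \<in> arrows (IB C) \<and> b \<in> arrows (IB C) \<and>
        tgt (IB C) a = nq p \<and> src (IB C) b = nq p \<and>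
        cmp (IB C) (cmp (IB C) a x) b \<in> D_class C p \<and>
        cmp (IB C) (cmp (IB C) a y) b \<in> D_class C p}"

definition R_cong ::
  "nat set \<Rightarrow> (nat \<Rightarrow> nat) \<Rightarrow> enat \<Rightarrow> nat \<Rightarrow> (nat \<Rightarrow> pbraid set) \<Rightarrow> (pb_arrow \<times> pb_arrow) set" where
  "R_cong C nq r q N =
     rees_congruence (IB_ideal C r) (rank_ideal C (enat q)) \<union>
     (\<Union>p\<in>{p. q + 1 \<le> p \<and> enat p \<le> r}. nu C nq p (N p))"

end

theory Submission
  imports Defs
begin

text \<open>
  A string system is a path in the space of configurations of distinct points of the plane, and two
  smooth systems are homotopic as soon as the paths are: nearby paths are joined by straight lines,
  and every path has polynomial paths with the same end points near it.  So partial braids are path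
  classes with prescribed end points, stacking is concatenation after restriction and reindexing, and
  the laws of an inverse category follow from those of path homotopy.

  Let \<open>\<sigma>\<close> be a congruence on \<open>I\<^sub>r\<close>, and let two \<open>\<sigma>\<close>-related partial braids have different domains or
  codomains, the larger rank being \<open>p\<close>.  Then some identity \<open>e\<close> of rank \<open>p\<close> is related to a partial
  braid \<open>z\<close> of smaller rank.  Multiplying \<open>z\<close> by its conjugates under braids that induce
  transpositions lowers the rank until \<open>e\<close> is related to the empty braid, and then \<open>\<sigma>\<close> is universal
  on \<open>I\<^sub>p\<close>.  Hence if \<open>q\<close> is maximal such that \<open>\<sigma>\<close> is universal on \<open>I\<^sub>q\<close>, then above rank \<open>q\<close> related
  partial braids share domain and codomain, and \<open>\<sigma>\<close> is given in rank \<open>p\<close> by the normal subgroup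
  \<open>N\<^sub>p\<close> of those braids that are related to the identity.  Deleting one string from an element of \<open>N\<^sub>p\<close>
  with \<open>p \<ge> q + 2\<close> must again yield related pairs, which forces \<open>N\<^sub>p\<close> to be pure and to restrict into
  \<open>N\<^bsub>p-1\<^esub>\<close>.  Conversely, a pure braid commutes with deleting strings, so under these conditions the
  relation is compatible with multiplications that lower the rank.
\<close>

section \<open>Strings and configurations of points\<close>

text \<open>Each stage of a homotopy of systems is smooth while the homotopy itself is only
  continuous, so smoothness has to be restored whenever a continuous path is realised by strings,
  without moving end points. Compactness supplies the room: distinct strings keep a distance
  \<delta>, and any motion closer to them than \<delta>/2 is again free of collisions. The product
  is a union over representatives whose joined strings happen to be smooth, so such representatives
  must be produced in every pair of classes. On the algebraic side, purity and restriction start in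
  rank q+2 because deleting a string in rank q+1 lands in I_q, where parallel arrows are already
  related. The restriction condition speaks of the last string only; keeping an arbitrary set of
  strings is reduced to keeping an initial segment by conjugating with a braid of suitable
  permutation, which normality permits. The numbers n_q single out one vertex at which N_q is
  recorded; invertible partial braids between sets of positions of equal size carry it to all
  others.\<close>

definition plane :: "point \<Rightarrow> real \<times> real" where
  "plane v = (fst v, fst (snd v))"

definition lift :: "(real \<Rightarrow> real \<times> real) \<Rightarrow> curve" where
  "lift c t = (fst (c t), snd (c t), 1 - t)"

text \<open>Absent strings contribute the constant 0. A configuration is then a total function, and
  continuity in the product topology can be checked coordinate by coordinate.\<close>

definition conf :: "string_system \<Rightarrow> real \<Rightarrow> nat \<Rightarrow> real \<times> real" where
  "conf a t i = (case a i of None \<Rightarrow> 0 | Some s \<Rightarrow> plane (s t))"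

definition conf_space :: "nat set \<Rightarrow> (nat \<Rightarrow> real \<times> real) set" where
  "conf_space A = {f. inj_on f A \<and> (\<forall>i. i \<notin> A \<longrightarrow> f i = 0)}"

definition basepoint :: "nat set \<Rightarrow> (nat \<Rightarrow> nat) \<Rightarrow> nat \<Rightarrow> real \<times> real" where
  "basepoint A f i = (if i \<in> A then (real (f i), 0) else 0)"

lemma plane_lift [simp]: "plane (lift c t) = c t"
  by (simp add: plane_def lift_def)

section \<open>Smooth curves, strings and their end points\<close>

lemma smooth_curve_linear_combination:
  assumes "smooth_curve s" "smooth_curve s'"
  shows "smooth_curve (\<lambda>t. c *\<^sub>R s t + d *\<^sub>R s' t)"
proof -
  from assms obtain g g' where
    g: "\<forall>t\<in>{0..1}. g 0 t = s t" "\<And>k t. t \<in> {0..1} \<Longrightarrow> (g k has_vector_derivative g (Suc k) t) (at t within {0..1})"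
    and g': "\<forall>t\<in>{0..1}. g' 0 t = s' t" "\<And>k t. t \<in> {0..1} \<Longrightarrow> (g' k has_vector_derivative g' (Suc k) t) (at t within {0..1})"
    unfolding smooth_curve_def by metis
  show ?thesis unfolding smooth_curve_def
  proof (intro exI[of _ "\<lambda>k t. c *\<^sub>R g k t + d *\<^sub>R g' k t"] conjI ballI allI)
    fix k and t :: real assume "t \<in> {0..1}"
    note [derivative_intros] = g(2)[OF this] g'(2)[OF this]
    show "((\<lambda>t. c *\<^sub>R g k t + d *\<^sub>R g' k t) has_vector_derivative
           c *\<^sub>R g (Suc k) t + d *\<^sub>R g' (Suc k) t) (at t within {0..1})"
      by (auto intro!: derivative_eq_intros)
  qed (use g g' in auto)
qed

lemma smooth_curve_continuous:
  assumes "smooth_curve s" shows "continuous_on {0..1} s"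
proof -
  from assms obtain g where
    g: "\<forall>t\<in>{0..1}. g 0 t = s t" "\<And>k t. t \<in> {0..1} \<Longrightarrow> (g k has_vector_derivative g (Suc k) t) (at t within {0..1})"
    unfolding smooth_curve_def by metis
  have "continuous_on {0..1} (g 0)"
    using g(2)[of _ 0] by (intro continuous_on_vector_derivative)
  then show ?thesis by (rule continuous_on_eq) (use g(1) in auto)
qed

text \<open>The derivative of a polynomial curve is again polynomial, so iterating a chosen
  derivative operator \<open>D\<close> provides derivatives of all orders.\<close>

lemma smooth_curve_polynomial:
  assumes "polynomial_function (s :: curve)" shows "smooth_curve s"
proof -
  define D where "D p = (SOME p'. polynomial_function p' \<and> (\<forall>x. (p has_vector_derivative (p' x)) (at x)))"
    for p :: curve
  have D: "polynomial_function (D p) \<and> (\<forall>x. (p has_vector_derivative (D p x)) (at x))"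
    if "polynomial_function p" for p
  proof -
    obtain p' where "polynomial_function p' \<and> (\<forall>x. (p has_vector_derivative (p' x)) (at x))"
      using has_vector_derivative_polynomial_function[OF \<open>polynomial_function p\<close>] by metis
    then show ?thesis unfolding D_def
      using someI[of "\<lambda>p'. polynomial_function p' \<and> (\<forall>x. (p has_vector_derivative (p' x)) (at x))" p'] by blast
  qed
  have P: "polynomial_function ((D ^^ k) s)" for k
    by (induction k) (use assms D in auto)
  show ?thesis unfolding smooth_curve_def
    by (rule exI[of _ "\<lambda>k. (D ^^ k) s"])
       (simp add: D[OF P] has_vector_derivative_at_within)
qed

text \<open>The height has derivative -1, which forces both injectivity and a nonzero
  velocity.\<close>

lemma is_stringI:
  assumes "smooth_curve s" and z: "\<And>t. t \<in> {0..1} \<Longrightarrow> snd (snd (s t)) = 1 - t"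
  shows "is_string s"
proof -
  have "vector_derivative s (at t within {0..1}) \<noteq> 0" if t: "t \<in> {0..1}" for t
  proof
    assume 0: "vector_derivative s (at t within {0..1}) = 0"
    obtain g where
      g: "\<forall>t\<in>{0..1}. g 0 t = s t" "\<And>k t. t \<in> {0..1} \<Longrightarrow> (g k has_vector_derivative g (Suc k) t) (at t within {0..1})"
      using assms(1) unfolding smooth_curve_def by metis
    have "(s has_vector_derivative g 1 t) (at t within {0..1})"
      using has_vector_derivative_transform[OF t, of s "g 0" "g 1 t"] g(1) g(2)[OF t, of 0] by simp
    then have "(s has_vector_derivative 0) (at t within {0..1})"
      using 0 vector_derivative_within_cbox[of 0 1 t s] t by fastforce
    then have "(s has_derivative (\<lambda>x. x *\<^sub>R 0)) (at t within {0..1})"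
      by (simp add: has_vector_derivative_def)
    from has_derivative_snd[OF has_derivative_snd[OF this]]
    have "((\<lambda>t. snd (snd (s t))) has_vector_derivative 0) (at t within {0..1})"
      by (simp add: has_vector_derivative_def)
    then have "((\<lambda>t. 1 - t) has_vector_derivative (0::real)) (at t within {0..1})"
      using has_vector_derivative_transform[OF t, of "\<lambda>t. 1 - t" "\<lambda>t. snd (snd (s t))" 0] z by simp
    moreover have "((\<lambda>t. 1 - t) has_vector_derivative (-1::real)) (at t within {0..1})"
      by (auto intro!: derivative_eq_intros)
    ultimately have "(0::real) = -1"
      using vector_derivative_unique_within_closed_interval[of 0 1 t "\<lambda>t. 1 - t" 0 "-1"] t by auto
    then show False by simp
  qed
  moreover have "inj_on s {0..1}"
  proof (rule inj_onI)
    fix t u :: real assume "t \<in> {0..1}" "u \<in> {0..1}" "s t = s u"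
    with z[of t] z[of u] have "1 - t = 1 - u" by metis
    then show "t = u" by simp
  qed
  ultimately show ?thesis using assms unfolding is_string_def smooth_embedding_def by auto
qed

lemma is_string_lift:
  assumes "polynomial_function c" shows "is_string (lift c)"
proof (rule is_stringI)
  have "polynomial_function (\<lambda>t. (fst (c t), snd (c t), 1 - t :: real))"
    using assms polynomial_function_id polynomial_function_const[of "1::real"]
    unfolding polynomial_function_iff_Basis_inner
    by (auto simp: Basis_prod_def inner_prod_def inner_Pair_0 real_polynomial_function_eq)
  then show "smooth_curve (lift c)"
    unfolding lift_def by (rule smooth_curve_polynomial)
qed (simp add: lift_def)

lemma is_string_conv:
  "is_string s \<longleftrightarrow> smooth_curve s \<and> (\<forall>t\<in>{0..1}. snd (snd (s t)) = 1 - t)"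
  using is_stringI unfolding is_string_def smooth_embedding_def by auto

text \<open>A common point has the same height on both strings and is therefore reached at the same
  parameter.\<close>

lemma disjoint_strings_iff:
  assumes "is_string s" "is_string s'"
  shows "s ` {0..1} \<inter> s' ` {0..1} = {} \<longleftrightarrow> (\<forall>t\<in>{0..1}. plane (s t) \<noteq> plane (s' t))"
proof -
  have z: "snd (snd (s t)) = 1 - t" "snd (snd (s' t)) = 1 - t" if "t \<in> {0..1}" for t
    using assms that by (auto simp: is_string_conv)
  have "s t = s' u \<longleftrightarrow> t = u \<and> plane (s t) = plane (s' u)" if "t \<in> {0..1}" "u \<in> {0..1}" for t u
    using z[of t] z[of u] that by (auto simp: plane_def prod_eq_iff)
  then show ?thesis by blast
qed

lemma is_string_system_iff:
  "is_string_system a \<longleftrightarrow>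
     finite (dom a) \<and> 0 \<notin> dom a \<and>
     (\<forall>i s. a i = Some s \<longrightarrow> is_string s \<and> s 0 = (real i, 0, 1) \<and> (\<exists>j\<ge>1. s 1 = (real j, 0, 0))) \<and>
     (\<forall>t\<in>{0..1}. inj_on (conf a t) (dom a))"
proof -
  have "(\<forall>i i' s s'. a i = Some s \<longrightarrow> a i' = Some s' \<longrightarrow> i \<noteq> i' \<longrightarrow> s ` {0..1} \<inter> s' ` {0..1} = {})
     \<longleftrightarrow> (\<forall>t\<in>{0..1}. inj_on (conf a t) (dom a))"
    if "\<forall>i s. a i = Some s \<longrightarrow> is_string s"
  proof -
    have "(\<forall>i i' s s'. a i = Some s \<longrightarrow> a i' = Some s' \<longrightarrow> i \<noteq> i' \<longrightarrow> s ` {0..1} \<inter> s' ` {0..1} = {})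
      \<longleftrightarrow> (\<forall>i i' s s'. a i = Some s \<longrightarrow> a i' = Some s' \<longrightarrow> i \<noteq> i' \<longrightarrow> (\<forall>t\<in>{0..1}. plane (s t) \<noteq> plane (s' t)))"
      by (rule iff_allI imp_cong[OF refl])+ (rule disjoint_strings_iff; use that in blast)
    also have "\<dots> \<longleftrightarrow> (\<forall>t\<in>{0..1}. inj_on (conf a t) (dom a))"
    proof (intro iffI ballI inj_onI)
      fix t i i' assume *: "\<forall>i i' s s'. a i = Some s \<longrightarrow> a i' = Some s' \<longrightarrow> i \<noteq> i' \<longrightarrow>
          (\<forall>t\<in>{0..1}. plane (s t) \<noteq> plane (s' t))" "t \<in> {0..1}" "i \<in> dom a" "i' \<in> dom a"
        "conf a t i = conf a t i'"
      then obtain s s' where "a i = Some s" "a i' = Some s'" by blast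
      with * show "i = i'" unfolding conf_def by fastforce
    next
      assume *: "\<forall>t\<in>{0..1}. inj_on (conf a t) (dom a)"
      show "\<forall>i i' s s'. a i = Some s \<longrightarrow> a i' = Some s' \<longrightarrow> i \<noteq> i' \<longrightarrow>
          (\<forall>t\<in>{0..1}. plane (s t) \<noteq> plane (s' t))"
      proof (intro allI impI ballI notI)
        fix i i' s s' and t :: real
        assume H: "a i = Some s" "a i' = Some s'" "i \<noteq> i'" "t \<in> {0..1}" "plane (s t) = plane (s' t)"
        then have "conf a t i = conf a t i'" by (simp add: conf_def)
        with * H show False by (meson domI inj_onD)
      qed
    qed
    finally show ?thesis .
  qed
  note * = this
  show ?thesis
  proof (cases "\<forall>i s. a i = Some s \<longrightarrow> is_string s")
    case True
    show ?thesis unfolding is_string_system_def *[OF True] ..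
  next
    \<comment> \<open>If some curve is not a string, the same conjunct fails on both sides.\<close>
    case False
    then have "\<not> (\<forall>i s. a i = Some s \<longrightarrow> is_string s \<and> P i s)" for P by blast
    then show ?thesis unfolding is_string_system_def by (simp only: simp_thms)
  qed
qed

lemma string_end_eqI: "s 1 = (real j, 0, 0) \<Longrightarrow> string_end s = j"
  unfolding string_end_def by auto

text \<open>The fallback \<open>i\<close> off the domain is that of \<open>braid_perm\<close>, so
  that the two agree everywhere (\<open>braid_perm_eq_ends\<close>).\<close>

definition ends :: "string_system \<Rightarrow> nat \<Rightarrow> nat" where
  "ends a i = (case a i of None \<Rightarrow> i | Some s \<Rightarrow> string_end s)"

lemma string_system_ends:
  assumes "is_string_system a" "a i = Some s"
  shows "s 1 = (real (ends a i), 0, 0)" "1 \<le> ends a i" "s 0 = (real i, 0, 1)"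
    "string_end s = ends a i"
proof -
  obtain j where j: "1 \<le> j" "s 1 = (real j, 0, 0)" "s 0 = (real i, 0, 1)"
    using assms unfolding is_string_system_def by blast
  with string_end_eqI[of s j, OF j(2)] assms(2)
  show "s 1 = (real (ends a i), 0, 0)" "1 \<le> ends a i" "s 0 = (real i, 0, 1)" "string_end s = ends a i"
    by (auto simp: ends_def)
qed

lemma conf_ends:
  assumes "is_string_system a"
  shows "conf a 0 = basepoint (dom a) id" "conf a 1 = basepoint (dom a) (ends a)"
proof -
  have "conf a 0 i = basepoint (dom a) id i \<and> conf a 1 i = basepoint (dom a) (ends a) i" for i
    using string_system_ends(1,3)[OF assms, of i]
    by (cases "a i") (simp_all add: conf_def basepoint_def plane_def domIff)
  then show "conf a 0 = basepoint (dom a) id" "conf a 1 = basepoint (dom a) (ends a)"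
    by auto
qed

lemma inj_ends:
  assumes "is_string_system a" shows "inj_on (ends a) (dom a)"
proof -
  have "inj_on (conf a 1) (dom a)" using assms by (auto simp: is_string_system_iff)
  then show ?thesis unfolding conf_ends(2)[OF assms]
    by (auto simp: inj_on_def basepoint_def)
qed

lemma path_conf:
  assumes "is_string_system a"
  shows "path (conf a)" "path_image (conf a) \<subseteq> conf_space (dom a)"
proof -
  have "continuous_on {0..1} (\<lambda>t. conf a t i)" for i
  proof (cases "a i")
    case None then show ?thesis by (simp add: conf_def)
  next
    case (Some s)
    then have "continuous_on {0..1} s"
      using assms by (auto simp: is_string_system_iff is_string_conv intro: smooth_curve_continuous)
    then show ?thesis using Some by (auto simp: conf_def plane_def intro!: continuous_intros)
  qed
  then show "path (conf a)" unfolding path_def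
    by (rule continuous_on_coordinatewise_then_product)
  show "path_image (conf a) \<subseteq> conf_space (dom a)"
  proof (clarsimp simp: path_image_def conf_space_def)
    fix t :: real assume "0 \<le> t" "t \<le> 1"
    then have "inj_on (conf a t) (dom a)" using assms by (simp add: is_string_system_iff)
    moreover have "conf a t i = 0" if "i \<notin> dom a" for i
      using that by (simp add: conf_def domIff)
    ultimately show "inj_on (conf a t) (dom a) \<and> (\<forall>i. i \<notin> dom a \<longrightarrow> conf a t i = 0)" by blast
  qed
qed

section \<open>Smooth and continuous homotopies\<close>

text \<open>Each of the finitely many pairwise distances attains a positive minimum on the compact
  set \<open>K\<close>.\<close>

lemma uniform_separation:
  fixes h :: "'a::topological_space \<Rightarrow> 'i \<Rightarrow> 'b::metric_space"
  assumes "finite A" "compact K" and cont: "\<And>i. i \<in> A \<Longrightarrow> continuous_on K (\<lambda>z. h z i)"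
    and inj: "\<And>z. z \<in> K \<Longrightarrow> inj_on (h z) A"
  obtains \<delta> where "0 < \<delta>" "\<And>z i j. z \<in> K \<Longrightarrow> i \<in> A \<Longrightarrow> j \<in> A \<Longrightarrow> i \<noteq> j \<Longrightarrow> \<delta> \<le> dist (h z i) (h z j)"
proof -
  define F where "F = {(i, j). i \<in> A \<and> j \<in> A \<and> i \<noteq> j}"
  have "F \<subseteq> A \<times> A" by (auto simp: F_def)
  then have "finite F" using \<open>finite A\<close> finite_subset by blast
  have "\<exists>d>0. \<forall>z\<in>K. d \<le> dist (h z (fst p)) (h z (snd p))" if "p \<in> F" for p
  proof (cases "K = {}")
    case True then show ?thesis by (auto intro: exI[of _ 1])
  next
    case False
    obtain i j where p: "p = (i, j)" "i \<in> A" "j \<in> A" "i \<noteq> j"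
      using \<open>p \<in> F\<close> unfolding F_def by blast
    have "continuous_on K (\<lambda>z. dist (h z i) (h z j))"
      using cont p by (intro continuous_intros) auto
    from continuous_attains_inf[OF \<open>compact K\<close> False this]
    obtain z where z: "z \<in> K" "\<And>y. y \<in> K \<Longrightarrow> dist (h z i) (h z j) \<le> dist (h y i) (h y j)" by blast
    moreover have "0 < dist (h z i) (h z j)" using inj[OF z(1)] p by (auto simp: inj_on_def)
    ultimately show ?thesis unfolding p(1) fst_conv snd_conv by blast
  qed
  then obtain d where d: "\<And>p. p \<in> F \<Longrightarrow> d p > (0::real)"
    "\<And>p z. p \<in> F \<Longrightarrow> z \<in> K \<Longrightarrow> d p \<le> dist (h z (fst p)) (h z (snd p))" by metis
  show thesis
  \<comment> \<open>The extra 1 keeps the minimum defined and positive when there is no pair of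
    distinct indices.\<close>
  proof (rule that[of "Min (insert 1 (d ` F))"])
    show "0 < Min (insert 1 (d ` F))" using \<open>finite F\<close> d(1) by simp
    fix z i j assume *: "z \<in> K" "i \<in> A" "j \<in> A" "i \<noteq> j"
    then have "(i, j) \<in> F" by (simp add: F_def)
    then have "Min (insert 1 (d ` F)) \<le> d (i, j)" using \<open>finite F\<close> by (intro Min_le) auto
    also have "\<dots> \<le> dist (h z i) (h z j)" using d(2)[OF \<open>(i, j) \<in> F\<close> *(1)] by simp
    finally show "Min (insert 1 (d ` F)) \<le> dist (h z i) (h z j)" .
  qed
qed

text \<open>If two values of \<open>g\<close> coincided, the triangle inequality would put the
  corresponding values of \<open>f\<close> closer than \<delta>.\<close>

lemma inj_on_near_separated:
  assumes "\<And>i j. i \<in> A \<Longrightarrow> j \<in> A \<Longrightarrow> i \<noteq> j \<Longrightarrow> \<delta> \<le> dist (f i) (f j)"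
    and "\<And>i. i \<in> A \<Longrightarrow> dist (g i) (f i) < \<delta> / 2"
  shows "inj_on g A"
proof (rule inj_onI, rule ccontr)
  fix i j assume *: "i \<in> A" "j \<in> A" "g i = g j" "i \<noteq> j"
  have "dist (f i) (f j) \<le> dist (g i) (f i) + dist (g j) (f j)"
    using *(3) by (metis dist_triangle3)
  with assms(1)[OF *(1,2,4)] assms(2)[OF *(1)] assms(2)[OF *(2)] show False by simp
qed

lemma dist_convex_combination_less:
  fixes x y z :: "'a::real_normed_vector"
  assumes "dist x z < e" "dist y z < e" "0 \<le> u" "u \<le> 1"
  shows "dist ((1 - u) *\<^sub>R x + u *\<^sub>R y) z < e"
  using convexD[OF convex_ball[of z e], of x y "1 - u" u] assms by (simp add: dist_commute)

section \<open>Homotopy of string systems as an equivalence relation\<close>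

lemma homotopic_systems_refl:
  assumes "is_string_system a" shows "homotopic_systems a a"
  unfolding homotopic_systems_def
proof (intro exI[of _ "\<lambda>_. a"] conjI ballI)
  fix i assume "i \<in> dom a"
  then have "continuous_on {0..1} (the (a i))"
    using assms by (auto simp: is_string_system_iff is_string_conv intro!: smooth_curve_continuous)
  then show "continuous_on ({0..1} \<times> {0..1}) (\<lambda>(u, t). the (a i) t)"
    unfolding split_beta by (intro continuous_on_compose2[OF _ continuous_on_snd]) auto
qed (use assms in auto)

lemma homotopic_systems_sym:
  assumes "homotopic_systems a b" shows "homotopic_systems b a"
proof -
  obtain H where H: "H 0 = a" "H 1 = b"
    "\<And>u. u \<in> {0..1} \<Longrightarrow> is_string_system (H u)" "\<And>u. u \<in> {0..1} \<Longrightarrow> dom (H u) = dom a"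
    "\<And>u i. u \<in> {0..1} \<Longrightarrow> i \<in> dom a \<Longrightarrow> the (H u i) 0 = the (a i) 0 \<and> the (H u i) 1 = the (a i) 1"
    "\<And>i. i \<in> dom a \<Longrightarrow> continuous_on ({0..1::real} \<times> {0..1}) (\<lambda>(u, t). the (H u i) t)"
    using assms unfolding homotopic_systems_def by blast
  have dab: "dom b = dom a" using H(2) H(4)[of 1] by simp
  show ?thesis unfolding homotopic_systems_def
  proof (intro exI[of _ "\<lambda>u. H (1 - u)"] conjI ballI)
    fix u :: real assume u: "u \<in> {0..1}"
    then have u': "1 - u \<in> {0..1}" by simp
    show "is_string_system (H (1 - u))" "dom (H (1 - u)) = dom b" using H(3,4)[OF u'] dab by auto
    fix i assume "i \<in> dom b"
    then show "the (H (1 - u) i) 0 = the (b i) 0" "the (H (1 - u) i) 1 = the (b i) 1"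
      using H(5)[OF u', of i] H(5)[of 1 i] H(2) dab by auto
  next
    fix i assume "i \<in> dom b"
    then have c: "continuous_on ({0..1} \<times> {0..1}) (\<lambda>(u, t). the (H u i) t)" using H(6) dab by simp
    have "continuous_on ({0..1} \<times> {0..1}) ((\<lambda>(u, t). the (H u i) t) \<circ> (\<lambda>z. (1 - fst z, snd z)))"
      by (intro continuous_on_compose continuous_intros continuous_on_subset[OF c]) auto
    then show "continuous_on ({0..1} \<times> {0..1}) (\<lambda>(u, t). the (H (1 - u) i) t)"
      by (simp add: o_def split_beta)
  qed (use H in auto)
qed

lemma homotopic_systems_trans:
  assumes "homotopic_systems a b" "homotopic_systems b c" shows "homotopic_systems a c"
proof -
  obtain H where H: "H 0 = a" "H 1 = b"
    "\<And>u. u \<in> {0..1} \<Longrightarrow> is_string_system (H u)" "\<And>u. u \<in> {0..1} \<Longrightarrow> dom (H u) = dom a"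
    "\<And>u i. u \<in> {0..1} \<Longrightarrow> i \<in> dom a \<Longrightarrow> the (H u i) 0 = the (a i) 0 \<and> the (H u i) 1 = the (a i) 1"
    "\<And>i. i \<in> dom a \<Longrightarrow> continuous_on ({0..1::real} \<times> {0..1}) (\<lambda>(u, t). the (H u i) t)"
    using assms(1) unfolding homotopic_systems_def by blast
  obtain K where K: "K 0 = b" "K 1 = c"
    "\<And>u. u \<in> {0..1} \<Longrightarrow> is_string_system (K u)" "\<And>u. u \<in> {0..1} \<Longrightarrow> dom (K u) = dom b"
    "\<And>u i. u \<in> {0..1} \<Longrightarrow> i \<in> dom b \<Longrightarrow> the (K u i) 0 = the (b i) 0 \<and> the (K u i) 1 = the (b i) 1"
    "\<And>i. i \<in> dom b \<Longrightarrow> continuous_on ({0..1::real} \<times> {0..1}) (\<lambda>(u, t). the (K u i) t)"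
    using assms(2) unfolding homotopic_systems_def by blast
  have dab: "dom b = dom a" using H(2) H(4)[of 1] by simp
  have eab: "the (b i) 0 = the (a i) 0" "the (b i) 1 = the (a i) 1" if "i \<in> dom a" for i
    using H(5)[of 1 i] H(2) that by auto
  show ?thesis unfolding homotopic_systems_def
  proof (intro exI[of _ "\<lambda>u. if u \<le> 1/2 then H (2 * u) else K (2 * u - 1)"] conjI ballI)
    fix u :: real assume u: "u \<in> {0..1}"
    let ?L = "if u \<le> 1/2 then H (2 * u) else K (2 * u - 1)"
    have u': "2 * u \<in> {0..1}" if "u \<le> 1/2" using that u by simp
    have u'': "2 * u - 1 \<in> {0..1}" if "\<not> u \<le> 1/2" using that u by simp
    show "is_string_system ?L" "dom ?L = dom a"
      using H(3,4)[OF u'] K(3,4)[OF u''] dab by auto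
    fix i assume i: "i \<in> dom a"
    show "the (?L i) 0 = the (a i) 0" "the (?L i) 1 = the (a i) 1"
      using H(5)[OF u' i] K(5)[OF u'', of i] dab eab[OF i] i by auto
  next
    fix i assume i: "i \<in> dom a"
    let ?H = "\<lambda>(u, t). the (H u i) t" and ?K = "\<lambda>(u, t). the (K u i) t"
    have c: "continuous_on ({0..1} \<times> {0..1}) ?H" "continuous_on ({0..1} \<times> {0..1}) ?K"
      using H(6) K(6) dab i by auto
    have 1: "continuous_on ({0..1/2} \<times> {0..1}) (?H \<circ> (\<lambda>z. (2 * fst z, snd z)))"
      by (intro continuous_on_compose continuous_intros continuous_on_subset[OF c(1)]) auto
    have 2: "continuous_on ({1/2..1} \<times> {0..1}) (?K \<circ> (\<lambda>z. (2 * fst z - 1, snd z)))"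
      by (intro continuous_on_compose continuous_intros continuous_on_subset[OF c(2)]) auto
    have U: "{0..1::real} \<times> {0..1::real} = {0..1/2} \<times> {0..1} \<union> {1/2..1} \<times> {0..1}"
      by auto
    have "continuous_on ({0..1/2} \<times> {0..1} \<union> {1/2..1} \<times> {0..1::real})
        (\<lambda>z. if fst z \<le> 1/2 then (?H \<circ> (\<lambda>z. (2 * fst z, snd z))) z else (?K \<circ> (\<lambda>z. (2 * fst z - 1, snd z))) z)"
    proof (rule continuous_on_cases[OF _ _ 1 2])
      show "\<forall>z. z \<in> {0..1/2} \<times> {0..1} \<and> \<not> fst z \<le> 1/2 \<or> z \<in> {1/2..1} \<times> {0..1::real} \<and> fst z \<le> 1/2 \<longrightarrow>
        (?H \<circ> (\<lambda>z. (2 * fst z, snd z))) z = (?K \<circ> (\<lambda>z. (2 * fst z - 1, snd z))) z"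
      proof (intro allI impI)
        fix z :: "real \<times> real"
        assume "z \<in> {0..1/2} \<times> {0..1} \<and> \<not> fst z \<le> 1/2 \<or> z \<in> {1/2..1} \<times> {0..1} \<and> fst z \<le> 1/2"
        then obtain t where "z = (1/2, t)" by (cases z) auto
        then show "(?H \<circ> (\<lambda>z. (2 * fst z, snd z))) z = (?K \<circ> (\<lambda>z. (2 * fst z - 1, snd z))) z"
          using H(2) K(1) by simp
      qed
    qed (auto intro!: closed_Times)
    then have "continuous_on ({0..1} \<times> {0..1})
        (\<lambda>z. if fst z \<le> 1/2 then (?H \<circ> (\<lambda>z. (2 * fst z, snd z))) z else (?K \<circ> (\<lambda>z. (2 * fst z - 1, snd z))) z)"
      unfolding U[symmetric] .
    then show "continuous_on ({0..1} \<times> {0..1})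
        (\<lambda>(u, t). the ((if u \<le> 1/2 then H (2 * u) else K (2 * u - 1)) i) t)"
      by (rule continuous_on_eq) (simp add: split_beta)
  qed (use H K in auto)
qed

text \<open>The straight-line homotopy works: balls are convex, so interpolated strings stay within
  \<delta>/2 of \<open>f\<close> and remain disjoint. The reference motion \<open>f\<close> will be
  one of the two systems or a stage of a continuous homotopy.\<close>

lemma homotopic_systems_close:
  assumes a: "is_string_system a" and b: "is_string_system b" and dom: "dom b = dom a"
    and ends: "\<And>i. i \<in> dom a \<Longrightarrow> ends b i = ends a i"
    and sep: "\<And>t i j. t \<in> {0..1} \<Longrightarrow> i \<in> dom a \<Longrightarrow> j \<in> dom a \<Longrightarrow> i \<noteq> j \<Longrightarrow> \<delta> \<le> dist (f t i) (f t j)"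
    and ca: "\<And>t i. t \<in> {0..1} \<Longrightarrow> i \<in> dom a \<Longrightarrow> dist (conf a t i) (f t i) < \<delta> / 2"
    and cb: "\<And>t i. t \<in> {0..1} \<Longrightarrow> i \<in> dom a \<Longrightarrow> dist (conf b t i) (f t i) < \<delta> / 2"
  shows "homotopic_systems a b"
proof -
  define H where "H u i = (case a i of None \<Rightarrow> None
     | Some s \<Rightarrow> Some (\<lambda>t. (1 - u) *\<^sub>R s t + u *\<^sub>R the (b i) t))" for u :: real and i
  have H0: "H 0 = a" by (auto simp: H_def fun_eq_iff split: option.splits)
  have H1: "H 1 = b"
  proof
    fix i
    have "a i = None \<longleftrightarrow> b i = None" using dom by (metis domIff)
    then show "H 1 i = b i"
      by (cases "a i"; cases "b i") (simp_all add: H_def)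
  qed
  have dH: "dom (H u) = dom a" for u by (auto simp: H_def dom_def split: option.splits)
  have ab: "\<exists>s s'. a i = Some s \<and> b i = Some s'" if "i \<in> dom a" for i
    using that dom by (metis domD)
  have cont: "continuous_on {0..1} (the (a i))" "continuous_on {0..1} (the (b i))" if "i \<in> dom a" for i
    using ab[OF that] a b by (auto simp: is_string_system_iff is_string_conv intro!: smooth_curve_continuous)
  have e: "s' 1 = s 1" "s' 0 = s 0" if "a i = Some s" "b i = Some s'" for i s s'
    using string_system_ends[OF a that(1)] string_system_ends[OF b that(2)] ends[of i] that by (auto simp: dom_def)
  have sys: "is_string_system (H u)" if u: "u \<in> {0..1}" for u
    unfolding is_string_system_iff dH
  proof (intro conjI allI impI ballI)
    show "finite (dom a)" "0 \<notin> dom a" using a by (auto simp: is_string_system_iff)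
    fix i w assume "H u i = Some w"
    then obtain s where s: "a i = Some s" "w = (\<lambda>t. (1 - u) *\<^sub>R s t + u *\<^sub>R the (b i) t)"
      by (auto simp: H_def split: option.splits)
    then obtain s' where s': "b i = Some s'" using ab[of i] by (auto simp: dom_def)
    have ss: "is_string s" "is_string s'" using a b s(1) s' by (auto simp: is_string_system_iff)
    show "is_string w"
    proof (rule is_stringI)
      show "smooth_curve w" unfolding s(2)
        using smooth_curve_linear_combination ss s' by (auto simp: is_string_conv)
      fix t :: real assume "t \<in> {0..1}"
      then have "snd (snd (s t)) = 1 - t" "snd (snd (s' t)) = 1 - t" using ss by (auto simp: is_string_conv)
      then show "snd (snd (w t)) = 1 - t" by (simp add: s s') (simp add: algebra_simps)
    qed
    have w: "w t = s t" if "s' t = s t" for t using that unfolding s(2) s' by (simp flip: scaleR_left_distrib)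
    show "w 0 = (real i, 0, 1)" using w e[OF s(1) s'] string_system_ends[OF a s(1)] by metis
    show "\<exists>j\<ge>1. w 1 = (real j, 0, 0)" using w e[OF s(1) s'] string_system_ends[OF a s(1)] by metis
  next
    fix t :: real assume t: "t \<in> {0..1}"
    show "inj_on (conf (H u) t) (dom a)"
    proof (rule inj_on_near_separated[OF sep[OF t]])
      fix i assume i: "i \<in> dom a"
      have "conf (H u) t i = (1 - u) *\<^sub>R conf a t i + u *\<^sub>R conf b t i"
        using ab[OF i] by (auto simp: conf_def H_def plane_def)
      then show "dist (conf (H u) t i) (f t i) < \<delta> / 2"
        using dist_convex_combination_less[OF ca[OF t i] cb[OF t i], of u] u by simp
    qed
  qed
  show ?thesis unfolding homotopic_systems_def
  proof (intro exI[of _ H] conjI ballI H0 H1 sys dH)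
    fix u i assume i: "i \<in> dom a"
    obtain s s' where "a i = Some s" "b i = Some s'" using ab i by blast
    with e[OF this] show "the (H u i) 0 = the (a i) 0" "the (H u i) 1 = the (a i) 1"
      by (auto simp: H_def simp flip: scaleR_left_distrib)
  next
    fix i assume i: "i \<in> dom a"
    have "continuous_on ({0..1} \<times> {0..1}) (\<lambda>z. (1 - fst z) *\<^sub>R the (a i) (snd z) + fst z *\<^sub>R the (b i) (snd z))"
      by (intro continuous_intros continuous_on_compose2[OF cont(1)[OF i]] continuous_on_compose2[OF cont(2)[OF i]]) auto
    then show "continuous_on ({0..1} \<times> {0..1}) (\<lambda>(u, t). the (H u i) t)"
      using i by (auto simp: H_def split_beta split: option.splits)
  qed
qed

text \<open>A polynomial with the right end points is within \<open>e/2\<close> of \<open>g\<close>.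
  The bump \<open>4 * t * (1 - t)\<close> vanishes at both ends, is 1 at \<open>1/2\<close> and
  never exceeds 1, so it repairs the value at \<open>1/2\<close> at the price of another
  \<open>e/2\<close>. The exact midpoint matters when a joined string is cut into an upper and a
  lower half.\<close>

lemma polynomial_approximation_midpoint:
  fixes g :: "real \<Rightarrow> 'b::euclidean_space"
  assumes "path g" "0 < e"
  obtains c where "polynomial_function c" "c 0 = g 0" "c (1/2) = g (1/2)" "c 1 = g 1"
    "\<And>t. t \<in> {0..1} \<Longrightarrow> dist (c t) (g t) < e"
proof -
  obtain p where p: "polynomial_function p" "pathstart p = pathstart g" "pathfinish p = pathfinish g"
     "\<And>t. t \<in> {0..1} \<Longrightarrow> norm (p t - g t) < e / 2"
    using path_approx_polynomial_function[OF assms(1), of "e/2"] assms(2) by auto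
  define v where "v = g (1/2) - p (1/2)"
  have v: "norm v < e / 2" using p(4)[of "1/2"] by (simp add: v_def norm_minus_commute)
  show thesis
  proof (rule that[of "\<lambda>t. p t + (4 * t * (1 - t)) *\<^sub>R v"])
    have "polynomial_function (\<lambda>t::real. (4 *\<^sub>R t) *\<^sub>R (1 - t))"
      by (intro polynomial_function_mult polynomial_function_cmul polynomial_function_diff
          polynomial_function_const polynomial_function_id)
    then have "polynomial_function (\<lambda>t::real. 4 * t * (1 - t))" by simp
    then show "polynomial_function (\<lambda>t. p t + (4 * t * (1 - t)) *\<^sub>R v)"
      using p(1) by (intro polynomial_function_add polynomial_function_mult polynomial_function_const)
    fix t :: real assume t: "t \<in> {0..1}"
    have "4 * t * (1 - t) = 1 - (1 - 2 * t)\<^sup>2" by (simp add: power2_eq_square algebra_simps)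
    then have "4 * t * (1 - t) \<le> 1" by simp
    moreover have "0 \<le> 4 * t * (1 - t)" using t by simp
    ultimately have "norm ((4 * t * (1 - t)) *\<^sub>R v) \<le> norm v"
      by (simp add: mult_left_le_one_le)
    then have "norm ((p t - g t) + (4 * t * (1 - t)) *\<^sub>R v) < e"
      using p(4)[OF t] v norm_triangle_ineq[of "p t - g t" "(4 * t * (1 - t)) *\<^sub>R v"] by linarith
    then show "dist (p t + (4 * t * (1 - t)) *\<^sub>R v) (g t) < e"
      by (simp add: dist_norm algebra_simps)
  qed (use p in \<open>auto simp: pathstart_def pathfinish_def v_def\<close>)
qed

definition polynomial_system :: "nat set \<Rightarrow> (nat \<Rightarrow> real \<Rightarrow> real \<times> real) \<Rightarrow> string_system" where
  "polynomial_system A c i = (if i \<in> A then Some (lift (c i)) else None)"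

lemma conf_polynomial_system [simp]: "i \<in> A \<Longrightarrow> conf (polynomial_system A c) t i = c i t"
  by (simp add: conf_def polynomial_system_def)

lemma dom_polynomial_system [simp]: "dom (polynomial_system A c) = A"
  by (auto simp: polynomial_system_def split: if_splits)

lemma is_string_system_polynomial:
  assumes "finite A" "0 \<notin> A" "0 \<notin> f ` A"
    and c: "\<And>i. i \<in> A \<Longrightarrow> polynomial_function (c i)" "\<And>i. i \<in> A \<Longrightarrow> c i 0 = (real i, 0)"
      "\<And>i. i \<in> A \<Longrightarrow> c i 1 = (real (f i), 0)"
    and inj: "\<And>t. t \<in> {0..1} \<Longrightarrow> inj_on (\<lambda>i. c i t) A"
  shows "is_string_system (polynomial_system A c)" "\<And>i. i \<in> A \<Longrightarrow> ends (polynomial_system A c) i = f i"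
proof -
  show "is_string_system (polynomial_system A c)"
    unfolding is_string_system_iff dom_polynomial_system
  proof (intro conjI allI impI ballI)
    fix i s assume "polynomial_system A c i = Some s"
    then have i: "i \<in> A" and s: "s = lift (c i)" by (auto simp: polynomial_system_def split: if_splits)
    show "is_string s" unfolding s using c(1)[OF i] by (rule is_string_lift)
    show "s 0 = (real i, 0, 1)" unfolding s using c(2)[OF i] by (simp add: lift_def)
    have "1 \<le> f i" using assms(3) i by (metis image_eqI less_one not_le)
    moreover have "s 1 = (real (f i), 0, 0)" unfolding s using c(3)[OF i] by (simp add: lift_def)
    ultimately show "\<exists>j\<ge>1. s 1 = (real j, 0, 0)" by blast
  next
    fix t :: real assume "t \<in> {0..1}"
    then show "inj_on (conf (polynomial_system A c) t) A"
      using inj by (simp add: inj_on_def)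
  qed (use assms in auto)
  show "ends (polynomial_system A c) i = f i" if "i \<in> A" for i
    using that c(3)[OF that] by (auto simp: ends_def polynomial_system_def lift_def intro!: string_end_eqI)
qed

lemma conf_space_path_coordinates:
  assumes "path p" shows "path (\<lambda>t. p t i)"
  using assms unfolding path_def by (rule continuous_on_product_then_coordinatewise)

text \<open>The coordinates are approximated independently of each other; the bound \<delta>/2 on
  the error keeps the resulting strings disjoint.\<close>

lemma string_system_approximation:
  assumes "finite A" "0 \<notin> A" "0 \<notin> f ` A"
    and p: "path p" "p 0 = basepoint A id" "p 1 = basepoint A f"
    and sep: "\<And>t i j. t \<in> {0..1} \<Longrightarrow> i \<in> A \<Longrightarrow> j \<in> A \<Longrightarrow> i \<noteq> j \<Longrightarrow> \<delta> \<le> dist (p t i) (p t j)"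
    and e: "0 < e" "e \<le> \<delta> / 2"
  obtains a where "is_string_system a" "dom a = A" "\<And>i. i \<in> A \<Longrightarrow> ends a i = f i"
    "\<And>t i. t \<in> {0..1} \<Longrightarrow> i \<in> A \<Longrightarrow> dist (conf a t i) (p t i) < e"
proof -
  have "\<exists>c. polynomial_function c \<and> c 0 = p 0 i \<and> c 1 = p 1 i \<and> (\<forall>t\<in>{0..1}. dist (c t) (p t i) < e)" for i
    using polynomial_approximation_midpoint[OF conf_space_path_coordinates[OF p(1), of i] e(1)] by metis
  then obtain c where c: "\<And>i. polynomial_function (c i)" "\<And>i. c i 0 = p 0 i" "\<And>i. c i 1 = p 1 i"
    "\<And>i t. t \<in> {0..1} \<Longrightarrow> dist (c i t) (p t i) < e" by metis
  have "inj_on (\<lambda>i. c i t) A" if "t \<in> {0..1}" for t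
    by (rule inj_on_near_separated[OF sep[OF that]]) (use less_le_trans[OF c(4)[OF that] e(2)] in auto)
  from is_string_system_polynomial[OF assms(1-3) c(1) _ _ this] c p
  show thesis by (intro that[of "polynomial_system A c"]) (auto simp: basepoint_def)
qed

section \<open>Comparison of homotopies of systems with homotopies of paths\<close>

lemma homotopic_systems_imp_homotopic_paths:
  assumes "is_string_system a" "homotopic_systems a b"
  shows "dom b = dom a" "is_string_system b" "homotopic_paths (conf_space (dom a)) (conf a) (conf b)"
proof -
  obtain H where H: "H 0 = a" "H 1 = b"
    "\<And>u. u \<in> {0..1} \<Longrightarrow> is_string_system (H u)" "\<And>u. u \<in> {0..1} \<Longrightarrow> dom (H u) = dom a"
    "\<And>u i. u \<in> {0..1} \<Longrightarrow> i \<in> dom a \<Longrightarrow> the (H u i) 0 = the (a i) 0 \<and> the (H u i) 1 = the (a i) 1"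
    "\<And>i. i \<in> dom a \<Longrightarrow> continuous_on ({0..1::real} \<times> {0..1}) (\<lambda>(u, t). the (H u i) t)"
    using assms unfolding homotopic_systems_def by blast
  show "dom b = dom a" "is_string_system b" using H(2) H(3,4)[of 1] by auto
  have ceq: "conf (H u) t i = (if i \<in> dom a then plane (the (H u i) t) else 0)" if "u \<in> {0..1}" for u t i
    using H(4)[OF that] domIff[of i "H u"] domIff[of i a] by (cases "H u i") (auto simp: conf_def)
  show "homotopic_paths (conf_space (dom a)) (conf a) (conf b)" unfolding homotopic_paths
  proof (intro exI[of _ "\<lambda>(u, t). conf (H u) t"] conjI ballI)
    have "continuous_on ({0..1} \<times> {0..1}) (\<lambda>z. conf (H (fst z)) (snd z) i)" for i
    proof (cases "i \<in> dom a")
      case True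
      have "continuous_on ({0..1} \<times> {0..1}) (\<lambda>z. plane ((\<lambda>(u, t). the (H u i) t) z))"
        using H(6)[OF True] unfolding plane_def by (intro continuous_intros)
      then show ?thesis by (rule continuous_on_eq) (use True ceq in \<open>auto simp: split_beta\<close>)
    next
      case False
      have "continuous_on ({0..1} \<times> {0..1::real}) (\<lambda>z::real \<times> real. 0 :: real \<times> real)" by simp
      then show ?thesis by (rule continuous_on_eq) (use False ceq in \<open>clarsimp simp: mem_Times_iff\<close>)
    qed
    then show "continuous_on ({0..1} \<times> {0..1}) (\<lambda>(u, t). conf (H u) t)"
      unfolding split_beta by (rule continuous_on_coordinatewise_then_product)
    show "(\<lambda>(u, t). conf (H u) t) \<in> {0..1} \<times> {0..1} \<rightarrow> conf_space (dom a)"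
      using path_conf(2)[OF H(3)] H(4) by (fastforce simp: path_image_def)
    fix u :: real assume u: "u \<in> {0..1}"
    show "pathstart ((\<lambda>(u, t). conf (H u) t) \<circ> Pair u) = pathstart (conf a)"
         "pathfinish ((\<lambda>(u, t). conf (H u) t) \<circ> Pair u) = pathfinish (conf a)"
      using H(5)[OF u] ceq[OF u] ceq[of 0] H(1) by (auto simp: pathstart_def pathfinish_def fun_eq_iff)
  qed (use H in auto)
qed

text \<open>Close to each stage \<open>h (u, _)\<close> of a continuous homotopy the string systems form a nonempty family
  of pairwise homotopic systems, and the families of nearby stages overlap up to homotopy; since
  \<open>[0,1]\<close> is connected, the two ends of the homotopy give homotopic systems.\<close>

lemma homotopic_paths_imp_homotopic_systems:
  assumes a: "is_string_system a" and b: "is_string_system b" and dom: "dom b = dom a"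
    and hom: "homotopic_paths (conf_space (dom a)) (conf a) (conf b)"
  shows "homotopic_systems a b"
proof -
  define A where "A = dom a"
  have fA: "finite A" "0 \<notin> A" using a by (auto simp: A_def is_string_system_iff)
  have eA: "0 \<notin> ends a ` A" using string_system_ends(2)[OF a] unfolding A_def by force
  have "pathfinish (conf a) = pathfinish (conf b)" using hom by (rule homotopic_paths_imp_pathfinish)
  then have "basepoint A (ends a) = basepoint A (ends b)"
    using conf_ends(2)[OF a] conf_ends(2)[OF b] dom by (simp add: A_def pathfinish_def)
  then have ends: "ends b i = ends a i" if "i \<in> A" for i
    using that unfolding basepoint_def fun_eq_iff by (metis Pair_inject of_nat_eq_iff)
  obtain h where h: "continuous_on ({0..1} \<times> {0..1}) h" "\<And>z. z \<in> {0..1} \<times> {0..1} \<Longrightarrow> h z \<in> conf_space A"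
    "\<And>t. t \<in> {0..1} \<Longrightarrow> h (0, t) = conf a t" "\<And>t. t \<in> {0..1} \<Longrightarrow> h (1, t) = conf b t"
    "\<And>u. u \<in> {0..1::real} \<Longrightarrow> h (u, 0) = conf a 0" "\<And>u. u \<in> {0..1::real} \<Longrightarrow> h (u, 1) = conf a (1::real)"
    using hom unfolding homotopic_paths by (auto simp: A_def pathstart_def pathfinish_def Pi_iff)
  have hi: "continuous_on ({0..1} \<times> {0..1}) (\<lambda>z. h z i)" for i
    using h(1) by (rule continuous_on_product_then_coordinatewise)
  have K: "compact ({0..1::real} \<times> {0..1::real})" by (intro compact_Times compact_Icc)
  have inj_h: "inj_on (h z) A" if "z \<in> {0..1} \<times> {0..1}" for z
    using h(2)[OF that] unfolding conf_space_def by blast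
  obtain \<delta> where \<delta>: "0 < \<delta>" "\<And>z i j. z \<in> {0..1} \<times> {0..1} \<Longrightarrow> i \<in> A \<Longrightarrow> j \<in> A \<Longrightarrow> i \<noteq> j \<Longrightarrow> \<delta> \<le> dist (h z i) (h z j)"
    using uniform_separation[OF fA(1) K hi inj_h] by blast
  have "\<exists>\<eta>>0. \<forall>z\<in>{0..1} \<times> {0..1}. \<forall>z'\<in>{0..1} \<times> {0..1}. dist z' z < \<eta> \<longrightarrow> dist (h z' i) (h z i) < \<delta> / 4" for i
  proof -
    have "0 < \<delta> / 4" using \<delta>(1) by simp
    with compact_uniformly_continuous[OF hi K, of i] show ?thesis
      unfolding uniformly_continuous_on_def by blast
  qed
  then obtain \<eta> where \<eta>: "\<And>i. 0 < \<eta> i" "\<And>i z z'. z \<in> {0..1} \<times> {0..1} \<Longrightarrow> z' \<in> {0..1} \<times> {0..1} \<Longrightarrow>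
    dist z' z < \<eta> i \<Longrightarrow> dist (h z' i) (h z i) < \<delta> / 4" by metis
  \<comment> \<open>A single radius for all strings; the 1 covers the system without
    strings.\<close>
  define \<epsilon> where "\<epsilon> = Min (insert 1 (\<eta> ` A))"
  have \<epsilon>: "0 < \<epsilon>" "\<And>i. i \<in> A \<Longrightarrow> \<epsilon> \<le> \<eta> i" using fA \<eta>(1) by (auto simp: \<epsilon>_def)
  \<comment> \<open>Nearness is measured by \<delta>/4, not \<delta>/2: passing from stage
    \<open>v\<close> to a neighbouring stage \<open>u\<close> costs another \<delta>/4, and the sum
    must fit \<open>homotopic_systems_close\<close>.\<close>
  define Q where "Q u s \<longleftrightarrow> is_string_system s \<and> dom s = A \<and> (\<forall>i\<in>A. ends s i = ends a i) \<and>
      (\<forall>t\<in>{0..1}. \<forall>i\<in>A. dist (conf s t i) (h (u, t) i) < \<delta> / 4)" for u s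
  define R where "R u v \<longleftrightarrow> (\<forall>s s'. Q u s \<longrightarrow> Q v s' \<longrightarrow> homotopic_systems s s')" for u v
  have Q: "\<exists>s. Q u s" if u: "u \<in> {0..1}" for u
  proof -
    have "path (\<lambda>t. h (u, t))" unfolding path_def
      by (rule continuous_on_compose2[OF h(1)]) (use u in \<open>auto intro!: continuous_intros\<close>)
    then obtain s where "is_string_system s" "dom s = A" "\<And>i. i \<in> A \<Longrightarrow> ends s i = ends a i"
      "\<And>t i. t \<in> {0..1} \<Longrightarrow> i \<in> A \<Longrightarrow> dist (conf s t i) (h (u, t) i) < \<delta> / 4"
    proof (rule string_system_approximation[OF fA eA, where \<delta> = \<delta> and e = "\<delta> / 4"])
      show "h (u, 0) = basepoint A id" "h (u, 1) = basepoint A (ends a)"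
        using h(5,6)[OF u] conf_ends[OF a] by (auto simp: A_def)
      show "\<delta> \<le> dist (h (u, t) i) (h (u, t) j)"
        if "t \<in> {0..1}" "i \<in> A" "j \<in> A" "i \<noteq> j" for t i j
        using \<delta>(2) that u by simp
    qed (use \<delta>(1) in auto)
    then show ?thesis unfolding Q_def by blast
  qed
  have "R 0 1"
  proof (rule connected_equivalence_relation[of "{0..1}"])
    show "R y x" if "R x y" for x y using that homotopic_systems_sym unfolding R_def by blast
    \<comment> \<open>Transitivity needs an actual system near the middle stage, which
      \<open>Q\<close> provides.\<close>
    show "R x z" if "R x y" "R y z" "y \<in> {0..1}" for x y z
      using that Q[OF that(3)] homotopic_systems_trans unfolding R_def by blast
    fix u :: real assume u: "u \<in> {0..1}"
    have "R u v" if v: "v \<in> {0..1} \<inter> ball u \<epsilon>" for v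
      unfolding R_def
    proof (intro allI impI)
      fix s s' assume s: "Q u s" and s': "Q v s'"
      show "homotopic_systems s s'"
      proof (rule homotopic_systems_close[of s s' \<delta> "\<lambda>t. h (u, t)"])
        show "\<delta> \<le> dist (h (u, t) i) (h (u, t) j)"
          if "t \<in> {0..1}" "i \<in> dom s" "j \<in> dom s" "i \<noteq> j" for t i j
          using \<delta>(2) that u s by (simp add: Q_def)
        show "dist (conf s t i) (h (u, t) i) < \<delta> / 2" if "t \<in> {0..1}" "i \<in> dom s" for t i
        proof -
          have "dist (conf s t i) (h (u, t) i) < \<delta> / 4" using s that by (simp add: Q_def)
          then show ?thesis using \<delta>(1) by simp
        qed
        show "dist (conf s' t i) (h (u, t) i) < \<delta> / 2" if t: "t \<in> {0..1}" "i \<in> dom s" for t i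
        proof -
          have i: "i \<in> A" using s t by (simp add: Q_def)
          have "dist (conf s' t i) (h (v, t) i) < \<delta> / 4" using s' t i by (simp add: Q_def)
          moreover have "dist (h (v, t) i) (h (u, t) i) < \<delta> / 4"
          proof (rule \<eta>(2))
            show "dist (v, t) (u, t) < \<eta> i" using v \<epsilon>(2)[OF i] by (simp add: dist_Pair_Pair dist_commute)
          qed (use t u v in auto)
          ultimately show ?thesis using dist_triangle[of "conf s' t i" "h (u, t) i" "h (v, t) i"] by simp
        qed
      qed (use s s' in \<open>auto simp: Q_def\<close>)
    qed
    then show "\<exists>T. openin (top_of_set {0..1}) T \<and> u \<in> T \<and> (\<forall>x\<in>T. R u x)"
      using u \<epsilon>(1) by (intro exI[of _ "{0..1} \<inter> ball u \<epsilon>"]) (simp add: openin_open_Int)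
  qed auto
  moreover have "Q 0 a" "Q 1 b"
    using a b dom h(3,4) \<delta>(1) ends by (auto simp: Q_def A_def)
  ultimately show ?thesis unfolding R_def by blast
qed

section \<open>Partial braids as path classes\<close>

text \<open>Two reparametrizations with the same ends are linearly homotopic inside the convex
  interval, and \<open>p\<close> carries this homotopy into \<open>S\<close>. The cancellation laws
  below are instances.\<close>

lemma homotopic_paths_reparametrizations:
  assumes "path p" "path_image p \<subseteq> S"
    and "path \<phi>" "path \<psi>" "path_image \<phi> \<subseteq> {0..1}" "path_image \<psi> \<subseteq> {0..1}"
    and "\<phi> 0 = \<psi> 0" "\<phi> 1 = \<psi> 1"
  shows "homotopic_paths S (p \<circ> \<phi>) (p \<circ> \<psi>)"
proof -
  have "homotopic_paths {0..1} \<phi> \<psi>"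
  proof (rule homotopic_paths_linear)
    fix t :: real assume "t \<in> {0..1}"
    then have "\<phi> t \<in> {0..1}" "\<psi> t \<in> {0..1}" using assms(5,6) by (auto simp: path_image_def image_subset_iff)
    then show "closed_segment (\<phi> t) (\<psi> t) \<subseteq> {0..1}"
      by (intro closed_segment_subset) auto
  qed (use assms in \<open>auto simp: pathstart_def pathfinish_def\<close>)
  then show ?thesis
    by (rule homotopic_paths_continuous_image) (use assms(1,2) in \<open>auto simp: path_def path_image_def\<close>)
qed

text \<open>Waiting before or after running through \<open>p\<close> is \<open>p\<close> composed
  with \<open>max 0 (2 * t - 1)\<close> or \<open>min 1 (2 * t)\<close>.\<close>

lemma homotopic_paths_const_join:
  assumes "path p" "path_image p \<subseteq> S"
  shows "homotopic_paths S ((\<lambda>_. p 0) +++ p) p" "homotopic_paths S (p +++ (\<lambda>_. p 1)) p"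
proof -
  have "homotopic_paths S (p \<circ> (\<lambda>t. max 0 (2 * t - 1))) (p \<circ> (\<lambda>t. t))"
    by (rule homotopic_paths_reparametrizations[OF assms])
       (auto simp: path_def path_image_def intro!: continuous_intros)
  moreover have "p \<circ> (\<lambda>t. max 0 (2 * t - 1)) = (\<lambda>_. p 0) +++ p"
    by (auto simp: joinpaths_def fun_eq_iff max_def intro!: arg_cong[of _ _ p])
  ultimately show "homotopic_paths S ((\<lambda>_. p 0) +++ p) p" by (simp add: o_def)
  have "homotopic_paths S (p \<circ> (\<lambda>t. min 1 (2 * t))) (p \<circ> (\<lambda>t. t))"
    by (rule homotopic_paths_reparametrizations[OF assms])
       (auto simp: path_def path_image_def intro!: continuous_intros)
  moreover have "p \<circ> (\<lambda>t. min 1 (2 * t)) = p +++ (\<lambda>_. p 1)"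
    by (auto simp: joinpaths_def fun_eq_iff min_def intro!: arg_cong[of _ _ p])
  ultimately show "homotopic_paths S (p +++ (\<lambda>_. p 1)) p" by (simp add: o_def)
qed

text \<open>Going forth and back is \<open>p\<close> along a tent function, which has the same ends
  as a constant.\<close>

lemma homotopic_paths_join_reversepath:
  assumes "path p" "path_image p \<subseteq> S"
  shows "homotopic_paths S (p +++ reversepath p) (\<lambda>_. p 0)" "homotopic_paths S (reversepath p +++ p) (\<lambda>_. p 1)"
proof -
  have "homotopic_paths S (p \<circ> (\<lambda>t. min (2 * t) (2 - 2 * t))) (p \<circ> (\<lambda>t. 0))"
    by (rule homotopic_paths_reparametrizations[OF assms])
       (auto simp: path_def path_image_def min_le_iff_disj intro!: continuous_intros)
  moreover have "p \<circ> (\<lambda>t. min (2 * t) (2 - 2 * t)) = p +++ reversepath p"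
    by (auto simp: joinpaths_def reversepath_def fun_eq_iff min_def intro!: arg_cong[of _ _ p])
  ultimately show "homotopic_paths S (p +++ reversepath p) (\<lambda>_. p 0)" by (simp add: o_def)
  have "homotopic_paths S (p \<circ> (\<lambda>t. max (1 - 2 * t) (2 * t - 1))) (p \<circ> (\<lambda>t. 1))"
    by (rule homotopic_paths_reparametrizations[OF assms])
       (auto simp: path_def path_image_def min_le_iff_disj intro!: continuous_intros)
  moreover have "p \<circ> (\<lambda>t. max (1 - 2 * t) (2 * t - 1)) = reversepath p +++ p"
    by (auto simp: joinpaths_def reversepath_def fun_eq_iff max_def intro!: arg_cong[of _ _ p])
  ultimately show "homotopic_paths S (reversepath p +++ p) (\<lambda>_. p 1)" by (simp add: o_def)
qed

text \<open>The contravariant action of injections on configuration spaces. With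
  \<open>f = id\<close> and a smaller \<open>A\<close> it deletes strings.\<close>

definition reindex :: "nat set \<Rightarrow> (nat \<Rightarrow> nat) \<Rightarrow> (nat \<Rightarrow> real \<times> real) \<Rightarrow> nat \<Rightarrow> real \<times> real" where
  "reindex A f x i = (if i \<in> A then x (f i) else 0)"

lemma continuous_on_reindex: "continuous_on S (reindex A f)"
proof (rule continuous_on_coordinatewise_then_product)
  fix i show "continuous_on S (\<lambda>x. reindex A f x i)"
    by (cases "i \<in> A") (simp_all add: reindex_def continuous_on_product_coordinates continuous_on_subset[OF continuous_on_product_coordinates])
qed

lemma reindex_conf_space:
  "inj_on f A \<Longrightarrow> f ` A \<subseteq> B \<Longrightarrow> x \<in> conf_space B \<Longrightarrow> reindex A f x \<in> conf_space A"
  by (auto simp: conf_space_def reindex_def inj_on_def image_subset_iff)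

lemma reindex_reindex: "f ` A \<subseteq> B \<Longrightarrow> reindex A f (reindex B g x) = reindex A (g \<circ> f) x"
  by (auto simp: reindex_def fun_eq_iff image_subset_iff)

lemma reindex_cong: "(\<And>i. i \<in> A \<Longrightarrow> f i = g i) \<Longrightarrow> reindex A f = reindex A g"
  by (auto simp: reindex_def fun_eq_iff)

lemma reindex_basepoint: "f ` A \<subseteq> B \<Longrightarrow> reindex A f (basepoint B g) = basepoint A (g \<circ> f)"
  by (auto simp: reindex_def basepoint_def fun_eq_iff image_subset_iff)

lemma basepoint_cong: "(\<And>i. i \<in> A \<Longrightarrow> f i = g i) \<Longrightarrow> basepoint A f = basepoint A g"
  by (auto simp: basepoint_def fun_eq_iff)

lemma homotopic_paths_reindex:
  assumes "homotopic_paths (conf_space B) p q" "inj_on f A" "f ` A \<subseteq> B"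
  shows "homotopic_paths (conf_space A) (reindex A f \<circ> p) (reindex A f \<circ> q)"
  by (rule homotopic_paths_continuous_image[OF assms(1) continuous_on_reindex])
     (use reindex_conf_space[OF assms(2,3)] in blast)

text \<open>The analogue of \<open>homotopic_systems_close\<close> for paths that are merely
  continuous; it compares a path with its polynomial approximation.\<close>

lemma homotopic_paths_conf_close:
  assumes p: "path p" "path q" "p 0 = q 0" "p 1 = q 1"
    and 0: "\<And>t i. t \<in> {0..1} \<Longrightarrow> i \<notin> A \<Longrightarrow> p t i = 0" "\<And>t i. t \<in> {0..1} \<Longrightarrow> i \<notin> A \<Longrightarrow> q t i = 0"
    and sep: "\<And>t i j. t \<in> {0..1} \<Longrightarrow> i \<in> A \<Longrightarrow> j \<in> A \<Longrightarrow> i \<noteq> j \<Longrightarrow> \<delta> \<le> dist (q t i) (q t j)"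
    and close: "\<And>t i. t \<in> {0..1} \<Longrightarrow> i \<in> A \<Longrightarrow> dist (p t i) (q t i) < \<delta> / 2"
  shows "homotopic_paths (conf_space A) p q"
  unfolding homotopic_paths
proof (intro exI[of _ "\<lambda>z i. (1 - fst z) *\<^sub>R p (snd z) i + fst z *\<^sub>R q (snd z) i"] conjI ballI funcsetI)
  have "continuous_on ({0..1} \<times> {0..1::real}) (\<lambda>z::real \<times> real. p (snd z) i)"
       "continuous_on ({0..1} \<times> {0..1::real}) (\<lambda>z::real \<times> real. q (snd z) i)" for i
    using conf_space_path_coordinates[OF p(1), of i] conf_space_path_coordinates[OF p(2), of i]
    unfolding path_def by (auto intro!: continuous_on_compose2[OF _ continuous_on_snd])
  then show "continuous_on ({0..1} \<times> {0..1}) (\<lambda>z i. (1 - fst z) *\<^sub>R p (snd z) i + fst z *\<^sub>R q (snd z) i)"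
    by (intro continuous_on_coordinatewise_then_product continuous_intros)
  fix z :: "real \<times> real" assume "z \<in> {0..1} \<times> {0..1}"
  then obtain u t where z: "z = (u, t)" "u \<in> {0..1}" "t \<in> {0..1}" by blast
  have "inj_on (\<lambda>i. (1 - u) *\<^sub>R p t i + u *\<^sub>R q t i) A"
  proof (rule inj_on_near_separated[OF sep[OF z(3)]])
    fix i assume i: "i \<in> A"
    have "dist (q t i) (q t i) < \<delta> / 2" using le_less_trans[OF zero_le_dist close[OF z(3) i]] by simp
    with close[OF z(3) i] show "dist ((1 - u) *\<^sub>R p t i + u *\<^sub>R q t i) (q t i) < \<delta> / 2"
      using z(2) by (intro dist_convex_combination_less) auto
  qed
  then show "(\<lambda>i. (1 - fst z) *\<^sub>R p (snd z) i + fst z *\<^sub>R q (snd z) i) \<in> conf_space A"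
    using 0[OF z(3)] z by (simp add: conf_space_def)
qed (use p in \<open>auto simp: pathstart_def pathfinish_def fun_eq_iff simp flip: scaleR_left_distrib\<close>)

section \<open>The path of a partial braid and its invariants\<close>

definition pb_path :: "pbraid \<Rightarrow> real \<Rightarrow> nat \<Rightarrow> real \<times> real" where
  "pb_path A = conf (pb_rep A)"

lemma homotopy_class_eq_iff:
  assumes "is_string_system a" "is_string_system b"
  shows "homotopy_class a = homotopy_class b \<longleftrightarrow> homotopic_systems a b"
  using homotopic_systems_refl[OF assms(2)] homotopic_systems_sym homotopic_systems_trans
  unfolding homotopy_class_def by blast

lemma pb_rep_homotopy_class:
  assumes "is_string_system a"
  shows "homotopic_systems a (pb_rep (homotopy_class a))"
proof -
  have "a \<in> homotopy_class a" using homotopic_systems_refl[OF assms] by (simp add: homotopy_class_def)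
  then have "pb_rep (homotopy_class a) \<in> homotopy_class a"
    unfolding pb_rep_def using someI[of "\<lambda>b. b \<in> homotopy_class a" a] by blast
  then show ?thesis by (simp add: homotopy_class_def)
qed

lemma partial_braid_rep:
  assumes "\<alpha> \<in> partial_braids"
  shows "is_string_system (pb_rep \<alpha>)" "\<alpha> = homotopy_class (pb_rep \<alpha>)"
proof -
  obtain a where a: "is_string_system a" "\<alpha> = homotopy_class a"
    using assms unfolding partial_braids_def by blast
  have h: "homotopic_systems a (pb_rep \<alpha>)" using pb_rep_homotopy_class[OF a(1)] a(2) by simp
  then show s: "is_string_system (pb_rep \<alpha>)" by (rule homotopic_systems_imp_homotopic_paths(2)[OF a(1)])
  show "\<alpha> = homotopy_class (pb_rep \<alpha>)"
    unfolding a(2) using h homotopy_class_eq_iff[OF a(1) s] a(2) by simp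
qed

lemma braid_perm_eq_ends: "braid_perm \<alpha> = ends (pb_rep \<alpha>)"
  by (simp add: braid_perm_def ends_def fun_eq_iff)

lemma partial_braid_facts:
  assumes "\<alpha> \<in> partial_braids"
  shows finite_pb_dom: "finite (pb_dom \<alpha>)" and zero_notin_pb_dom: "0 \<notin> pb_dom \<alpha>"
    and inj_on_braid_perm: "inj_on (braid_perm \<alpha>) (pb_dom \<alpha>)"
    and pb_codom_eq: "pb_codom \<alpha> = braid_perm \<alpha> ` pb_dom \<alpha>"
    and zero_notin_pb_codom: "0 \<notin> pb_codom \<alpha>"
    and path_pb_path: "path (pb_path \<alpha>)" and path_image_pb_path: "path_image (pb_path \<alpha>) \<subseteq> conf_space (pb_dom \<alpha>)"
    and pb_path_start: "pb_path \<alpha> 0 = basepoint (pb_dom \<alpha>) id"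
    and pb_path_finish: "pb_path \<alpha> 1 = basepoint (pb_dom \<alpha>) (braid_perm \<alpha>)"
    and braid_perm_outside: "\<And>i. i \<notin> pb_dom \<alpha> \<Longrightarrow> braid_perm \<alpha> i = i"
proof -
  note s = partial_braid_rep(1)[OF assms]
  show "finite (pb_dom \<alpha>)" "0 \<notin> pb_dom \<alpha>" using s by (auto simp: pb_dom_def is_string_system_iff)
  show "inj_on (braid_perm \<alpha>) (pb_dom \<alpha>)" using inj_ends[OF s] by (simp add: braid_perm_eq_ends pb_dom_def)
  show c: "pb_codom \<alpha> = braid_perm \<alpha> ` pb_dom \<alpha>"
  proof -
    have "ran (pb_rep \<alpha>) = (\<lambda>i. the (pb_rep \<alpha> i)) ` dom (pb_rep \<alpha>)"
      by (force simp: ran_def dom_def image_iff)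
    moreover have "string_end (the (pb_rep \<alpha> i)) = braid_perm \<alpha> i" if "i \<in> dom (pb_rep \<alpha>)" for i
      using that by (auto simp: braid_perm_def)
    ultimately show ?thesis
      unfolding pb_codom_def pb_dom_def by (simp add: image_image cong: image_cong_simp)
  qed
  show "0 \<notin> pb_codom \<alpha>"
    using string_system_ends(2)[OF s] unfolding c pb_dom_def braid_perm_eq_ends by fastforce
  show "path (pb_path \<alpha>)" "path_image (pb_path \<alpha>) \<subseteq> conf_space (pb_dom \<alpha>)"
    using path_conf[OF s] by (simp_all add: pb_path_def pb_dom_def)
  show "pb_path \<alpha> 0 = basepoint (pb_dom \<alpha>) id" "pb_path \<alpha> 1 = basepoint (pb_dom \<alpha>) (braid_perm \<alpha>)"
    using conf_ends[OF s] by (simp_all add: pb_path_def pb_dom_def braid_perm_eq_ends)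
  show "braid_perm \<alpha> i = i" if "i \<notin> pb_dom \<alpha>" for i
    using that by (simp add: braid_perm_def pb_dom_def domIff)
qed

text \<open>Domain and end points are constant along a homotopy, so what is read off the arbitrary
  choice \<open>pb_rep\<close> agrees with what any representative gives.\<close>

lemma homotopy_class_facts:
  assumes a: "is_string_system a"
  shows "homotopy_class a \<in> partial_braids" "pb_dom (homotopy_class a) = dom a"
    "braid_perm (homotopy_class a) = ends a"
    "homotopic_paths (conf_space (dom a)) (pb_path (homotopy_class a)) (conf a)"
proof -
  show "homotopy_class a \<in> partial_braids" using a by (auto simp: partial_braids_def)
  note h = homotopic_systems_imp_homotopic_paths[OF a pb_rep_homotopy_class[OF a]]
  show d: "pb_dom (homotopy_class a) = dom a" using h(1) by (simp add: pb_dom_def)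
  show "homotopic_paths (conf_space (dom a)) (pb_path (homotopy_class a)) (conf a)"
    using h(3) by (simp add: pb_path_def homotopic_paths_sym)
  have "pathfinish (conf a) = pathfinish (conf (pb_rep (homotopy_class a)))"
    using h(3) by (rule homotopic_paths_imp_pathfinish)
  then have e: "basepoint (dom a) (ends a) = basepoint (dom a) (ends (pb_rep (homotopy_class a)))"
    using conf_ends(2)[OF a] conf_ends(2)[OF h(2)] h(1) by (simp add: pathfinish_def)
  show "braid_perm (homotopy_class a) = ends a"
  proof
    fix i show "braid_perm (homotopy_class a) i = ends a i"
    proof (cases "i \<in> dom a")
      case True
      with fun_cong[OF e, of i] show ?thesis by (simp add: braid_perm_eq_ends basepoint_def)
    next
      case False
      then have "a i = None" "pb_rep (homotopy_class a) i = None" using h(1) by blast+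
      then show ?thesis by (simp add: braid_perm_eq_ends ends_def)
    qed
  qed
qed

text \<open>Reduces equality of partial braids to homotopy of continuous paths. The laws for
  products, identities, inverses and restrictions are all obtained through it.\<close>

lemma partial_braid_eqI:
  assumes "\<alpha> \<in> partial_braids" "\<beta> \<in> partial_braids" "pb_dom \<beta> = pb_dom \<alpha>"
    "homotopic_paths (conf_space (pb_dom \<alpha>)) (pb_path \<alpha>) (pb_path \<beta>)"
  shows "\<alpha> = \<beta>"
proof -
  have "homotopic_systems (pb_rep \<alpha>) (pb_rep \<beta>)"
    using assms by (intro homotopic_paths_imp_homotopic_systems partial_braid_rep)
      (simp_all add: pb_dom_def pb_path_def)
  then show ?thesis
    using partial_braid_rep[OF assms(1)] partial_braid_rep[OF assms(2)] homotopy_class_eq_iff by metis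
qed

text \<open>Every path class with admissible ends comes from a partial braid: a polynomial system
  within half the separation of \<open>p\<close> is joined to \<open>p\<close> by straight
  lines.\<close>

lemma partial_braid_of_path:
  assumes A: "finite A" "0 \<notin> A" "0 \<notin> f ` A"
    and p: "path p" "path_image p \<subseteq> conf_space A" "p 0 = basepoint A id" "p 1 = basepoint A f"
  obtains \<alpha> where "\<alpha> \<in> partial_braids" "pb_dom \<alpha> = A" "\<And>i. i \<in> A \<Longrightarrow> braid_perm \<alpha> i = f i"
    "homotopic_paths (conf_space A) (pb_path \<alpha>) p"
proof -
  have pt: "p t \<in> conf_space A" if "t \<in> {0..1}" for t using p(2) that by (auto simp: path_image_def)
  have "continuous_on {0..1} (\<lambda>t. p t i)" for i
    using conf_space_path_coordinates[OF p(1), of i] by (simp add: path_def)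
  moreover have "inj_on (p t) A" if "t \<in> {0..1}" for t using pt[OF that] by (simp add: conf_space_def)
  ultimately obtain \<delta> where \<delta>: "0 < \<delta>"
    "\<And>t i j. t \<in> {0..1} \<Longrightarrow> i \<in> A \<Longrightarrow> j \<in> A \<Longrightarrow> i \<noteq> j \<Longrightarrow> \<delta> \<le> dist (p t i) (p t j)"
    using uniform_separation[OF A(1) compact_Icc, of 0 1 p] by blast
  obtain a where a: "is_string_system a" "dom a = A" "\<And>i. i \<in> A \<Longrightarrow> ends a i = f i"
    "\<And>t i. t \<in> {0..1} \<Longrightarrow> i \<in> A \<Longrightarrow> dist (conf a t i) (p t i) < \<delta> / 2"
    by (rule string_system_approximation[OF A p(1,3,4) \<delta>(2), of "\<delta> / 2"]) (use \<delta>(1) in auto)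
  have "homotopic_paths (conf_space A) (conf a) p"
  proof (rule homotopic_paths_conf_close[OF path_conf(1)[OF a(1)] p(1) _ _ _ _ \<delta>(2) a(4)])
    show "conf a 0 = p 0" using conf_ends(1)[OF a(1)] p(3) a(2) by simp
    show "conf a 1 = p 1" using conf_ends(2)[OF a(1)] p(4) a(2) basepoint_cong[of A "ends a" f] a(3) by simp
    show "conf a t i = 0" if "i \<notin> A" for t i
    proof -
      have "a i = None" using that a(2) by (metis domIff)
      then show ?thesis by (simp add: conf_def)
    qed
    show "p t i = 0" if "t \<in> {0..1}" "i \<notin> A" for t i using pt[OF that(1)] that(2) by (simp add: conf_space_def)
  qed
  then show thesis
    using homotopy_class_facts[OF a(1)] a(2,3) homotopic_paths_trans
    by (intro that[of "homotopy_class a"]) auto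
qed

text \<open>In a product, a string of the lower factor carries the label of the upper string that it
  continues; \<open>pull\<close> performs this relabelling.\<close>

definition pull :: "nat set \<Rightarrow> (nat \<Rightarrow> nat) \<Rightarrow> pbraid \<Rightarrow> real \<Rightarrow> nat \<Rightarrow> real \<times> real" where
  "pull D f \<alpha> = reindex D f \<circ> pb_path \<alpha>"

section \<open>Stacking and the product\<close>

lemma dom_stack: "dom (stack a b) = {i \<in> dom a. ends a i \<in> dom b}"
  by (auto simp: stack_def ends_def dom_def split: option.splits)

text \<open>\<open>join_strings\<close> and \<open>+++\<close> use the same parametrization with the
  break at \<open>1/2\<close>, so this is an equality of paths and not just a homotopy.\<close>

lemma conf_stack:
  "conf (stack a b) = (reindex (dom (stack a b)) id \<circ> conf a) +++ (reindex (dom (stack a b)) (ends a) \<circ> conf b)"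
proof (intro ext)
  fix t i
  show "conf (stack a b) t i =
    ((reindex (dom (stack a b)) id \<circ> conf a) +++ (reindex (dom (stack a b)) (ends a) \<circ> conf b)) t i"
  proof (cases "i \<in> dom (stack a b)")
    case False
    then have "stack a b i = None" by (simp add: domIff)
    then show ?thesis using False by (simp add: conf_def joinpaths_def reindex_def)
  next
    case True
    then obtain s s' where s: "a i = Some s" "b (ends a i) = Some s'"
      unfolding dom_stack by blast
    then have e: "string_end s = ends a i" by (simp add: ends_def)
    then have "stack a b i = Some (join_strings s s')" using s by (simp add: stack_def)
    then show ?thesis using True s
      by (auto simp: conf_def joinpaths_def reindex_def plane_def join_strings_def split: prod.splits)
  qed
qed

lemma ends_stack:
  assumes "is_string_system a" "is_string_system b" "i \<in> dom (stack a b)"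
  shows "ends (stack a b) i = ends b (ends a i)"
proof -
  obtain s s' where s: "a i = Some s" "b (ends a i) = Some s'"
    using assms(3) unfolding dom_stack by blast
  then have e: "string_end s = ends a i" by (simp add: ends_def)
  have st: "stack a b i = Some (join_strings s s')" using s e by (simp add: stack_def)
  have "string_end (join_strings s s') = ends b (ends a i)"
    using string_system_ends(1)[OF assms(2) s(2)] by (intro string_end_eqI) (simp add: join_strings_def)
  then show ?thesis using st by (simp add: ends_def)
qed

text \<open>Each joined string is approximated by one polynomial with the right values at \<open>0\<close>, \<open>1/2\<close> and \<open>1\<close>,
  which is then cut at \<open>1/2\<close>: the two halves fit together smoothly without being flat at their ends.\<close>

lemma stackable_representatives:
  assumes a: "is_string_system a" and b: "is_string_system b"
  obtains a' b' where "homotopic_systems a a'" "homotopic_systems b b'" "is_string_system (stack a' b')"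
proof -
  define A where "A = dom a"
  define B where "B = dom b"
  define f where "f = ends a"
  have fin: "finite A" "finite B" "0 \<notin> A" "0 \<notin> B"
    using a b by (auto simp: A_def B_def is_string_system_iff)
  have pos: "0 \<notin> f ` A" "0 \<notin> ends b ` B"
    using string_system_ends(2)[OF a] string_system_ends(2)[OF b] unfolding A_def B_def f_def by fastforce+
  have inj: "inj_on f A" using inj_ends[OF a] by (simp add: f_def A_def)
  have ca: "continuous_on {0..1} (\<lambda>t. conf a t i)" and cb: "continuous_on {0..1} (\<lambda>t. conf b t i)" for i
    using conf_space_path_coordinates[OF path_conf(1)[OF a], of i] conf_space_path_coordinates[OF path_conf(1)[OF b], of i]
    by (simp_all add: path_def)
  have ia: "inj_on (conf a t) A" and ib: "inj_on (conf b t) B" if "t \<in> {0..1}" for t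
    using a b that by (auto simp: A_def B_def is_string_system_iff)
  obtain \<delta>1 where \<delta>1: "0 < \<delta>1"
    "\<And>t i j. t \<in> {0..1} \<Longrightarrow> i \<in> A \<Longrightarrow> j \<in> A \<Longrightarrow> i \<noteq> j \<Longrightarrow> \<delta>1 \<le> dist (conf a t i) (conf a t j)"
    using uniform_separation[OF fin(1) compact_Icc ca ia] by blast
  obtain \<delta>2 where \<delta>2: "0 < \<delta>2"
    "\<And>t i j. t \<in> {0..1} \<Longrightarrow> i \<in> B \<Longrightarrow> j \<in> B \<Longrightarrow> i \<noteq> j \<Longrightarrow> \<delta>2 \<le> dist (conf b t i) (conf b t j)"
    using uniform_separation[OF fin(2) compact_Icc cb ib] by blast
  define e where "e = min \<delta>1 \<delta>2 / 2"
  have e: "0 < e" "e \<le> \<delta>1 / 2" "e \<le> \<delta>2 / 2" using \<delta>1(1) \<delta>2(1) by (auto simp: e_def)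
  \<comment> \<open>A string of \<open>a\<close> that meets no string of \<open>b\<close> is
    continued by a constant path, so that every \<open>i\<close> in \<open>A\<close> has a full path
    to approximate; the second half of such a path does not enter the systems built below.\<close>
  define g where "g i = (\<lambda>t. conf a t i) +++ (if f i \<in> B then (\<lambda>t. conf b t (f i)) else (\<lambda>t. conf a 1 i))" for i
  have a0: "conf a 0 i = (real i, 0)" "conf a 1 i = (real (f i), 0)" if "i \<in> A" for i
    using conf_ends[OF a] that by (simp_all add: A_def f_def basepoint_def)
  have b0: "conf b 0 i = (real i, 0)" "conf b 1 i = (real (ends b i), 0)" if "i \<in> B" for i
    using conf_ends[OF b] that by (simp_all add: B_def basepoint_def)
  have "path (g i)" if "i \<in> A" for i
    unfolding g_def using ca cb a0[OF that] b0 that by (intro path_join_imp) (auto simp: path_def pathstart_def pathfinish_def)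
  then have "\<forall>i\<in>A. \<exists>c. polynomial_function c \<and> c 0 = g i 0 \<and> c (1/2) = g i (1/2) \<and> c 1 = g i 1 \<and>
      (\<forall>t\<in>{0..1}. dist (c t) (g i t) < e)"
    using polynomial_approximation_midpoint e(1) by metis
  then obtain c where c: "\<And>i. i \<in> A \<Longrightarrow> polynomial_function (c i)" "\<And>i. i \<in> A \<Longrightarrow> c i 0 = g i 0"
    "\<And>i. i \<in> A \<Longrightarrow> c i (1/2) = g i (1/2)" "\<And>i. i \<in> A \<Longrightarrow> c i 1 = g i 1"
    "\<And>i t. i \<in> A \<Longrightarrow> t \<in> {0..1} \<Longrightarrow> dist (c i t) (g i t) < e" by metis
  have "\<exists>c. polynomial_function c \<and> c 0 = conf b 0 i \<and> c 1 = conf b 1 i \<and>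
      (\<forall>t\<in>{0..1}. dist (c t) (conf b t i) < e)" for i
    using polynomial_approximation_midpoint[OF conf_space_path_coordinates[OF path_conf(1)[OF b], of i] e(1)] by metis
  then obtain d where d: "\<And>i. polynomial_function (d i)" "\<And>i. d i 0 = conf b 0 i"
    "\<And>i. d i 1 = conf b 1 i" "\<And>i t. t \<in> {0..1} \<Longrightarrow> dist (d i t) (conf b t i) < e" by metis
  have g1: "g i (t / 2) = conf a t i" if "t \<in> {0..1}" for i t
    using that by (simp add: g_def joinpaths_def)
  have g2: "g i ((t + 1) / 2) = conf b t (f i)" if "t \<in> {0..1}" "i \<in> A" "f i \<in> B" for i t
  proof (cases "t = 0")
    case True
    then show ?thesis using a0(2) b0(1) that by (simp add: g_def joinpaths_def)
  next
    case False
    then have "\<not> (t + 1) / 2 \<le> 1 / 2" using that(1) by simp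
    then show ?thesis using that(3) unfolding g_def joinpaths_def by (simp add: field_simps)
  qed
  define c1 where "c1 i t = c i (t / 2)" for i t
  \<comment> \<open>Strings of \<open>b\<close> that continue a string of \<open>a\<close> must come
    from the common polynomial \<open>c\<close>; the others are approximated separately by
    \<open>d\<close>.\<close>
  define c2 where "c2 j t = (if j \<in> f ` A then c (inv_into A f j) ((t + 1) / 2) else d j t)" for j t
  have c2f: "c2 (f i) t = c i ((t + 1) / 2)" if "i \<in> A" for i t
    using that inj by (simp add: c2_def)
  have near1: "dist (c1 i t) (conf a t i) < e" if "i \<in> A" "t \<in> {0..1}" for i t
    using c(5)[OF that(1), of "t / 2"] g1[OF that(2)] that by (simp add: c1_def)
  have near2: "dist (c2 j t) (conf b t j) < e" if "j \<in> B" "t \<in> {0..1}" for j t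
  proof (cases "j \<in> f ` A")
    case True
    then obtain i where i: "i \<in> A" "j = f i" by blast
    show ?thesis
      using c(5)[OF i(1), of "(t + 1) / 2"] g2[OF that(2) i(1)] that i(2) by (simp add: c2f[OF i(1)])
  next
    case False then show ?thesis using d(4)[OF that(2)] by (simp add: c2_def)
  qed
  have inj1: "inj_on (\<lambda>i. c1 i t) A" if "t \<in> {0..1}" for t
    by (rule inj_on_near_separated[OF \<delta>1(2)[OF that]]) (use less_le_trans[OF near1[OF _ that] e(2)] in auto)
  have inj2: "inj_on (\<lambda>i. c2 i t) B" if "t \<in> {0..1}" for t
    by (rule inj_on_near_separated[OF \<delta>2(2)[OF that]]) (use less_le_trans[OF near2[OF _ that] e(3)] in auto)
  have half: "polynomial_function (\<lambda>t::real. t / 2)" "polynomial_function (\<lambda>t::real. (t + 1) / 2)"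
  proof -
    have "polynomial_function (\<lambda>t::real. (1/2) *\<^sub>R t)" "polynomial_function (\<lambda>t::real. (1/2) *\<^sub>R (t + 1))"
      by (intro polynomial_function_cmul polynomial_function_add polynomial_function_const polynomial_function_id)+
    then show "polynomial_function (\<lambda>t::real. t / 2)" "polynomial_function (\<lambda>t::real. (t + 1) / 2)" by simp_all
  qed
  have poly1: "polynomial_function (c1 i)" if "i \<in> A" for i
    using polynomial_function_compose[OF half(1) c(1)[OF that]] by (simp add: c1_def[abs_def] o_def)
  have poly2: "polynomial_function (c2 j)" for j
  proof (cases "j \<in> f ` A")
    case True
    then obtain i where i: "i \<in> A" "j = f i" by blast
    have "c2 j = c i \<circ> (\<lambda>t. (t + 1) / 2)" using c2f[OF i(1)] i(2) by (simp add: fun_eq_iff)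
    then show ?thesis using polynomial_function_compose[OF half(2) c(1)[OF i(1)]] by simp
  next
    case False then show ?thesis using d(1) by (simp add: c2_def[abs_def])
  qed
  have c1e: "c1 i 0 = (real i, 0)" "c1 i 1 = (real (f i), 0)" if "i \<in> A" for i
    using c(2,3)[OF that] g1[of 0 i] g1[of 1 i] a0[OF that] by (simp_all add: c1_def)
  have c2e: "c2 j 0 = (real j, 0)" "c2 j 1 = (real (ends b j), 0)" if "j \<in> B" for j
  proof -
    have "c2 j 0 = conf b 0 j \<and> c2 j 1 = conf b 1 j"
    proof (cases "j \<in> f ` A")
      case True
      then obtain i where i: "i \<in> A" "j = f i" by blast
      show ?thesis
        using c(3,4)[OF i(1)] g2[OF _ i(1), of 0] g2[OF _ i(1), of 1] that i(2) by (simp add: c2f[OF i(1)])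
    next
      case False then show ?thesis using d by (simp add: c2_def)
    qed
    then show "c2 j 0 = (real j, 0)" "c2 j 1 = (real (ends b j), 0)" using b0[OF that] by auto
  qed
  define a' where "a' = polynomial_system A c1"
  define b' where "b' = polynomial_system B c2"
  have a': "is_string_system a'" "\<And>i. i \<in> A \<Longrightarrow> ends a' i = f i"
    using is_string_system_polynomial[OF fin(1,3) pos(1) poly1 c1e inj1] unfolding a'_def by blast+
  have b': "is_string_system b'" "\<And>i. i \<in> B \<Longrightarrow> ends b' i = ends b i"
    using is_string_system_polynomial[OF fin(2,4) pos(2) poly2 c2e inj2] unfolding b'_def by blast+
  have ha: "homotopic_systems a a'"
  proof (rule homotopic_systems_close[OF a a'(1), where f = "conf a" and \<delta> = \<delta>1])
    show "dist (conf a' t i) (conf a t i) < \<delta>1 / 2" if "t \<in> {0..1}" "i \<in> dom a" for t i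
      using near1[of i t] that e(2) by (simp add: a'_def A_def)
  qed (use \<delta>1 a' in \<open>auto simp: a'_def A_def f_def\<close>)
  have hb: "homotopic_systems b b'"
  proof (rule homotopic_systems_close[OF b b'(1), where f = "conf b" and \<delta> = \<delta>2])
    show "dist (conf b' t i) (conf b t i) < \<delta>2 / 2" if "t \<in> {0..1}" "i \<in> dom b" for t i
      using near2[of i t] that e(3) by (simp add: b'_def B_def)
  qed (use \<delta>2 b' in \<open>auto simp: b'_def B_def\<close>)
  define D where "D = {i \<in> A. f i \<in> B}"
  have D: "dom (stack a' b') = D"
    using a'(2) by (auto simp: dom_stack a'_def b'_def D_def)
  have st: "stack a' b' = polynomial_system D c"
  proof
    fix i show "stack a' b' i = polynomial_system D c i"
    proof (cases "i \<in> D")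
      case False
      then show ?thesis using D by (auto simp: polynomial_system_def)
    next
      case True
      then have i: "i \<in> A" "f i \<in> B" by (auto simp: D_def)
      have ai: "a' i = Some (lift (c1 i))" using i by (simp add: a'_def polynomial_system_def)
      then have "string_end (lift (c1 i)) = f i" using a'(2)[OF i(1)] by (simp add: ends_def)
      moreover have "b' (f i) = Some (lift (c2 (f i)))" using i by (simp add: b'_def polynomial_system_def)
      moreover have "join_strings (lift (c1 i)) (lift (c2 (f i))) = lift (c i)"
        by (auto simp: fun_eq_iff join_strings_def lift_def c1_def c2f[OF i(1)])
      ultimately show ?thesis using True ai by (simp add: stack_def polynomial_system_def)
    qed
  qed
  have "is_string_system (polynomial_system D c)"
  proof (rule is_string_system_polynomial(1))
    show "finite D" "0 \<notin> D" using fin by (auto simp: D_def)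
    show "0 \<notin> (ends b \<circ> f) ` D" using pos(2) by (auto simp: D_def)
    fix i assume "i \<in> D"
    then have i: "i \<in> A" "f i \<in> B" by (auto simp: D_def)
    show "polynomial_function (c i)" using c(1) i by blast
    show "c i 0 = (real i, 0)" using c1e(1)[OF i(1)] by (simp add: c1_def)
    show "c i 1 = (real ((ends b \<circ> f) i), 0)" using c2e(2)[OF i(2)] c2f[OF i(1), of 1] by simp
  next
    fix t :: real assume t: "t \<in> {0..1}"
    show "inj_on (\<lambda>i. c i t) D"
    proof (cases "t \<le> 1/2")
      case True
      then have "inj_on (\<lambda>i. c1 i (2 * t)) A" using inj1[of "2 * t"] t by simp
      then show ?thesis by (simp add: c1_def) (rule inj_on_subset, auto simp: D_def)
    next
      case False
      then have "inj_on (\<lambda>i. c2 i (2 * t - 1)) B" using inj2[of "2 * t - 1"] t by simp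
      moreover have "inj_on f D" "f ` D \<subseteq> B" using inj by (auto simp: D_def inj_on_def)
      ultimately have "inj_on ((\<lambda>i. c2 i (2 * t - 1)) \<circ> f) D" by (intro comp_inj_on) (auto intro: inj_on_subset)
      moreover have "c2 (f i) (2 * t - 1) = c i t" if "i \<in> D" for i
        using that c2f by (simp add: D_def)
      ultimately show ?thesis by (simp add: inj_on_def)
    qed
  qed
  then show thesis using that[OF ha hb] st by simp
qed

text \<open>Homotopic representatives have homotopic stacks, because reindexing and concatenation
  respect path homotopy. Hence the union defining the product consists of one class, and stackable
  representatives show that it is not an empty union.\<close>

lemma pb_mult_facts:
  assumes \<alpha>: "\<alpha> \<in> partial_braids" and \<beta>: "\<beta> \<in> partial_braids"
  shows pb_mult_closed: "pb_mult \<alpha> \<beta> \<in> partial_braids"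
    and pb_dom_mult: "pb_dom (pb_mult \<alpha> \<beta>) = {i \<in> pb_dom \<alpha>. braid_perm \<alpha> i \<in> pb_dom \<beta>}"
    and braid_perm_mult: "\<And>i. i \<in> pb_dom (pb_mult \<alpha> \<beta>) \<Longrightarrow> braid_perm (pb_mult \<alpha> \<beta>) i = braid_perm \<beta> (braid_perm \<alpha> i)"
    and pb_path_mult: "homotopic_paths (conf_space (pb_dom (pb_mult \<alpha> \<beta>))) (pb_path (pb_mult \<alpha> \<beta>))
      (pull (pb_dom (pb_mult \<alpha> \<beta>)) id \<alpha> +++ pull (pb_dom (pb_mult \<alpha> \<beta>)) (braid_perm \<alpha>) \<beta>)"
proof -
  define a where "a = pb_rep \<alpha>"
  define b where "b = pb_rep \<beta>"
  define D where "D = {i \<in> pb_dom \<alpha>. braid_perm \<alpha> i \<in> pb_dom \<beta>}"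
  define P where "P = pull D id \<alpha> +++ pull D (braid_perm \<alpha>) \<beta>"
  have a: "is_string_system a" "\<alpha> = homotopy_class a" and b: "is_string_system b" "\<beta> = homotopy_class b"
    using partial_braid_rep \<alpha> \<beta> by (auto simp: a_def b_def)
  have dab: "pb_dom \<alpha> = dom a" "pb_dom \<beta> = dom b" "braid_perm \<alpha> = ends a" "braid_perm \<beta> = ends b"
    by (auto simp: pb_dom_def a_def b_def braid_perm_eq_ends)
  have inj: "inj_on (ends a) D" "ends a ` D \<subseteq> dom b"
    using inj_ends[OF a(1)] by (auto simp: D_def dab inj_on_def)
  have facts: "is_string_system a'" "is_string_system b'" "dom (stack a' b') = D"
    "i \<in> D \<Longrightarrow> ends (stack a' b') i = ends b (ends a i)"
    "homotopic_paths (conf_space D) (conf (stack a' b')) P"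
    if ab: "homotopic_systems a a'" "homotopic_systems b b'" for a' b' i
  proof -
    note ha = homotopic_systems_imp_homotopic_paths[OF a(1) ab(1)]
    note hb = homotopic_systems_imp_homotopic_paths[OF b(1) ab(2)]
    have ab': "homotopy_class a' = \<alpha>" "homotopy_class b' = \<beta>"
      using homotopy_class_eq_iff[OF a(1) ha(2)] homotopy_class_eq_iff[OF b(1) hb(2)] ab a(2) b(2) by auto
    have ea: "ends a' = ends a" "ends b' = ends b"
      using homotopy_class_facts(3)[OF ha(2)] homotopy_class_facts(3)[OF hb(2)] ab' dab by auto
    show "is_string_system a'" "is_string_system b'" using ha hb by auto
    show D: "dom (stack a' b') = D" using ha(1) hb(1) ea by (simp add: dom_stack D_def dab)
    show "i \<in> D \<Longrightarrow> ends (stack a' b') i = ends b (ends a i)"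
      using ends_stack[OF ha(2) hb(2)] D ea by simp
    have "homotopic_paths (conf_space D) (reindex D id \<circ> conf a) (reindex D id \<circ> conf a')"
      using ha(3) by (rule homotopic_paths_reindex) (auto simp: D_def dab)
    moreover have "homotopic_paths (conf_space D) (reindex D (ends a) \<circ> conf b) (reindex D (ends a) \<circ> conf b')"
      using hb(3) inj by (rule homotopic_paths_reindex)
    moreover have "pathfinish (reindex D id \<circ> conf a) = pathstart (reindex D (ends a) \<circ> conf b)"
      using inj(2) conf_ends[OF a(1)] conf_ends[OF b(1)]
      by (auto simp: pathfinish_def pathstart_def reindex_def basepoint_def fun_eq_iff image_subset_iff D_def dab)
    ultimately have "homotopic_paths (conf_space D)
      ((reindex D id \<circ> conf a) +++ (reindex D (ends a) \<circ> conf b))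
      ((reindex D id \<circ> conf a') +++ (reindex D (ends a) \<circ> conf b'))"
      by (rule homotopic_paths_join)
    then show "homotopic_paths (conf_space D) (conf (stack a' b')) P"
      unfolding conf_stack D ea P_def pull_def pb_path_def a_def[symmetric] b_def[symmetric] dab
      by (rule homotopic_paths_sym)
  qed
  obtain a0 b0 where 0: "homotopic_systems a a0" "homotopic_systems b b0" "is_string_system (stack a0 b0)"
    using stackable_representatives[OF a(1) b(1)] by blast
  define s where "s = stack a0 b0"
  have "homotopy_class (stack a' b') = homotopy_class s"
    if "homotopic_systems a a'" "homotopic_systems b b'" "is_string_system (stack a' b')" for a' b'
  proof -
    have "homotopic_systems (stack a' b') s"
      using facts(3,5)[OF that(1,2)] facts(3,5)[OF 0(1,2)] that(3) 0(3) unfolding s_def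
      by (intro homotopic_paths_imp_homotopic_systems) (auto intro: homotopic_paths_trans homotopic_paths_sym)
    then show ?thesis using homotopy_class_eq_iff[OF that(3)] 0(3) by (simp add: s_def)
  qed
  then have "{homotopy_class (stack a b) | a b. a \<in> \<alpha> \<and> b \<in> \<beta> \<and> is_string_system (stack a b)} = {homotopy_class s}"
    unfolding a(2) b(2) homotopy_class_def[of a] homotopy_class_def[of b] mem_Collect_eq
    using 0 unfolding s_def by blast
  then have m: "pb_mult \<alpha> \<beta> = homotopy_class s" unfolding pb_mult_def by simp
  note hs = homotopy_class_facts[OF 0(3), folded s_def m]
  note f0 = facts(3-5)[OF 0(1,2), folded s_def]
  show "pb_mult \<alpha> \<beta> \<in> partial_braids" by (rule hs)
  show d: "pb_dom (pb_mult \<alpha> \<beta>) = {i \<in> pb_dom \<alpha>. braid_perm \<alpha> i \<in> pb_dom \<beta>}"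
    using hs(2) f0(1) by (simp add: D_def)
  show "braid_perm (pb_mult \<alpha> \<beta>) i = braid_perm \<beta> (braid_perm \<alpha> i)" if "i \<in> pb_dom (pb_mult \<alpha> \<beta>)" for i
    using that f0(2) hs(3) dab d by (simp add: D_def)
  show "homotopic_paths (conf_space (pb_dom (pb_mult \<alpha> \<beta>))) (pb_path (pb_mult \<alpha> \<beta>))
      (pull (pb_dom (pb_mult \<alpha> \<beta>)) id \<alpha> +++ pull (pb_dom (pb_mult \<alpha> \<beta>)) (braid_perm \<alpha>) \<beta>)"
    using homotopic_paths_trans[OF hs(4)[unfolded f0(1)] f0(3)] unfolding d P_def D_def .
qed

section \<open>The inverse category of partial braids\<close>

notation pb_mult (infixl "\<star>" 70)

lemma pull_facts:
  assumes "\<alpha> \<in> partial_braids" "inj_on f D" "f ` D \<subseteq> pb_dom \<alpha>"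
  shows path_pull: "path (pull D f \<alpha>)" and path_image_pull: "path_image (pull D f \<alpha>) \<subseteq> conf_space D"
    and pull_start: "pull D f \<alpha> 0 = basepoint D f"
    and pull_finish: "pull D f \<alpha> 1 = basepoint D (braid_perm \<alpha> \<circ> f)"
proof -
  note p = partial_braid_facts[OF assms(1)]
  show "path (pull D f \<alpha>)" unfolding pull_def
    by (rule path_continuous_image[OF path_pb_path[OF assms(1)] continuous_on_reindex])
  show "path_image (pull D f \<alpha>) \<subseteq> conf_space D"
    using path_image_pb_path[OF assms(1)] reindex_conf_space[OF assms(2,3)]
    unfolding pull_def path_image_compose by blast
  show "pull D f \<alpha> 0 = basepoint D f" "pull D f \<alpha> 1 = basepoint D (braid_perm \<alpha> \<circ> f)"
    using pb_path_start[OF assms(1)] pb_path_finish[OF assms(1)] reindex_basepoint[OF assms(3)]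
    by (simp_all add: pull_def)
qed

lemma pull_cong: "(\<And>i. i \<in> D \<Longrightarrow> f i = g i) \<Longrightarrow> pull D f \<alpha> = pull D g \<alpha>"
  unfolding pull_def by (simp add: reindex_cong[of D f g])

lemma pull_dom: "pull (pb_dom \<alpha>) id \<alpha> = pb_path \<alpha>"
proof (intro ext)
  fix t i
  show "pull (pb_dom \<alpha>) id \<alpha> t i = pb_path \<alpha> t i"
    by (cases "pb_rep \<alpha> i") (auto simp: pull_def reindex_def pb_path_def pb_dom_def conf_def domIff)
qed

text \<open>Reindexing commutes with concatenation, so the path of a product may be pulled back
  factor by factor.\<close>

lemma homotopic_paths_pull_mult:
  assumes \<alpha>: "\<alpha> \<in> partial_braids" and \<beta>: "\<beta> \<in> partial_braids"
    and f: "inj_on f D" "f ` D \<subseteq> pb_dom (\<alpha> \<star> \<beta>)"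
  shows "homotopic_paths (conf_space D) (pull D f (\<alpha> \<star> \<beta>)) (pull D f \<alpha> +++ pull D (braid_perm \<alpha> \<circ> f) \<beta>)"
proof -
  have "reindex D f \<circ> pull (pb_dom (\<alpha> \<star> \<beta>)) g \<gamma> = pull D (g \<circ> f) \<gamma>" for g \<gamma>
    using reindex_reindex[OF f(2)] by (simp add: pull_def fun_eq_iff)
  then have "reindex D f \<circ> (pull (pb_dom (\<alpha> \<star> \<beta>)) id \<alpha> +++ pull (pb_dom (\<alpha> \<star> \<beta>)) (braid_perm \<alpha>) \<beta>)
      = pull D f \<alpha> +++ pull D (braid_perm \<alpha> \<circ> f) \<beta>"
    by (simp add: path_compose_join)
  with homotopic_paths_reindex[OF pb_path_mult[OF \<alpha> \<beta>] f] show ?thesis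
    by (simp add: pull_def[of D f "\<alpha> \<star> \<beta>"])
qed

text \<open>On the set \<open>D\<close> of strings surviving through all three factors, the two
  sides are the two bracketings of the same three pulled back paths.\<close>

lemma pb_mult_assoc:
  assumes \<alpha>: "\<alpha> \<in> partial_braids" and \<beta>: "\<beta> \<in> partial_braids" and \<gamma>: "\<gamma> \<in> partial_braids"
  shows "\<alpha> \<star> \<beta> \<star> \<gamma> = \<alpha> \<star> (\<beta> \<star> \<gamma>)"
proof -
  note \<alpha>\<beta> = pb_mult_closed[OF \<alpha> \<beta>] and \<beta>\<gamma> = pb_mult_closed[OF \<beta> \<gamma>]
  let ?f = "braid_perm \<alpha>" and ?g = "braid_perm \<beta>"
  define D where "D = pb_dom (\<alpha> \<star> \<beta> \<star> \<gamma>)"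
  have D: "D = {i \<in> pb_dom \<alpha>. ?f i \<in> pb_dom \<beta> \<and> ?g (?f i) \<in> pb_dom \<gamma>}"
    using pb_dom_mult[OF \<alpha>\<beta> \<gamma>] pb_dom_mult[OF \<alpha> \<beta>] braid_perm_mult[OF \<alpha> \<beta>] by (auto simp: D_def)
  have D': "pb_dom (\<alpha> \<star> (\<beta> \<star> \<gamma>)) = D"
    using pb_dom_mult[OF \<alpha> \<beta>\<gamma>] pb_dom_mult[OF \<beta> \<gamma>] by (auto simp: D)
  have inj: "inj_on id D" "inj_on ?f D" "inj_on (?g \<circ> ?f) D"
  proof -
    show f: "inj_on ?f D" by (rule inj_on_subset[OF inj_on_braid_perm[OF \<alpha>]]) (auto simp: D)
    show "inj_on (?g \<circ> ?f) D"
      by (rule comp_inj_on[OF f]) (rule inj_on_subset[OF inj_on_braid_perm[OF \<beta>]], auto simp: D)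
  qed auto
  have sub: "id ` D \<subseteq> pb_dom (\<alpha> \<star> \<beta>)" "?f ` D \<subseteq> pb_dom (\<beta> \<star> \<gamma>)" "id ` D \<subseteq> pb_dom \<alpha>" "?f ` D \<subseteq> pb_dom \<beta>"
    "(?g \<circ> ?f) ` D \<subseteq> pb_dom \<gamma>"
    using pb_dom_mult[OF \<alpha> \<beta>] pb_dom_mult[OF \<beta> \<gamma>] by (auto simp: D)
  let ?p = "pull D id \<alpha>" and ?q = "pull D ?f \<beta>" and ?r = "pull D (?g \<circ> ?f) \<gamma>"
  note p = pull_facts[OF \<alpha> inj(1) sub(3)] and q = pull_facts[OF \<beta> inj(2) sub(4)] and r = pull_facts[OF \<gamma> inj(3) sub(5)]
  have pq: "pathfinish ?p = pathstart ?q" and qr: "pathfinish ?q = pathstart ?r"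
    using p(4) q(3,4) r(3) by (simp_all add: pathfinish_def pathstart_def)
  have "braid_perm (\<alpha> \<star> \<beta>) i = (?g \<circ> ?f) i" if "i \<in> D" for i
    using braid_perm_mult[OF \<alpha> \<beta>, of i] sub(1) that by auto
  then have r': "pull D (braid_perm (\<alpha> \<star> \<beta>)) \<gamma> = ?r" by (rule pull_cong)
  have 1: "homotopic_paths (conf_space D) (pb_path (\<alpha> \<star> \<beta> \<star> \<gamma>)) (pull D id (\<alpha> \<star> \<beta>) +++ ?r)"
    using pb_path_mult[OF \<alpha>\<beta> \<gamma>] unfolding D_def[symmetric] r' .
  have m: "pathfinish (pull D id (\<alpha> \<star> \<beta>)) = pathstart ?r"
    unfolding pathfinish_def pathstart_def r(3) pull_finish[OF \<alpha>\<beta> inj(1) sub(1)]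
    by (rule basepoint_cong) (use braid_perm_mult[OF \<alpha> \<beta>] sub(1) in auto)
  have "homotopic_paths (conf_space D) (pull D id (\<alpha> \<star> \<beta>)) (?p +++ ?q)"
    using homotopic_paths_pull_mult[OF \<alpha> \<beta> inj(1) sub(1)] by simp
  then have 2: "homotopic_paths (conf_space D) (pull D id (\<alpha> \<star> \<beta>) +++ ?r) ((?p +++ ?q) +++ ?r)"
    by (rule homotopic_paths_join) (use r m in auto)
  have 3: "homotopic_paths (conf_space D) ((?p +++ ?q) +++ ?r) (?p +++ (?q +++ ?r))"
    by (rule homotopic_paths_sym, rule homotopic_paths_assoc) (use p q r pq qr in auto)
  have 4: "homotopic_paths (conf_space D) (?p +++ pull D ?f (\<beta> \<star> \<gamma>)) (?p +++ (?q +++ ?r))"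
    using homotopic_paths_pull_mult[OF \<beta> \<gamma> inj(2) sub(2)] pull_start[OF \<beta>\<gamma> inj(2) sub(2)] p
    by (intro homotopic_paths_join) (simp_all add: pathfinish_def pathstart_def)
  have 5: "homotopic_paths (conf_space D) (pb_path (\<alpha> \<star> (\<beta> \<star> \<gamma>))) (?p +++ pull D ?f (\<beta> \<star> \<gamma>))"
    using pb_path_mult[OF \<alpha> \<beta>\<gamma>] unfolding D' .
  show ?thesis
  proof (rule partial_braid_eqI)
    show "homotopic_paths (conf_space (pb_dom (\<alpha> \<star> \<beta> \<star> \<gamma>))) (pb_path (\<alpha> \<star> \<beta> \<star> \<gamma>)) (pb_path (\<alpha> \<star> (\<beta> \<star> \<gamma>)))"
      unfolding D_def[symmetric]
      by (rule homotopic_paths_trans[OF homotopic_paths_trans[OF homotopic_paths_trans[OF 1 2] 3]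
            homotopic_paths_sym[OF homotopic_paths_trans[OF 5 4]]])
  qed (use D' D_def \<alpha> \<beta> \<gamma> in \<open>auto intro: pb_mult_closed\<close>)
qed

section \<open>Identities, restrictions and inverses\<close>

definition id_braid :: "nat set \<Rightarrow> pbraid" where
  "id_braid A = homotopy_class (\<lambda>i. if i \<in> A then Some (\<lambda>t. (real i, 0, 1 - t)) else None)"

lemma identity_braid_eq: "identity_braid n = id_braid {1..n}"
  by (simp add: identity_braid_def id_braid_def)

lemma id_braid_facts:
  assumes "finite A" "0 \<notin> A"
  shows id_braid_closed: "id_braid A \<in> partial_braids" and pb_dom_id_braid: "pb_dom (id_braid A) = A"
    and braid_perm_id_braid: "braid_perm (id_braid A) = id"
    and pb_path_id_braid: "homotopic_paths (conf_space A) (pb_path (id_braid A)) (\<lambda>_. basepoint A id)"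
proof -
  define s where "s = polynomial_system A (\<lambda>i t. (real i, 0))"
  have s: "id_braid A = homotopy_class s"
    by (auto simp: id_braid_def s_def polynomial_system_def lift_def fun_eq_iff intro!: arg_cong[of _ _ homotopy_class])
  have sys: "is_string_system s" "\<And>i. i \<in> A \<Longrightarrow> ends s i = i"
    unfolding s_def by (rule is_string_system_polynomial; use assms in \<open>auto simp: inj_on_def\<close>)+
  have d: "dom s = A" by (simp add: s_def)
  have c: "conf s = (\<lambda>_. basepoint A id)"
    by (auto simp: fun_eq_iff conf_def s_def polynomial_system_def basepoint_def)
  note h = homotopy_class_facts[OF sys(1), folded s, unfolded d c]
  show "id_braid A \<in> partial_braids" "pb_dom (id_braid A) = A"
    "homotopic_paths (conf_space A) (pb_path (id_braid A)) (\<lambda>_. basepoint A id)"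
    using h by auto
  show "braid_perm (id_braid A) = id"
  proof
    fix i show "braid_perm (id_braid A) i = id i"
      unfolding h(3) using sys(2) d by (cases "i \<in> A") (auto simp: ends_def domIff)
  qed
qed

lemma homotopic_paths_pull_id_braid:
  assumes "finite A" "0 \<notin> A" "inj_on f D" "f ` D \<subseteq> A"
  shows "homotopic_paths (conf_space D) (pull D f (id_braid A)) (\<lambda>_. basepoint D f)"
proof -
  have "reindex D f \<circ> (\<lambda>_. basepoint A id) = (\<lambda>_::real. basepoint D f)"
    using reindex_basepoint[OF assms(4), of id] by (simp add: fun_eq_iff)
  with homotopic_paths_reindex[OF pb_path_id_braid[OF assms(1,2)] assms(3,4)] show ?thesis
    by (simp add: pull_def)
qed

text \<open>Left multiplication by an identity deletes strings: what it puts in front of the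
  surviving ones is constant up to homotopy.\<close>

lemma pb_path_id_mult:
  assumes A: "finite A" "0 \<notin> A" and \<alpha>: "\<alpha> \<in> partial_braids"
  shows "pb_dom (id_braid A \<star> \<alpha>) = A \<inter> pb_dom \<alpha>"
    "homotopic_paths (conf_space (A \<inter> pb_dom \<alpha>)) (pb_path (id_braid A \<star> \<alpha>)) (pull (A \<inter> pb_dom \<alpha>) id \<alpha>)"
proof -
  note e = id_braid_facts[OF A]
  let ?D = "A \<inter> pb_dom \<alpha>"
  show d: "pb_dom (id_braid A \<star> \<alpha>) = ?D" using pb_dom_mult[OF e(1) \<alpha>] e by auto
  have sub: "id ` ?D \<subseteq> A" "id ` ?D \<subseteq> pb_dom \<alpha>" by auto
  note p = pull_facts[OF \<alpha> inj_on_id sub(2)]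
  have "homotopic_paths (conf_space ?D) (pb_path (id_braid A \<star> \<alpha>)) (pull ?D id (id_braid A) +++ pull ?D id \<alpha>)"
    using pb_path_mult[OF e(1) \<alpha>] unfolding d e(3) .
  also have "homotopic_paths (conf_space ?D) (pull ?D id (id_braid A) +++ pull ?D id \<alpha>) ((\<lambda>_. basepoint ?D id) +++ pull ?D id \<alpha>)"
    using homotopic_paths_pull_id_braid[OF A inj_on_id sub(1)] p pull_finish[OF e(1) inj_on_id, of ?D]
    by (intro homotopic_paths_join) (simp_all add: pathfinish_def pathstart_def e)
  also have "homotopic_paths (conf_space ?D) ((\<lambda>_. basepoint ?D id) +++ pull ?D id \<alpha>) (pull ?D id \<alpha>)"
    using homotopic_paths_const_join(1)[OF p(1,2)] p(3) by simp
  finally show "homotopic_paths (conf_space ?D) (pb_path (id_braid A \<star> \<alpha>)) (pull ?D id \<alpha>)" .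
qed

lemma id_braid_mult:
  assumes "finite A" "0 \<notin> A" "\<alpha> \<in> partial_braids" "pb_dom \<alpha> \<subseteq> A"
  shows "id_braid A \<star> \<alpha> = \<alpha>"
proof -
  have "A \<inter> pb_dom \<alpha> = pb_dom \<alpha>" using assms(4) by blast
  with pb_path_id_mult[OF assms(1-3)]
  show ?thesis by (intro partial_braid_eqI) (simp_all add: assms pb_mult_closed id_braid_closed pull_dom)
qed

lemma mult_id_braid:
  assumes A: "finite A" "0 \<notin> A" and \<alpha>: "\<alpha> \<in> partial_braids" and cod: "pb_codom \<alpha> \<subseteq> A"
  shows "\<alpha> \<star> id_braid A = \<alpha>"
proof -
  note e = id_braid_facts[OF A]
  let ?D = "pb_dom \<alpha>" and ?f = "braid_perm \<alpha>"
  have f: "inj_on ?f ?D" "?f ` ?D \<subseteq> A" using inj_on_braid_perm[OF \<alpha>] cod pb_codom_eq[OF \<alpha>] by auto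
  have d: "pb_dom (\<alpha> \<star> id_braid A) = ?D" using pb_dom_mult[OF \<alpha> e(1)] e f(2) by auto
  have "homotopic_paths (conf_space ?D) (pb_path (\<alpha> \<star> id_braid A)) (pb_path \<alpha> +++ pull ?D ?f (id_braid A))"
    using pb_path_mult[OF \<alpha> e(1)] unfolding d pull_dom .
  also have "homotopic_paths (conf_space ?D) (pb_path \<alpha> +++ pull ?D ?f (id_braid A)) (pb_path \<alpha> +++ (\<lambda>_. basepoint ?D ?f))"
    using homotopic_paths_pull_id_braid[OF A f] path_pb_path[OF \<alpha>] path_image_pb_path[OF \<alpha>] pb_path_finish[OF \<alpha>]
      pull_start[OF e(1) f(1)] f(2)
    by (intro homotopic_paths_join) (simp_all add: pathfinish_def pathstart_def e)
  also have "homotopic_paths (conf_space ?D) (pb_path \<alpha> +++ (\<lambda>_. basepoint ?D ?f)) (pb_path \<alpha>)"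
    using homotopic_paths_const_join(2)[OF path_pb_path[OF \<alpha>] path_image_pb_path[OF \<alpha>]] pb_path_finish[OF \<alpha>] by simp
  finally show ?thesis
    by (intro partial_braid_eqI) (simp_all add: d \<alpha> e pb_mult_closed)
qed

text \<open>Expresses the geometric restriction as multiplication by an idempotent, after which
  congruences and associativity apply to it.\<close>

lemma pb_restrict_eq:
  assumes \<alpha>: "\<alpha> \<in> partial_braids"
  shows "pb_restrict m \<alpha> = id_braid {1..m} \<star> \<alpha>"
proof -
  define a where "a = pb_rep \<alpha>"
  define D where "D = {1..m} \<inter> pb_dom \<alpha>"
  have a: "is_string_system a" "\<alpha> = homotopy_class a" using partial_braid_rep[OF \<alpha>] by (simp_all add: a_def)
  have da: "dom a = pb_dom \<alpha>" by (simp add: a_def pb_dom_def)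
  have sys: "is_string_system (b |` {1..m})" "dom (b |` {1..m}) = D" "conf (b |` {1..m}) = reindex D id \<circ> conf b"
    if "is_string_system b" "dom b = pb_dom \<alpha>" for b
  proof -
    show d: "dom (b |` {1..m}) = D" using that(2) by (auto simp: D_def)
    show c: "conf (b |` {1..m}) = reindex D id \<circ> conf b"
    proof (intro ext)
      fix t i
      have "i \<in> D \<longleftrightarrow> i \<in> {1..m} \<and> b i \<noteq> None" using that(2) by (auto simp: D_def)
      then show "conf (b |` {1..m}) t i = (reindex D id \<circ> conf b) t i"
        by (auto simp: conf_def reindex_def restrict_map_def)
    qed
    have i: "inj_on (conf (b |` {1..m}) t) D" if "t \<in> {0..1}" for t
    proof -
      have "inj_on (conf b t) (dom b)" using \<open>is_string_system b\<close> that by (simp add: is_string_system_iff)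
      then have "inj_on (conf b t) D" by (rule inj_on_subset) (simp add: D_def \<open>dom b = pb_dom \<alpha>\<close>)
      then show ?thesis unfolding c by (simp add: inj_on_def reindex_def)
    qed
    have "finite D" "0 \<notin> D" by (simp_all add: D_def)
    moreover have "is_string s \<and> s 0 = (real i, 0, 1) \<and> (\<exists>j\<ge>1. s 1 = (real j, 0, 0))"
      if "(b |` {1..m}) i = Some s" for i s
    proof -
      have "b i = Some s" using that by (simp add: restrict_map_def split: if_splits)
      with \<open>is_string_system b\<close> show ?thesis unfolding is_string_system_iff by blast
    qed
    ultimately show "is_string_system (b |` {1..m})"
      unfolding is_string_system_iff[of "b |` {1..m}"] d using i by blast
  qed
  have h: "homotopic_systems (a |` {1..m}) (b |` {1..m})" if "homotopic_systems a b" for b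
  proof -
    note hb = homotopic_systems_imp_homotopic_paths[OF a(1) that]
    note sa = sys[OF a(1) da] and sb = sys[OF hb(2) hb(1)[unfolded da]]
    have "homotopic_paths (conf_space D) (reindex D id \<circ> conf a) (reindex D id \<circ> conf b)"
      using hb(3) unfolding da by (rule homotopic_paths_reindex) (auto simp: D_def)
    then show ?thesis
      by (intro homotopic_paths_imp_homotopic_systems) (simp_all only: sa sb)
  qed
  have "{homotopy_class (b |` {1..m}) | b. b \<in> \<alpha>} = {homotopy_class (a |` {1..m})}"
  proof -
    have mem: "b \<in> \<alpha> \<longleftrightarrow> homotopic_systems a b" for b
      unfolding a(2) homotopy_class_def by simp
    have "homotopy_class (b |` {1..m}) = homotopy_class (a |` {1..m})" if "b \<in> \<alpha>" for b
    proof -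
      have ab: "homotopic_systems a b" using that mem by blast
      note hb = homotopic_systems_imp_homotopic_paths(1,2)[OF a(1) ab]
      have "is_string_system (b |` {1..m})" using sys(1)[OF hb(2)] hb(1) da by simp
      with homotopy_class_eq_iff[OF sys(1)[OF a(1) da] this] h[OF ab] show ?thesis by simp
    qed
    moreover have "a \<in> \<alpha>" using mem homotopic_systems_refl[OF a(1)] by blast
    ultimately show ?thesis by blast
  qed
  then have r: "pb_restrict m \<alpha> = homotopy_class (a |` {1..m})" by (simp add: pb_restrict_def)
  note sa = sys[OF a(1) da]
  note hr = homotopy_class_facts[OF sa(1), folded r, unfolded sa(2,3)]
  have m: "finite {1..m}" "0 \<notin> {1..m}" by auto
  note e = pb_path_id_mult[OF m \<alpha>, folded D_def]
  show ?thesis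
  proof (rule partial_braid_eqI)
    show "homotopic_paths (conf_space (pb_dom (pb_restrict m \<alpha>))) (pb_path (pb_restrict m \<alpha>)) (pb_path (id_braid {1..m} \<star> \<alpha>))"
      using homotopic_paths_trans[OF hr(4) homotopic_paths_sym[OF e(2)[unfolded pull_def pb_path_def[of \<alpha>] a_def[symmetric]]]]
      unfolding hr(2) .
  qed (use hr e in \<open>simp_all add: pb_mult_closed \<alpha> id_braid_closed\<close>)
qed

text \<open>The inverse is \<alpha> run backwards. Its strings must be labelled by their upper ends,
  which are the lower ends of \<alpha>; hence the relabelling by \<open>g\<close> before the path is
  reversed.\<close>

lemma partial_braid_inverse_exists:
  assumes \<alpha>: "\<alpha> \<in> partial_braids"
  obtains \<beta> where "\<beta> \<in> partial_braids" "pb_dom \<beta> = pb_codom \<alpha>" "pb_codom \<beta> = pb_dom \<alpha>"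
    "\<alpha> \<star> \<beta> = id_braid (pb_dom \<alpha>)" "\<beta> \<star> \<alpha> = id_braid (pb_codom \<alpha>)"
proof -
  define A B f where "A = pb_dom \<alpha>" and "B = pb_codom \<alpha>" and "f = braid_perm \<alpha>"
  define g where "g = inv_into A f"
  have B: "B = f ` A" unfolding A_def B_def f_def by (rule pb_codom_eq[OF \<alpha>])
  have inj: "inj_on f A" using inj_on_braid_perm[OF \<alpha>] by (simp add: f_def A_def)
  have gf: "g (f i) = i" if "i \<in> A" for i using inj that by (simp add: g_def)
  have fg: "f (g j) = j" "g j \<in> A" if "j \<in> B" for j using that gf by (auto simp: B)
  have gB: "g ` B = A" using gf fg by (force simp: B)
  have injg: "inj_on g B" using fg by (metis inj_onI)
  have fA: "finite A" "0 \<notin> A" and fB: "finite B" "0 \<notin> B"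
    using finite_pb_dom[OF \<alpha>] zero_notin_pb_dom[OF \<alpha>] zero_notin_pb_codom[OF \<alpha>] B by (auto simp: A_def B_def)
  let ?p = "pb_path \<alpha>" and ?q = "pull B g \<alpha>"
  have p: "path ?p" "path_image ?p \<subseteq> conf_space A" "?p 0 = basepoint A id" "?p 1 = basepoint A f"
    using path_pb_path[OF \<alpha>] path_image_pb_path[OF \<alpha>] pb_path_start[OF \<alpha>] pb_path_finish[OF \<alpha>]
    by (simp_all add: A_def f_def)
  have gsub: "g ` B \<subseteq> pb_dom \<alpha>" using gB A_def by simp
  note q = pull_facts[OF \<alpha> injg gsub, folded f_def]
  have q1: "?q 1 = basepoint B id" unfolding q(4) by (rule basepoint_cong) (simp add: fg)
  have rq: "reversepath ?q 0 = ?q 1" "reversepath ?q 1 = ?q 0" by (simp_all add: reversepath_def)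
  obtain \<beta> where \<beta>: "\<beta> \<in> partial_braids" "pb_dom \<beta> = B" "\<And>i. i \<in> B \<Longrightarrow> braid_perm \<beta> i = g i"
    "homotopic_paths (conf_space B) (pb_path \<beta>) (reversepath ?q)"
    by (rule partial_braid_of_path[OF fB, of g "reversepath ?q"]) (use q q1 gB fA in \<open>auto simp: rq\<close>)
  have cod: "pb_codom \<beta> = A" using pb_codom_eq[OF \<beta>(1)] \<beta>(2,3) gB by auto
  have "\<alpha> \<star> \<beta> = id_braid A"
  proof -
    have d: "pb_dom (\<alpha> \<star> \<beta>) = A" using pb_dom_mult[OF \<alpha> \<beta>(1)] \<beta>(2) by (auto simp: B f_def A_def)
    have fB': "f ` A \<subseteq> B" by (simp add: B)
    have r: "reindex A f \<circ> reversepath ?q = reversepath ?p"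
    proof -
      have "reindex A f (?q t) = ?p t" for t
      proof -
        have "reindex A f (?q t) = reindex A (g \<circ> f) (?p t)"
          unfolding pull_def o_def[of _ "pb_path \<alpha>"] by (rule reindex_reindex[OF fB'])
        also have "\<dots> = pull (pb_dom \<alpha>) id \<alpha> t"
          using reindex_cong[of A "g \<circ> f" id] gf by (simp add: pull_def A_def)
        finally show ?thesis by (simp add: pull_dom)
      qed
      then show ?thesis by (simp add: reversepath_def fun_eq_iff)
    qed
    have "homotopic_paths (conf_space A) (pb_path (\<alpha> \<star> \<beta>)) (?p +++ pull A f \<beta>)"
      using pb_path_mult[OF \<alpha> \<beta>(1)] unfolding d by (simp add: A_def pull_dom f_def)
    also have "homotopic_paths (conf_space A) (?p +++ pull A f \<beta>) (?p +++ reversepath ?p)"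
      using homotopic_paths_reindex[OF \<beta>(4) inj fB'] p pull_start[OF \<beta>(1) inj] fB' \<beta>(2) unfolding r
      by (intro homotopic_paths_join) (simp_all add: pull_def[symmetric] pathfinish_def pathstart_def)
    also have "homotopic_paths (conf_space A) (?p +++ reversepath ?p) (\<lambda>_. basepoint A id)"
      using homotopic_paths_join_reversepath(1)[OF p(1,2)] p(3) by simp
    also have "homotopic_paths (conf_space A) (\<lambda>_. basepoint A id) (pb_path (id_braid A))"
      by (rule homotopic_paths_sym[OF pb_path_id_braid[OF fA]])
    finally show ?thesis
      by (intro partial_braid_eqI) (simp_all add: d \<alpha> \<beta> id_braid_facts[OF fA] pb_mult_closed)
  qed
  moreover have "\<beta> \<star> \<alpha> = id_braid B"
  proof -
    have d: "pb_dom (\<beta> \<star> \<alpha>) = B" using pb_dom_mult[OF \<beta>(1) \<alpha>] \<beta>(2,3) fg by (auto simp: A_def)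
    have pg: "pull B (braid_perm \<beta>) \<alpha> = ?q" by (rule pull_cong) (rule \<beta>(3))
    have "homotopic_paths (conf_space B) (pb_path (\<beta> \<star> \<alpha>)) (pb_path \<beta> +++ ?q)"
      using pb_path_mult[OF \<beta>(1) \<alpha>] pull_dom[of \<beta>] unfolding d \<beta>(2) pg by simp
    also have "homotopic_paths (conf_space B) (pb_path \<beta> +++ ?q) (reversepath ?q +++ ?q)"
      using \<beta>(4) q pb_path_finish[OF \<beta>(1)] basepoint_cong[of B "braid_perm \<beta>" g] \<beta>(2,3)
      by (intro homotopic_paths_join) (simp_all add: pathfinish_def pathstart_def)
    also have "homotopic_paths (conf_space B) (reversepath ?q +++ ?q) (\<lambda>_. basepoint B id)"
      using homotopic_paths_join_reversepath(2)[OF q(1,2)] q1 by simp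
    also have "homotopic_paths (conf_space B) (\<lambda>_. basepoint B id) (pb_path (id_braid B))"
      by (rule homotopic_paths_sym[OF pb_path_id_braid[OF fB]])
    finally show ?thesis
      by (intro partial_braid_eqI) (simp_all add: d \<alpha> \<beta> id_braid_facts[OF fB] pb_mult_closed)
  qed
  ultimately show thesis using that[OF \<beta>(1)] \<beta>(2) cod by (simp add: A_def B_def)
qed

lemma partial_braid_of_injection:
  assumes A: "finite A" "0 \<notin> A" "0 \<notin> f ` A" and inj: "inj_on f A"
  obtains \<alpha> where "\<alpha> \<in> partial_braids" "pb_dom \<alpha> = A" "\<And>i. i \<in> A \<Longrightarrow> braid_perm \<alpha> i = f i"
proof -
  \<comment> \<open>The second coordinate separates the strings except at the two ends.\<close>
  define p :: "real \<Rightarrow> nat \<Rightarrow> real \<times> real" where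
    "p t i = (if i \<in> A then ((1 - t) * real i + t * real (f i), t * (1 - t) * real i) else 0)" for t i
  have "continuous_on {0..1} (\<lambda>t. p t i)" for i
    by (cases "i \<in> A") (auto simp: p_def intro!: continuous_intros)
  then have "path p" unfolding path_def by (rule continuous_on_coordinatewise_then_product)
  moreover have "path_image p \<subseteq> conf_space A"
  proof -
    have "inj_on (p t) A" if t: "0 \<le> t" "t \<le> 1" for t
    proof (rule inj_onI)
      fix i j assume *: "i \<in> A" "j \<in> A" "p t i = p t j"
      then have e: "(1 - t) * real i + t * real (f i) = (1 - t) * real j + t * real (f j)"
        "t * (1 - t) * real i = t * (1 - t) * real j" by (auto simp: p_def)
      consider "t = 0" | "t = 1" | "t * (1 - t) \<noteq> 0" by (cases "t = 0"; cases "t = 1") auto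
      then show "i = j"
      proof cases
        case 1 then show ?thesis using e by simp
      next
        case 2
        then have "f i = f j" using e(1) by simp
        then show ?thesis using inj *(1,2) by (simp add: inj_on_eq_iff)
      next
        case 3 then show ?thesis using e(2) by simp
      qed
    qed
    then show ?thesis by (auto simp: path_image_def conf_space_def p_def)
  qed
  moreover have "p 0 = basepoint A id" "p 1 = basepoint A f"
    by (auto simp: p_def basepoint_def fun_eq_iff)
  ultimately show thesis
    using partial_braid_of_path[OF A, of p] that by blast
qed

section \<open>Domains, codomains and ranks in algebraic form\<close>

definition positions :: "nat set \<Rightarrow> bool" where
  "positions A \<longleftrightarrow> finite A \<and> 0 \<notin> A"

lemma positions_interval [simp]: "positions {1..n}" "positions {Suc 0..n}" "positions {}"
  by (auto simp: positions_def)

lemma positions_subset: "positions B \<Longrightarrow> A \<subseteq> B \<Longrightarrow> positions A"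
  unfolding positions_def using finite_subset by blast

lemma positions_dom [simp]: "\<alpha> \<in> partial_braids \<Longrightarrow> positions (pb_dom \<alpha>)"
  by (simp add: positions_def finite_pb_dom zero_notin_pb_dom)

lemma positions_codom [simp]: "\<alpha> \<in> partial_braids \<Longrightarrow> positions (pb_codom \<alpha>)"
  unfolding positions_def using zero_notin_pb_codom finite_pb_dom pb_codom_eq by (metis finite_imageI)

lemma id_braid_simps [simp]:
  assumes "positions A"
  shows "id_braid A \<in> partial_braids" "pb_dom (id_braid A) = A" "braid_perm (id_braid A) = id" "pb_codom (id_braid A) = A"
  using id_braid_facts[of A] assms pb_codom_eq[of "id_braid A"] by (simp_all add: positions_def)

lemma id_mult: "positions A \<Longrightarrow> \<alpha> \<in> partial_braids \<Longrightarrow> pb_dom \<alpha> \<subseteq> A \<Longrightarrow> id_braid A \<star> \<alpha> = \<alpha>"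
  using id_braid_mult by (simp add: positions_def)

lemma mult_id: "positions A \<Longrightarrow> \<alpha> \<in> partial_braids \<Longrightarrow> pb_codom \<alpha> \<subseteq> A \<Longrightarrow> \<alpha> \<star> id_braid A = \<alpha>"
  using mult_id_braid by (simp add: positions_def)

declare pb_mult_closed [simp]

lemma pb_codom_mult:
  assumes "\<alpha> \<in> partial_braids" "\<beta> \<in> partial_braids"
  shows "pb_codom (\<alpha> \<star> \<beta>) = braid_perm \<beta> ` (pb_codom \<alpha> \<inter> pb_dom \<beta>)"
proof -
  have "pb_codom (\<alpha> \<star> \<beta>) = (\<lambda>i. braid_perm \<beta> (braid_perm \<alpha> i)) ` pb_dom (\<alpha> \<star> \<beta>)"
    using braid_perm_mult[OF assms] by (simp add: pb_codom_eq assms)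
  also have "\<dots> = braid_perm \<beta> ` (pb_codom \<alpha> \<inter> pb_dom \<beta>)"
    by (auto simp: pb_dom_mult pb_codom_eq assms)
  finally show ?thesis .
qed

lemma card_pb_codom: "\<alpha> \<in> partial_braids \<Longrightarrow> card (pb_codom \<alpha>) = card (pb_dom \<alpha>)"
  by (simp add: pb_codom_eq card_image inj_on_braid_perm)

lemma pb_dom_mult_subset: "\<alpha> \<in> partial_braids \<Longrightarrow> \<beta> \<in> partial_braids \<Longrightarrow> pb_dom (\<alpha> \<star> \<beta>) \<subseteq> pb_dom \<alpha>"
  by (auto simp: pb_dom_mult)

lemma pb_codom_mult_subset: "\<alpha> \<in> partial_braids \<Longrightarrow> \<beta> \<in> partial_braids \<Longrightarrow> pb_codom (\<alpha> \<star> \<beta>) \<subseteq> pb_codom \<beta>"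
  using pb_codom_eq[of \<beta>] by (auto simp: pb_codom_mult)

lemma pb_dom_mono_card:
  "\<alpha> \<in> partial_braids \<Longrightarrow> B \<subseteq> pb_dom \<alpha> \<Longrightarrow> card B \<le> card (pb_dom \<alpha>)"
  by (simp add: card_mono finite_pb_dom)

lemma card_pb_dom_mult:
  assumes "\<alpha> \<in> partial_braids" "\<beta> \<in> partial_braids"
  shows "card (pb_dom (\<alpha> \<star> \<beta>)) \<le> card (pb_dom \<alpha>)" "card (pb_dom (\<alpha> \<star> \<beta>)) \<le> card (pb_dom \<beta>)"
proof -
  show "card (pb_dom (\<alpha> \<star> \<beta>)) \<le> card (pb_dom \<alpha>)"
    using assms by (intro pb_dom_mono_card pb_dom_mult_subset)
  have "card (pb_codom (\<alpha> \<star> \<beta>)) \<le> card (pb_codom \<beta>)"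
    using assms pb_codom_mult_subset[OF assms] positions_codom[OF assms(2)] by (simp add: card_mono positions_def)
  then show "card (pb_dom (\<alpha> \<star> \<beta>)) \<le> card (pb_dom \<beta>)"
    using assms by (simp add: card_pb_codom)
qed

text \<open>Without strings the default value makes every configuration the zero function, so the
  two paths coincide.\<close>

lemma empty_partial_braid:
  assumes \<alpha>: "\<alpha> \<in> partial_braids" and d: "pb_dom \<alpha> = {}"
  shows "\<alpha> = id_braid {}"
proof (rule partial_braid_eqI[OF \<alpha>])
  have "pb_path \<beta> = (\<lambda>_ _. 0)" if "pb_dom \<beta> = {}" for \<beta>
    using that by (simp add: fun_eq_iff pb_path_def pb_dom_def conf_def)
  then have "pb_path (id_braid {}) = pb_path \<alpha>" using d by simp
  then show "homotopic_paths (conf_space (pb_dom \<alpha>)) (pb_path \<alpha>) (pb_path (id_braid {}))"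
    using path_pb_path[OF \<alpha>] path_image_pb_path[OF \<alpha>] by simp
qed (simp_all add: d)

text \<open>These are the hom sets of the groupoid of invertible partial braids, whose objects are
  sets of positions.\<close>

definition braids :: "nat set \<Rightarrow> nat set \<Rightarrow> pbraid set" where
  "braids A B = {\<alpha> \<in> partial_braids. pb_dom \<alpha> = A \<and> pb_codom \<alpha> = B}"

lemma braidsD:
  assumes "\<alpha> \<in> braids A B"
  shows "\<alpha> \<in> partial_braids" "pb_dom \<alpha> = A" "pb_codom \<alpha> = B" "positions A" "positions B" "card A = card B"
proof -
  show a: "\<alpha> \<in> partial_braids" "pb_dom \<alpha> = A" "pb_codom \<alpha> = B" using assms by (simp_all add: braids_def)
  show "positions A" "positions B" "card A = card B"
    using positions_dom[OF a(1)] positions_codom[OF a(1)] card_pb_codom[OF a(1)] a(2,3) by simp_all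
qed

lemma braidsI: "\<alpha> \<in> partial_braids \<Longrightarrow> \<alpha> \<in> braids (pb_dom \<alpha>) (pb_codom \<alpha>)"
  by (simp add: braids_def)

lemma id_in_braids [simp]: "positions A \<Longrightarrow> id_braid A \<in> braids A A"
  by (simp add: braids_def)

lemma mult_braids:
  assumes "\<alpha> \<in> braids A B" "\<beta> \<in> braids B C" shows "\<alpha> \<star> \<beta> \<in> braids A C"
proof -
  note a = braidsD(1-3)[OF assms(1)] and b = braidsD(1-3)[OF assms(2)]
  have "pb_dom (\<alpha> \<star> \<beta>) = A"
    unfolding pb_dom_mult[OF a(1) b(1)] using a b pb_codom_eq[OF a(1)] by auto
  moreover have "pb_codom (\<alpha> \<star> \<beta>) = C"
    unfolding pb_codom_mult[OF a(1) b(1)] using a b pb_codom_eq[OF b(1)] by auto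
  ultimately show ?thesis using a b by (simp add: braids_def)
qed

lemma id_mult_braids:
  assumes "\<alpha> \<in> braids A B" shows "id_braid A \<star> \<alpha> = \<alpha>"
  by (rule id_mult) (simp_all add: braidsD(1,2,4)[OF assms])

lemma mult_id_braids:
  assumes "\<alpha> \<in> braids A B" shows "\<alpha> \<star> id_braid B = \<alpha>"
  by (rule mult_id) (simp_all add: braidsD(1,3,5)[OF assms])

definition pb_inv :: "pbraid \<Rightarrow> pbraid" where
  "pb_inv \<alpha> = (SOME \<beta>. \<beta> \<in> braids (pb_codom \<alpha>) (pb_dom \<alpha>) \<and>
     \<alpha> \<star> \<beta> = id_braid (pb_dom \<alpha>) \<and> \<beta> \<star> \<alpha> = id_braid (pb_codom \<alpha>))"

lemma pb_inv:
  assumes "\<alpha> \<in> braids A B"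
  shows pb_inv_in: "pb_inv \<alpha> \<in> braids B A" and mult_pb_inv: "\<alpha> \<star> pb_inv \<alpha> = id_braid A"
    and pb_inv_mult: "pb_inv \<alpha> \<star> \<alpha> = id_braid B"
proof -
  note a = braidsD[OF assms]
  let ?P = "\<lambda>\<beta>. \<beta> \<in> braids (pb_codom \<alpha>) (pb_dom \<alpha>) \<and>
     \<alpha> \<star> \<beta> = id_braid (pb_dom \<alpha>) \<and> \<beta> \<star> \<alpha> = id_braid (pb_codom \<alpha>)"
  have "\<exists>\<beta>. ?P \<beta>"
    by (rule partial_braid_inverse_exists[OF a(1)], rule exI) (simp add: braids_def)
  then have "?P (pb_inv \<alpha>)" unfolding pb_inv_def by (rule someI_ex)
  then show "pb_inv \<alpha> \<in> braids B A" "\<alpha> \<star> pb_inv \<alpha> = id_braid A" "pb_inv \<alpha> \<star> \<alpha> = id_braid B"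
    unfolding a(2,3) by blast+
qed

lemma braids_assoc:
  assumes "\<alpha> \<in> braids A B" "\<beta> \<in> braids A' B'" "\<gamma> \<in> braids A'' B''"
  shows "\<alpha> \<star> \<beta> \<star> \<gamma> = \<alpha> \<star> (\<beta> \<star> \<gamma>)"
  by (rule pb_mult_assoc) (rule braidsD(1)[OF assms(1)] braidsD(1)[OF assms(2)] braidsD(1)[OF assms(3)])+

lemma mult_inv_cancel:
  assumes "\<alpha> \<in> braids A B"
  shows "\<beta> \<in> partial_braids \<Longrightarrow> pb_dom \<beta> \<subseteq> B \<Longrightarrow> pb_inv \<alpha> \<star> (\<alpha> \<star> \<beta>) = \<beta>"
    "\<beta> \<in> partial_braids \<Longrightarrow> pb_dom \<beta> \<subseteq> A \<Longrightarrow> \<alpha> \<star> (pb_inv \<alpha> \<star> \<beta>) = \<beta>"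
    "\<beta> \<in> partial_braids \<Longrightarrow> pb_codom \<beta> \<subseteq> A \<Longrightarrow> \<beta> \<star> \<alpha> \<star> pb_inv \<alpha> = \<beta>"
    "\<beta> \<in> partial_braids \<Longrightarrow> pb_codom \<beta> \<subseteq> B \<Longrightarrow> \<beta> \<star> pb_inv \<alpha> \<star> \<alpha> = \<beta>"
proof -
  note a = braidsD(1-5)[OF assms] and i = braidsD(1-5)[OF pb_inv_in[OF assms]] pb_inv[OF assms]
  show "pb_inv \<alpha> \<star> (\<alpha> \<star> \<beta>) = \<beta>" if "\<beta> \<in> partial_braids" "pb_dom \<beta> \<subseteq> B"
    using pb_mult_assoc[OF i(1) a(1) that(1)] id_mult[OF a(5) that] i(8) by simp
  show "\<alpha> \<star> (pb_inv \<alpha> \<star> \<beta>) = \<beta>" if "\<beta> \<in> partial_braids" "pb_dom \<beta> \<subseteq> A"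
    using pb_mult_assoc[OF a(1) i(1) that(1)] id_mult[OF a(4) that] i(7) by simp
  show "\<beta> \<star> \<alpha> \<star> pb_inv \<alpha> = \<beta>" if "\<beta> \<in> partial_braids" "pb_codom \<beta> \<subseteq> A"
    using pb_mult_assoc[OF that(1) a(1) i(1)] mult_id[OF a(4) that] i(7) by simp
  show "\<beta> \<star> pb_inv \<alpha> \<star> \<alpha> = \<beta>" if "\<beta> \<in> partial_braids" "pb_codom \<beta> \<subseteq> B"
    using pb_mult_assoc[OF that(1) i(1) a(1)] mult_id[OF a(5) that] i(8) by simp
qed

lemma braid_of_bijection:
  assumes "positions A" "positions B" "bij_betw f A B"
  obtains \<alpha> where "\<alpha> \<in> braids A B" "\<And>i. i \<in> A \<Longrightarrow> braid_perm \<alpha> i = f i"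
proof -
  have "inj_on f A" "f ` A = B" using assms(3) by (auto simp: bij_betw_def)
  then obtain \<alpha> where \<alpha>: "\<alpha> \<in> partial_braids" "pb_dom \<alpha> = A" "\<And>i. i \<in> A \<Longrightarrow> braid_perm \<alpha> i = f i"
    using partial_braid_of_injection[of A f] assms unfolding positions_def by metis
  moreover have "pb_codom \<alpha> = B" using pb_codom_eq[OF \<alpha>(1)] \<alpha>(2,3) \<open>f ` A = B\<close> by auto
  ultimately show thesis using that by (simp add: braids_def)
qed

lemma braids_nonempty:
  assumes "positions A" "positions B" "card A = card B"
  obtains \<alpha> where "\<alpha> \<in> braids A B"
proof -
  obtain f where "bij_betw f A B" using finite_same_card_bij assms by (auto simp: positions_def)
  then show thesis using braid_of_bijection assms that by metis
qed

lemma id_mult_restrict: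
  assumes "positions A" "\<alpha> \<in> partial_braids"
  shows "pb_dom (id_braid A \<star> \<alpha>) = A \<inter> pb_dom \<alpha>" "pb_codom (id_braid A \<star> \<alpha>) = braid_perm \<alpha> ` (A \<inter> pb_dom \<alpha>)"
    "\<And>i. i \<in> A \<inter> pb_dom \<alpha> \<Longrightarrow> braid_perm (id_braid A \<star> \<alpha>) i = braid_perm \<alpha> i"
  using assms by (auto simp: pb_dom_mult pb_codom_mult braid_perm_mult)

lemma mult_id_restrict:
  assumes "positions A" "\<alpha> \<in> partial_braids"
  shows "pb_dom (\<alpha> \<star> id_braid A) = {i \<in> pb_dom \<alpha>. braid_perm \<alpha> i \<in> A}" "pb_codom (\<alpha> \<star> id_braid A) = pb_codom \<alpha> \<inter> A"
  using assms by (auto simp: pb_dom_mult pb_codom_mult)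

text \<open>Selecting strings by their lower ends is the same as selecting them by their upper ends.
  For a pure braid the two selections use the same set.\<close>

lemma mult_id_restrict_commute:
  assumes "positions B" "\<alpha> \<in> partial_braids"
  shows "\<alpha> \<star> id_braid B = id_braid (pb_dom (\<alpha> \<star> id_braid B)) \<star> \<alpha>"
proof -
  define A where "A = pb_dom (\<alpha> \<star> id_braid B)"
  have A: "positions A" "A \<subseteq> pb_dom \<alpha>" using assms pb_dom_mult_subset by (simp_all add: A_def)
  have "pb_codom (id_braid A \<star> \<alpha>) \<subseteq> B"
    using assms A by (auto simp: id_mult_restrict A_def mult_id_restrict)
  then have "id_braid A \<star> \<alpha> = id_braid A \<star> \<alpha> \<star> id_braid B" using assms A by (simp add: mult_id)
  also have "\<dots> = id_braid A \<star> (\<alpha> \<star> id_braid B)" using assms A by (simp add: pb_mult_assoc)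
  also have "\<dots> = \<alpha> \<star> id_braid B" using assms A by (simp add: id_mult A_def)
  finally show ?thesis by (simp add: A_def)
qed

section \<open>Braid groups and pure braid groups\<close>

lemma braid_group_simps:
  "carrier (braid_group p) = braids {1..p} {1..p}" "mult (braid_group p) = pb_mult" "one (braid_group p) = id_braid {1..p}"
  by (simp_all add: braid_group_def braids_def identity_braid_eq)

lemma group_braid_group: "group (braid_group p)"
proof (rule groupI, unfold braid_group_simps)
  fix x y z assume x: "x \<in> braids {1..p} {1..p}"
  show "\<exists>y\<in>braids {1..p} {1..p}. y \<star> x = id_braid {1..p}" using pb_inv[OF x] by blast
  show "id_braid {1..p} \<star> x = x" using x by (rule id_mult_braids)
  assume y: "y \<in> braids {1..p} {1..p}"
  show "x \<star> y \<in> braids {1..p} {1..p}" using x y by (rule mult_braids)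
  assume z: "z \<in> braids {1..p} {1..p}"
  show "x \<star> y \<star> z = x \<star> (y \<star> z)" using x y z by (rule braids_assoc)
qed (rule id_in_braids, rule positions_interval)

lemma inv_braid_group:
  assumes "x \<in> braids {1..p} {1..p}" shows "inv\<^bsub>braid_group p\<^esub> x = pb_inv x"
  by (rule group.inv_equality[OF group_braid_group], unfold braid_group_simps)
     (rule pb_inv_mult[OF assms], rule assms, rule pb_inv_in[OF assms])

lemma normal_braid_group_iff:
  "N \<lhd> braid_group p \<longleftrightarrow> N \<subseteq> braids {1..p} {1..p} \<and> id_braid {1..p} \<in> N \<and> (\<forall>x\<in>N. \<forall>y\<in>N. x \<star> y \<in> N) \<and>
     (\<forall>x\<in>N. pb_inv x \<in> N) \<and> (\<forall>g\<in>braids {1..p} {1..p}. \<forall>x\<in>N. g \<star> x \<star> pb_inv g \<in> N)"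
  (is "?L \<longleftrightarrow> ?R")
proof
  assume ?L
  then have s: "subgroup N (braid_group p)" and c: "\<forall>x\<in>carrier (braid_group p). \<forall>h\<in>N. x \<otimes>\<^bsub>braid_group p\<^esub> h \<otimes>\<^bsub>braid_group p\<^esub> inv\<^bsub>braid_group p\<^esub> x \<in> N"
    using group.normal_inv_iff[OF group_braid_group] by blast+
  show ?R
  proof (intro conjI ballI)
    show sub: "N \<subseteq> braids {1..p} {1..p}" using subgroup.subset[OF s] by (simp add: braid_group_simps)
    show "id_braid {1..p} \<in> N" using subgroup.one_closed[OF s] by (simp add: braid_group_simps)
    fix x assume x: "x \<in> N"
    then have xb: "x \<in> braids {1..p} {1..p}" using sub by blast
    show "pb_inv x \<in> N" using subgroup.m_inv_closed[OF s x] inv_braid_group[OF xb] by simp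
    show "x \<star> y \<in> N" if "y \<in> N" for y using subgroup.m_closed[OF s x that] by (simp add: braid_group_simps)
    show "g \<star> x \<star> pb_inv g \<in> N" if "g \<in> braids {1..p} {1..p}" for g
      using bspec[OF bspec[OF c, of g] x] that inv_braid_group[OF that] by (simp add: braid_group_simps)
  qed
next
  assume R: ?R
  have "subgroup N (braid_group p)"
  proof (rule group.subgroupI[OF group_braid_group])
    show "N \<subseteq> carrier (braid_group p)" "N \<noteq> {}" using R unfolding braid_group_simps by blast+
    fix x assume x: "x \<in> N"
    show "inv\<^bsub>braid_group p\<^esub> x \<in> N"
    proof -
      have "x \<in> braids {1..p} {1..p}" "pb_inv x \<in> N" using R x by blast+
      then show ?thesis using inv_braid_group by simp
    qed
    show "x \<otimes>\<^bsub>braid_group p\<^esub> y \<in> N" if "y \<in> N" for y using R x that unfolding braid_group_simps by blast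
  qed
  moreover have "\<forall>x\<in>carrier (braid_group p). \<forall>h\<in>N. x \<otimes>\<^bsub>braid_group p\<^esub> h \<otimes>\<^bsub>braid_group p\<^esub> inv\<^bsub>braid_group p\<^esub> x \<in> N"
  proof (intro ballI)
    fix g x assume "g \<in> carrier (braid_group p)" "x \<in> N"
    then have "g \<in> braids {1..p} {1..p}" unfolding braid_group_simps by blast
    moreover from this have "g \<star> x \<star> pb_inv g \<in> N" using R \<open>x \<in> N\<close> by blast
    ultimately show "g \<otimes>\<^bsub>braid_group p\<^esub> x \<otimes>\<^bsub>braid_group p\<^esub> inv\<^bsub>braid_group p\<^esub> g \<in> N"
      by (simp add: braid_group_simps inv_braid_group)
  qed
  ultimately show ?L using group.normal_inv_iff[OF group_braid_group] by blast
qed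

lemma pure_braids_iff: "n \<in> pure_braids p \<longleftrightarrow> n \<in> braids {1..p} {1..p} \<and> (\<forall>i\<in>{1..p}. braid_perm n i = i)"
proof -
  have one: "\<one>\<^bsub>sym_group p\<^esub> = id" by (simp add: sym_group_def)
  have "n \<in> pure_braids p \<longleftrightarrow> n \<in> braids {1..p} {1..p} \<and> braid_perm n = id"
    unfolding pure_braids_def kernel_def braid_group_simps mem_Collect_eq one ..
  also have "\<dots> \<longleftrightarrow> n \<in> braids {1..p} {1..p} \<and> (\<forall>i\<in>{1..p}. braid_perm n i = i)"
  proof (rule conj_cong[OF refl])
    assume n: "n \<in> braids {1..p} {1..p}"
    show "braid_perm n = id \<longleftrightarrow> (\<forall>i\<in>{1..p}. braid_perm n i = i)"
      using braid_perm_outside[OF braidsD(1)[OF n]] braidsD(2)[OF n] by (auto simp: fun_eq_iff)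
  qed
  finally show ?thesis .
qed

section \<open>Congruences on the ideals\<close>

definition ideal_homs :: "enat \<Rightarrow> nat \<Rightarrow> nat \<Rightarrow> pbraid set" where
  "ideal_homs r m n = {x \<in> partial_braids. pb_dom x \<subseteq> {1..m} \<and> pb_codom x \<subseteq> {1..n} \<and> enat (card (pb_dom x)) \<le> r}"

lemma ideal_homsD:
  assumes "x \<in> ideal_homs r m n"
  shows "x \<in> partial_braids" "pb_dom x \<subseteq> {1..m}" "pb_codom x \<subseteq> {1..n}" "enat (card (pb_dom x)) \<le> r"
    "x \<in> braids (pb_dom x) (pb_codom x)"
  using assms by (auto simp: ideal_homs_def braids_def)

lemma braids_ideal_homs:
  assumes "x \<in> braids A B" "A \<subseteq> {1..m}" "B \<subseteq> {1..n}" "enat (card A) \<le> r"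
  shows "x \<in> ideal_homs r m n"
  using braidsD(1-3)[OF assms(1)] assms(2-4) by (simp add: ideal_homs_def)

lemma mult_ideal_homs:
  assumes "x \<in> ideal_homs r l m" "y \<in> ideal_homs r m n"
  shows "x \<star> y \<in> ideal_homs r l n"
proof -
  note x = ideal_homsD[OF assms(1)] and y = ideal_homsD[OF assms(2)]
  have "enat (card (pb_dom (x \<star> y))) \<le> enat (card (pb_dom x))"
    using card_pb_dom_mult(1)[OF x(1) y(1)] by simp
  then show ?thesis
    using pb_dom_mult_subset[OF x(1) y(1)] pb_codom_mult_subset[OF x(1) y(1)] x y
      order_trans[OF \<open>enat (card (pb_dom (x \<star> y))) \<le> enat (card (pb_dom x))\<close> x(4)]
    unfolding ideal_homs_def by auto
qed

lemma IB_ideal_simps: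
  "arrows (IB_ideal C r) = rank_ideal C r" "src (IB_ideal C r) (m, x, n) = m" "tgt (IB_ideal C r) (m, x, n) = n"
  "cmp (IB_ideal C r) (m, x, n) (n', y, k) = (m, x \<star> y, k)"
  by (simp_all add: IB_ideal_def IB_def)

lemma rank_ideal_iff: "(m, x, n) \<in> rank_ideal C r \<longleftrightarrow> m \<in> C \<and> n \<in> C \<and> x \<in> ideal_homs r m n"
  by (auto simp: rank_ideal_def IB_def IB_hom_def arrow_rank_def pb_rank_def ideal_homs_def)

lemma universal_congruence_iff:
  "(u, v) \<in> universal_congruence (IB_ideal C r) \<longleftrightarrow>
    (\<exists>m n x y. u = (m, x, n) \<and> v = (m, y, n) \<and> m \<in> C \<and> n \<in> C \<and> x \<in> ideal_homs r m n \<and> y \<in> ideal_homs r m n)"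
  unfolding universal_congruence_def parallel_def IB_ideal_simps(1)
  by (cases u; cases v) (auto simp: IB_ideal_simps rank_ideal_iff)

text \<open>The relations to be built compare partial braids by a condition \<open>P\<close> that
  does not mention the objects \<open>m\<close> and \<open>n\<close>; the laws of a congruence then
  become laws of \<open>P\<close>.\<close>

lemma is_congruenceI:
  assumes R: "\<And>u v. (u, v) \<in> R \<longleftrightarrow> (\<exists>m n x y. u = (m, x, n) \<and> v = (m, y, n) \<and> m \<in> C \<and> n \<in> C \<and>
      x \<in> ideal_homs r m n \<and> y \<in> ideal_homs r m n \<and> P x y)"
    and refl: "\<And>x. P x x"
    and sym: "\<And>x y m n. P x y \<Longrightarrow> y \<in> ideal_homs r m n \<Longrightarrow> P y x"
    and trans: "\<And>x y z m n. P x y \<Longrightarrow> P y z \<Longrightarrow> z \<in> ideal_homs r m n \<Longrightarrow> P x z"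
    and left: "\<And>x y a k m n. P x y \<Longrightarrow> x \<in> ideal_homs r m n \<Longrightarrow> y \<in> ideal_homs r m n \<Longrightarrow>
      a \<in> ideal_homs r k m \<Longrightarrow> P (a \<star> x) (a \<star> y)"
    and right: "\<And>x y b k m n. P x y \<Longrightarrow> x \<in> ideal_homs r m n \<Longrightarrow> y \<in> ideal_homs r m n \<Longrightarrow>
      b \<in> ideal_homs r n k \<Longrightarrow> P (x \<star> b) (y \<star> b)"
  shows "is_congruence (IB_ideal C r) R"
proof -
  have mem: "((m, x, n), (m', y, n')) \<in> R \<longleftrightarrow> m' = m \<and> n' = n \<and> m \<in> C \<and> n \<in> C \<and>
      x \<in> ideal_homs r m n \<and> y \<in> ideal_homs r m n \<and> P x y" for m x n m' y n'
    unfolding R by auto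
  have "equiv (rank_ideal C r) R"
  proof (rule equivI)
    show "R \<subseteq> rank_ideal C r \<times> rank_ideal C r" by (auto simp: mem rank_ideal_iff)
    show "refl_on (rank_ideal C r) R" by (rule refl_onI) (auto simp: mem rank_ideal_iff refl)
    show "sym R" by (rule symI) (auto simp: mem intro: sym)
    show "trans R" by (rule transI) (auto simp: mem intro: trans)
  qed
  moreover have "\<forall>(u, v)\<in>R. parallel (IB_ideal C r) u v"
    by (auto simp: mem parallel_def IB_ideal_simps)
  moreover have "\<forall>(u, v)\<in>R. \<forall>a\<in>rank_ideal C r.
        (tgt (IB_ideal C r) a = src (IB_ideal C r) u \<longrightarrow> (cmp (IB_ideal C r) a u, cmp (IB_ideal C r) a v) \<in> R) \<and>
        (tgt (IB_ideal C r) u = src (IB_ideal C r) a \<longrightarrow> (cmp (IB_ideal C r) u a, cmp (IB_ideal C r) v a) \<in> R)"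
    by (auto simp: mem IB_ideal_simps rank_ideal_iff intro: left right mult_ideal_homs)
  ultimately show ?thesis unfolding is_congruence_def IB_ideal_simps(1) by blast
qed

lemma is_congruence_universal: "is_congruence (IB_ideal C r) (universal_congruence (IB_ideal C r))"
  by (rule is_congruenceI[where P = "\<lambda>_ _. True"]) (simp_all add: universal_congruence_iff)

section \<open>Consequences of a congruence on an ideal\<close>

locale ideal_congruence =
  fixes C :: "nat set" and r :: enat and \<sigma> :: "(pb_arrow \<times> pb_arrow) set"
  assumes congruence: "is_congruence (IB_ideal C r) \<sigma>"
begin

definition rel :: "nat \<Rightarrow> nat \<Rightarrow> pbraid \<Rightarrow> pbraid \<Rightarrow> bool" where
  "rel m n x y \<longleftrightarrow> ((m, x, n), (m, y, n)) \<in> \<sigma>"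

lemma equiv_sigma: "equiv (rank_ideal C r) \<sigma>"
  using congruence by (simp add: is_congruence_def IB_ideal_simps)

lemma sigma_subset_universal: "\<sigma> \<subseteq> universal_congruence (IB_ideal C r)"
proof -
  have "\<sigma> \<subseteq> rank_ideal C r \<times> rank_ideal C r" using equiv_sigma by (simp add: equiv_def)
  moreover have "\<forall>(x, y)\<in>\<sigma>. parallel (IB_ideal C r) x y" using congruence by (simp add: is_congruence_def)
  ultimately show ?thesis unfolding universal_congruence_def IB_ideal_simps(1) by auto
qed

lemma rel_homs:
  assumes "rel m n x y" shows "m \<in> C" "n \<in> C" "x \<in> ideal_homs r m n" "y \<in> ideal_homs r m n"
  using subsetD[OF sigma_subset_universal assms[unfolded rel_def]] by (simp_all add: universal_congruence_iff)

lemma rel_refl: "m \<in> C \<Longrightarrow> n \<in> C \<Longrightarrow> x \<in> ideal_homs r m n \<Longrightarrow> rel m n x x"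
  using equiv_sigma rank_ideal_iff[of m x n C r] unfolding rel_def equiv_def refl_on_def by simp

lemma rel_sym: "rel m n x y \<Longrightarrow> rel m n y x"
  unfolding rel_def by (rule symD) (use equiv_sigma in \<open>simp_all add: equiv_def\<close>)

lemma rel_trans: "rel m n x y \<Longrightarrow> rel m n y z \<Longrightarrow> rel m n x z"
  unfolding rel_def by (rule transD) (use equiv_sigma in \<open>simp_all add: equiv_def\<close>)

lemma rel_mult:
  assumes xy: "rel m n x y" and k: "k \<in> C"
  shows rel_left: "a \<in> ideal_homs r k m \<Longrightarrow> rel k n (a \<star> x) (a \<star> y)"
    and rel_right: "b \<in> ideal_homs r n k \<Longrightarrow> rel m k (x \<star> b) (y \<star> b)"
proof -
  have c: "\<forall>(x, y)\<in>\<sigma>. \<forall>a\<in>rank_ideal C r.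
        (tgt (IB_ideal C r) a = src (IB_ideal C r) x \<longrightarrow> (cmp (IB_ideal C r) a x, cmp (IB_ideal C r) a y) \<in> \<sigma>) \<and>
        (tgt (IB_ideal C r) x = src (IB_ideal C r) a \<longrightarrow> (cmp (IB_ideal C r) x a, cmp (IB_ideal C r) y a) \<in> \<sigma>)"
    using congruence unfolding is_congruence_def IB_ideal_simps(1) by (elim conjE)
  have *: "\<forall>a\<in>rank_ideal C r.
        (tgt (IB_ideal C r) a = src (IB_ideal C r) (m, x, n) \<longrightarrow>
          (cmp (IB_ideal C r) a (m, x, n), cmp (IB_ideal C r) a (m, y, n)) \<in> \<sigma>) \<and>
        (tgt (IB_ideal C r) (m, x, n) = src (IB_ideal C r) a \<longrightarrow>
          (cmp (IB_ideal C r) (m, x, n) a, cmp (IB_ideal C r) (m, y, n) a) \<in> \<sigma>)"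
    using bspec[OF c xy[unfolded rel_def]] unfolding case_prod_conv .
  show "rel k n (a \<star> x) (a \<star> y)" if "a \<in> ideal_homs r k m"
    using bspec[OF *, of "(k, a, m)"] that k rel_homs[OF xy] by (simp add: IB_ideal_simps rank_ideal_iff rel_def)
  show "rel m k (x \<star> b) (y \<star> b)" if "b \<in> ideal_homs r n k"
    using bspec[OF *, of "(n, b, k)"] that k rel_homs[OF xy] by (simp add: IB_ideal_simps rank_ideal_iff rel_def)
qed

text \<open>Induction on the rank of \<open>z\<close>. As long as \<open>z\<close> is not empty, it
  can be replaced by a product \<open>z \<star> w\<close> with strictly smaller domain, where
  \<open>w\<close> is conjugate to \<open>z\<close> and therefore also related to the identity on
  \<open>A\<close>.\<close>

lemma collapse_idempotent:
  assumes m: "m \<in> C" and A: "A \<subseteq> {1..m}" "enat (card A) \<le> r"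
    and "rel m m (id_braid A) z" "pb_dom z \<subseteq> A" "pb_codom z \<subseteq> A" "card (pb_dom z) < card A"
  shows "rel m m (id_braid A) (id_braid {})"
  using assms(4-7)
proof (induction "card (pb_dom z)" arbitrary: z rule: less_induct)
  case less
  note z = ideal_homsD[OF rel_homs(4)[OF less.prems(1)]]
  have pA: "positions A" using positions_subset[OF _ A(1)] by simp
  then have fA: "finite A" by (simp add: positions_def)
  show ?case
  proof (cases "pb_dom z = {}")
    case True
    then have "z = id_braid {}" by (rule empty_partial_braid[OF z(1)])
    then show ?thesis using less.prems(1) by simp
  next
    case False
    then obtain b where b: "b \<in> pb_codom z" using pb_codom_eq[OF z(1)] by blast
    have "pb_dom z \<noteq> A" using less.prems(4) by auto
    then obtain a where a: "a \<in> A" "a \<notin> pb_dom z" using less.prems(2) by blast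
    have bA: "b \<in> A" using b less.prems(3) by blast
    \<comment> \<open>\<open>a\<close> is missing from the domain of \<open>z\<close> and
      \<open>b\<close> is the lower end of one of its strings; for \<open>a = b\<close> the map is
      the identity.\<close>
    define f where "f = id(a := b, b := a)"
    have "f ` A = A" using a(1) bA by (auto simp: f_def image_iff)
    moreover have "inj_on f A" by (auto simp: f_def inj_on_def)
    ultimately have "bij_betw f A A" by (simp add: bij_betw_def)
    then obtain g where g: "g \<in> braids A A" "\<And>i. i \<in> A \<Longrightarrow> braid_perm g i = f i"
      using braid_of_bijection[OF pA pA] by blast
    have ga: "braid_perm g a = b" using g(2)[OF a(1)] by (simp add: f_def)
    note gi = pb_inv[OF g(1)]
    note gD = braidsD[OF g(1)] and iD = braidsD[OF gi(1)]
    have gh: "g \<in> ideal_homs r m m" "pb_inv g \<in> ideal_homs r m m"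
      using braids_ideal_homs[OF g(1) A(1) A(1) A(2)] braids_ideal_homs[OF gi(1) A(1) A(1) A(2)] by auto
    have perm_inv: "braid_perm (pb_inv g) b = a"
    proof -
      have "a \<in> pb_dom (g \<star> pb_inv g)" using gi(2) pA a(1) by simp
      then have "braid_perm (g \<star> pb_inv g) a = braid_perm (pb_inv g) (braid_perm g a)"
        by (rule braid_perm_mult[OF gD(1) iD(1)])
      then show ?thesis using gi(2) pA ga by simp
    qed
    define w where "w = pb_inv g \<star> z \<star> g"
    have wB: "w \<in> partial_braids" using gD iD z by (simp add: w_def)
    \<comment> \<open>The conjugate misses the position to which \<open>g\<close> moves
      \<open>a\<close>. Hence the string of \<open>z\<close> that ends at \<open>b\<close> finds no
      continuation in \<open>w\<close>.\<close>
    have "b \<notin> pb_dom (pb_inv g \<star> z)"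
      using perm_inv a(2) by (simp add: pb_dom_mult[OF iD(1) z(1)])
    then have bw: "b \<notin> pb_dom w"
      using pb_dom_mult_subset[OF pb_mult_closed[OF iD(1) z(1)] gD(1)] by (auto simp: w_def)
    have "rel m m (pb_inv g \<star> id_braid A \<star> g) w"
      unfolding w_def by (rule rel_right[OF rel_left[OF less.prems(1) m gh(2)] m gh(1)])
    then have "rel m m (id_braid A) w" using mult_id_braids[OF gi(1)] gi(3) by simp
    \<comment> \<open>Multiplying the identity and \<open>w\<close> by \<open>z\<close> relates
      \<open>z\<close> to \<open>z \<star> w\<close>, and transitivity then links the identity to
      \<open>z \<star> w\<close>.\<close>
    then have "rel m m (z \<star> id_braid A) (z \<star> w)"
      using rel_left m rel_homs(4)[OF less.prems(1)] by blast
    then have "rel m m z (z \<star> w)" using mult_id[OF pA z(1) less.prems(3)] by simp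
    then have zw: "rel m m (id_braid A) (z \<star> w)" by (rule rel_trans[OF less.prems(1)])
    obtain i where i: "i \<in> pb_dom z" "braid_perm z i = b" using b pb_codom_eq[OF z(1)] by auto
    have "i \<notin> pb_dom (z \<star> w)" using i bw by (simp add: pb_dom_mult[OF z(1) wB])
    then have "pb_dom (z \<star> w) \<subset> pb_dom z" using pb_dom_mult_subset[OF z(1) wB] i(1) by blast
    then have lt: "card (pb_dom (z \<star> w)) < card (pb_dom z)" and sub: "pb_dom (z \<star> w) \<subseteq> A"
      using psubset_card_mono[OF finite_pb_dom[OF z(1)]] less.prems(2) by auto
    have "pb_codom (z \<star> w) \<subseteq> pb_codom w" by (rule pb_codom_mult_subset[OF z(1) wB])
    also have "\<dots> \<subseteq> A" using pb_codom_mult_subset[OF pb_mult_closed[OF iD(1) z(1)] gD(1)] gD(3) by (simp add: w_def)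
    finally have cod: "pb_codom (z \<star> w) \<subseteq> A" .
    show ?thesis using less.hyps[OF lt zw sub cod] lt less.prems(4) by simp
  qed
qed

text \<open>An \<open>x\<close> of rank at most \<open>card A\<close> factors through the identity
  on \<open>A\<close>: move its domain onto a subset \<open>A0\<close> of \<open>A\<close> by
  \<open>g\<close> and write \<open>x\<close> as
  \<open>g \<star> id_braid A \<star> (pb_inv g \<star> x)\<close>. Replacing the middle factor by
  the empty braid empties the product.\<close>

lemma collapse_ideal:
  assumes m: "m \<in> C" and A: "A \<subseteq> {1..m}" "enat (card A) \<le> r" and rel: "rel m m (id_braid A) (id_braid {})"
    and x: "m' \<in> C" "n' \<in> C" "x \<in> ideal_homs r m' n'" "card (pb_dom x) \<le> card A"
  shows "rel m' n' x (id_braid {})"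
proof -
  define D where "D = pb_dom x"
  note xD = ideal_homsD[OF x(3)]
  have pA: "positions A" using positions_subset[OF _ A(1)] by simp
  obtain A0 where A0: "A0 \<subseteq> A" "card A0 = card D"
    using x(4) obtain_subset_with_card_n unfolding D_def by metis
  have pos: "positions D" "positions A0" using xD(1) positions_subset[OF pA A0(1)] by (simp_all add: D_def)
  obtain g where g: "g \<in> braids D A0" using braids_nonempty[OF pos] A0(2) by metis
  have x': "x \<in> braids D (pb_codom x)" using xD(5) by (simp add: D_def)
  have v: "pb_inv g \<star> x \<in> braids A0 (pb_codom x)" by (rule mult_braids[OF pb_inv_in[OF g] x'])
  have cD: "enat (card D) \<le> r" using xD(4) by (simp add: D_def)
  have gh: "g \<in> ideal_homs r m' m" using braids_ideal_homs[OF g _ _ cD] xD(2) A0(1) A(1) by (auto simp: D_def)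
  have vh: "pb_inv g \<star> x \<in> ideal_homs r m n'"
    using braids_ideal_homs[OF v _ xD(3)] A0 A(1) cD by auto
  have "rel m' n' (g \<star> id_braid A \<star> (pb_inv g \<star> x)) (g \<star> id_braid {} \<star> (pb_inv g \<star> x))"
    by (rule rel_right[OF rel_left[OF rel x(1) gh] x(2) vh])
  moreover have "g \<star> id_braid A = g" using mult_id[OF pA] braidsD[OF g] A0(1) by simp
  moreover have "g \<star> (pb_inv g \<star> x) = x" by (rule mult_inv_cancel(2)[OF g xD(1)]) (simp add: D_def)
  moreover have "g \<star> id_braid {} \<star> (pb_inv g \<star> x) = id_braid {}"
  proof (rule empty_partial_braid)
    have gB: "g \<in> partial_braids" "pb_inv g \<star> x \<in> partial_braids" using braidsD(1)[OF g] braidsD(1)[OF v] by auto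
    then show "g \<star> id_braid {} \<star> (pb_inv g \<star> x) \<in> partial_braids" by simp
    have "pb_dom (g \<star> id_braid {}) = {}" using gB by (simp add: mult_id_restrict)
    then show "pb_dom (g \<star> id_braid {} \<star> (pb_inv g \<star> x)) = {}"
      using pb_dom_mult_subset[of "g \<star> id_braid {}" "pb_inv g \<star> x"] gB by simp
  qed
  ultimately show ?thesis by simp
qed

text \<open>Since \<open>y\<close> has no more strings than \<open>x\<close>, a difference of
  domains means that some upper end of \<open>x\<close> is missing in \<open>y\<close>; then
  multiplication by \<open>pb_inv x\<close> on the right relates the identity on \<open>A\<close> to
  something of smaller rank. A difference of codomains is treated dually with
  \<open>pb_inv x\<close> on the left.\<close>

lemma collapse:
  assumes xy: "rel m n x y" "card (pb_dom y) \<le> card (pb_dom x)" "pb_dom x \<noteq> pb_dom y \<or> pb_codom x \<noteq> pb_codom y"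
    and uv: "m' \<in> C" "n' \<in> C" "u \<in> ideal_homs r m' n'" "v \<in> ideal_homs r m' n'"
      "card (pb_dom u) \<le> card (pb_dom x)" "card (pb_dom v) \<le> card (pb_dom x)"
  shows "rel m' n' u v"
proof -
  note mn = rel_homs[OF xy(1)]
  note x = ideal_homsD[OF mn(3)] and y = ideal_homsD[OF mn(4)]
  define A where "A = pb_dom x"
  define B where "B = pb_codom x"
  have xB: "x \<in> braids A B" using x(5) by (simp add: A_def B_def)
  have pos: "positions A" "positions B" using x(1) by (simp_all add: A_def B_def)
  have fin: "finite A" "finite B" using pos by (simp_all add: positions_def)
  have AB: "card A = card B" using braidsD(6)[OF xB] .
  have le: "enat (card A) \<le> r" "enat (card B) \<le> r" using x(4) AB by (simp_all add: A_def)
  have sub: "A \<subseteq> {1..m}" "B \<subseteq> {1..n}" using x(2,3) by (simp_all add: A_def B_def)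
  note xi = pb_inv[OF xB]
  note xiD = braidsD[OF xi(1)]
  have xih: "pb_inv x \<in> ideal_homs r n m" by (rule braids_ideal_homs[OF xi(1) sub(2,1) le(2)])
  have eh: "id_braid A \<in> ideal_homs r m m" "id_braid B \<in> ideal_homs r n n"
    by (rule braids_ideal_homs[OF id_in_braids[OF pos(1)] sub(1) sub(1) le(1)],
        rule braids_ideal_homs[OF id_in_braids[OF pos(2)] sub(2) sub(2) le(2)])
  have "\<exists>k E. k \<in> C \<and> E \<subseteq> {1..k} \<and> card E = card A \<and> rel k k (id_braid E) (id_braid {})"
  proof (cases "A = pb_dom y")
    case False
    \<comment> \<open>\<open>y\<close> may have strings starting outside \<open>A\<close>; the first
      factor removes them, as \<open>collapse_idempotent\<close> wants both ends inside
      \<open>A\<close>.\<close>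
    define z where "z = id_braid A \<star> (y \<star> pb_inv x)"
    have "rel m m (x \<star> pb_inv x) (y \<star> pb_inv x)" by (rule rel_right[OF xy(1) mn(1) xih])
    then have "rel m m (id_braid A \<star> id_braid A) z" unfolding z_def xi(2)
      by (rule rel_left[OF _ mn(1) eh(1)])
    then have r: "rel m m (id_braid A) z" using id_mult_braids[OF id_in_braids[OF pos(1)]] by simp
    have yx: "y \<star> pb_inv x \<in> partial_braids" using y(1) xiD(1) by simp
    have dz: "pb_dom z \<subseteq> A \<inter> pb_dom y"
      using id_mult_restrict(1)[OF pos(1) yx] pb_dom_mult_subset[OF y(1) xiD(1)] by (auto simp: z_def)
    have "\<not> A \<subseteq> pb_dom y"
      using card_seteq[OF finite_pb_dom[OF y(1)], of A] xy(2) False by (auto simp: A_def)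
    then have "A \<inter> pb_dom y \<subset> A" by blast
    then have "pb_dom z \<subset> A" using dz by blast
    then have "card (pb_dom z) < card A" by (rule psubset_card_mono[OF fin(1)])
    moreover have "pb_codom z \<subseteq> A"
      using pb_codom_mult_subset[OF id_braid_simps(1)[OF pos(1)] yx] pb_codom_mult_subset[OF y(1) xiD(1)] xiD(3)
      by (auto simp: z_def)
    ultimately have "rel m m (id_braid A) (id_braid {})"
      using collapse_idempotent[OF mn(1) sub(1) le(1) r] dz by blast
    then show ?thesis using mn(1) sub(1) by blast
  next
    case True
    then have ne: "B \<noteq> pb_codom y" using xy(3) by (auto simp: A_def B_def)
    define z where "z = pb_inv x \<star> y \<star> id_braid B"
    have "rel n n (pb_inv x \<star> x) (pb_inv x \<star> y)" by (rule rel_left[OF xy(1) mn(2) xih])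
    then have "rel n n (id_braid B \<star> id_braid B) z" unfolding z_def xi(3)
      by (rule rel_right[OF _ mn(2) eh(2)])
    then have r: "rel n n (id_braid B) z" using id_mult_braids[OF id_in_braids[OF pos(2)]] by simp
    have xy': "pb_inv x \<star> y \<in> partial_braids" using y(1) xiD(1) by simp
    then have zB: "z \<in> partial_braids" using pos(2) by (simp add: z_def)
    have cz: "pb_codom z \<subseteq> pb_codom y \<inter> B"
      using mult_id_restrict(2)[OF pos(2) xy'] pb_codom_mult_subset[OF xiD(1) y(1)] by (auto simp: z_def)
    have "card (pb_codom y) \<le> card B" using xy(2) AB card_pb_codom[OF y(1)] by (simp add: A_def)
    moreover have "finite (pb_codom y)" using positions_codom[OF y(1)] by (simp add: positions_def)
    ultimately have "\<not> B \<subseteq> pb_codom y" using card_seteq[of "pb_codom y" B] ne by auto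
    then have "pb_codom z \<subset> B" using cz by blast
    then have "card (pb_codom z) < card B" by (rule psubset_card_mono[OF fin(2)])
    then have "card (pb_dom z) < card B" using card_pb_codom[OF zB] by simp
    moreover have "pb_dom z \<subseteq> B"
      using pb_dom_mult_subset[OF xy' id_braid_simps(1)[OF pos(2)]] pb_dom_mult_subset[OF xiD(1) y(1)] xiD(2)
      by (auto simp: z_def)
    ultimately have "rel n n (id_braid B) (id_braid {})"
      using collapse_idempotent[OF mn(2) sub(2) le(2) r] cz by blast
    then show ?thesis using mn(2) sub(2) AB by auto
  qed
  then obtain k E where k: "k \<in> C" "E \<subseteq> {1..k}" "card E = card A" "rel k k (id_braid E) (id_braid {})" by blast
  have leE: "enat (card E) \<le> r" using le(1) k(3) by simp
  have "rel m' n' u (id_braid {})" "rel m' n' v (id_braid {})"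
    using collapse_ideal[OF k(1,2) leE k(4) uv(1,2)] uv(3-6) k(3) by (simp_all add: A_def)
  then show ?thesis using rel_sym rel_trans by blast
qed

text \<open>Cancelling \<open>y\<close> reduces the left side to \<open>w\<close> being related to
  an identity, and \<open>g\<close> moves that relation from the vertex \<open>m\<close> to
  \<open>k\<close>. All factors and their inverses have the rank of \<open>y\<close>, so they lie in
  the ideal and the argument is reversible.\<close>

lemma rel_conjugate:
  assumes mn: "m \<in> C" "n \<in> C" and y: "y \<in> ideal_homs r m n" and w: "w \<in> braids (pb_dom y) (pb_dom y)"
    and g: "g \<in> braids {1..p} (pb_dom y)" and k: "k \<in> C" "p \<le> k"
  shows "rel m n (w \<star> y) y \<longleftrightarrow> rel k k (g \<star> w \<star> pb_inv g) (id_braid {1..p})"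
proof -
  note yD = ideal_homsD[OF y]
  note gi = pb_inv[OF g] and yi = pb_inv[OF yD(5)]
  have P: "{1..p} \<subseteq> {1..k}" using k(2) by auto
  have c: "enat (card {1..p}) \<le> r" using yD(4) braidsD(6)[OF g] by simp
  have gh: "g \<in> ideal_homs r k m" by (rule braids_ideal_homs[OF g P yD(2) c])
  have gih: "pb_inv g \<in> ideal_homs r m k" by (rule braids_ideal_homs[OF gi(1) yD(2) P yD(4)])
  have cc: "enat (card (pb_codom y)) \<le> r" using yD(4) card_pb_codom[OF yD(1)] by simp
  have yih: "pb_inv y \<in> ideal_homs r n m" by (rule braids_ideal_homs[OF yi(1) yD(3) yD(2) cc])
  note wD = braidsD[OF w] and gD = braidsD[OF g] and giD = braidsD[OF gi(1)]
  show ?thesis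
  proof
    assume "rel m n (w \<star> y) y"
    then have "rel m m (w \<star> y \<star> pb_inv y) (y \<star> pb_inv y)" by (rule rel_right[OF _ mn(1) yih])
    then have "rel m m w (id_braid (pb_dom y))"
      using mult_inv_cancel(3)[OF yD(5) wD(1)] wD(3) yi(2) by simp
    then have "rel k k (g \<star> w \<star> pb_inv g) (g \<star> id_braid (pb_dom y) \<star> pb_inv g)"
      by (intro rel_right[OF rel_left[OF _ k(1) gh] k(1) gih])
    then show "rel k k (g \<star> w \<star> pb_inv g) (id_braid {1..p})"
      using mult_id_braids[OF g] gi(2) by simp
  next
    assume "rel k k (g \<star> w \<star> pb_inv g) (id_braid {1..p})"
    then have "rel m m (pb_inv g \<star> (g \<star> w \<star> pb_inv g) \<star> g) (pb_inv g \<star> id_braid {1..p} \<star> g)"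
      by (intro rel_right[OF rel_left[OF _ mn(1) gih] mn(1) gh])
    moreover have "pb_inv g \<star> id_braid {1..p} \<star> g = id_braid (pb_dom y)"
      using mult_id_braids[OF gi(1)] gi(3) by simp
    moreover have "pb_inv g \<star> (g \<star> w \<star> pb_inv g) \<star> g = w"
    proof -
      have "pb_inv g \<star> (g \<star> w \<star> pb_inv g) = pb_inv g \<star> (g \<star> (w \<star> pb_inv g))"
        using pb_mult_assoc[OF gD(1) wD(1) giD(1)] by simp
      also have "\<dots> = w \<star> pb_inv g"
        by (rule mult_inv_cancel(1)[OF g]) (use braidsD[OF mult_braids[OF w gi(1)]] in auto)
      finally show ?thesis using mult_inv_cancel(4)[OF g wD(1)] wD(3) by simp
    qed
    ultimately have "rel m m w (id_braid (pb_dom y))" by simp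
    then have "rel m n (w \<star> y) (id_braid (pb_dom y) \<star> y)" by (rule rel_right[OF _ mn(2) y])
    then show "rel m n (w \<star> y) y" using id_mult_braids[OF yD(5)] by simp
  qed
qed

end

section \<open>Relations from normal subgroups\<close>

lemma pb_inv_unique:
  assumes "\<alpha> \<in> braids A B" "\<beta> \<in> braids B A" "\<alpha> \<star> \<beta> = id_braid A"
  shows "pb_inv \<alpha> = \<beta>"
proof -
  note b = braidsD[OF assms(2)]
  have "pb_inv \<alpha> \<star> (\<alpha> \<star> \<beta>) = \<beta>" by (rule mult_inv_cancel(1)[OF assms(1) b(1)]) (simp add: b)
  then show ?thesis using mult_id_braids[OF pb_inv_in[OF assms(1)]] assms(3) by simp
qed

lemma pb_inv_mult_braids:
  assumes a: "\<alpha> \<in> braids A B" and b: "\<beta> \<in> braids B D"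
  shows "pb_inv (\<alpha> \<star> \<beta>) = pb_inv \<beta> \<star> pb_inv \<alpha>"
proof (rule pb_inv_unique[OF mult_braids[OF a b] mult_braids[OF pb_inv_in[OF b] pb_inv_in[OF a]]])
  note ai = pb_inv_in[OF a] and bi = pb_inv_in[OF b]
  have "\<alpha> \<star> \<beta> \<star> (pb_inv \<beta> \<star> pb_inv \<alpha>) = \<alpha> \<star> (\<beta> \<star> (pb_inv \<beta> \<star> pb_inv \<alpha>))"
    by (rule braids_assoc[OF a b mult_braids[OF bi ai]])
  also have "\<beta> \<star> (pb_inv \<beta> \<star> pb_inv \<alpha>) = pb_inv \<alpha>"
    by (rule mult_inv_cancel(2)[OF b]) (simp_all add: braidsD(1,2)[OF ai])
  finally show "\<alpha> \<star> \<beta> \<star> (pb_inv \<beta> \<star> pb_inv \<alpha>) = id_braid A" using mult_pb_inv[OF a] by simp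
qed

lemma pb_inv_inv: "\<alpha> \<in> braids A B \<Longrightarrow> pb_inv (pb_inv \<alpha>) = \<alpha>"
  by (rule pb_inv_unique[OF pb_inv_in _ pb_inv_mult])

lemma pb_inv_id: "positions A \<Longrightarrow> pb_inv (id_braid A) = id_braid A"
  by (rule pb_inv_unique[where A = A and B = A]) (simp_all add: id_mult)

text \<open>Products are read from left to right, so an arrow \<open>g\<close> from \<open>B\<close>
  to \<open>A\<close> carries the vertex group at \<open>A\<close> to the vertex group at
  \<open>B\<close>.\<close>

definition conjugate :: "pbraid \<Rightarrow> pbraid \<Rightarrow> pbraid" where
  "conjugate g w = g \<star> w \<star> pb_inv g"

lemma conjugate_in:
  assumes "g \<in> braids B A" "w \<in> braids A A" shows "conjugate g w \<in> braids B B"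
  unfolding conjugate_def by (rule mult_braids[OF mult_braids[OF assms] pb_inv_in[OF assms(1)]])

lemma conjugate_conjugate:
  assumes k: "k \<in> braids D B" and h: "h \<in> braids B A" and w: "w \<in> braids A A"
  shows "conjugate k (conjugate h w) = conjugate (k \<star> h) w"
proof -
  note mem = braidsD(1)[OF k] braidsD(1)[OF h] braidsD(1)[OF w] braidsD(1)[OF pb_inv_in[OF h]] braidsD(1)[OF pb_inv_in[OF k]]
  show ?thesis
    unfolding conjugate_def pb_inv_mult_braids[OF k h] by (simp add: pb_mult_assoc mem)
qed

lemma conjugate_mult:
  assumes g: "g \<in> braids B A" and w: "w \<in> braids A A" and v: "v \<in> braids A A"
  shows "conjugate g (w \<star> v) = conjugate g w \<star> conjugate g v"
proof -
  note gi = pb_inv_in[OF g]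
  note mem = braidsD(1)[OF g] braidsD(1)[OF w] braidsD(1)[OF v] braidsD(1)[OF gi]
  have "pb_inv g \<star> (g \<star> (v \<star> pb_inv g)) = v \<star> pb_inv g"
    by (rule mult_inv_cancel(1)[OF g]) (simp_all add: braidsD(1,2)[OF mult_braids[OF v gi]])
  then show ?thesis unfolding conjugate_def by (simp add: pb_mult_assoc mem)
qed

lemma conjugate_id: "g \<in> braids B A \<Longrightarrow> conjugate g (id_braid A) = id_braid B"
  by (simp add: conjugate_def mult_id_braids mult_pb_inv)

lemma id_conjugate: "w \<in> braids A A \<Longrightarrow> conjugate (id_braid A) w = w"
  using braidsD(4) by (simp add: conjugate_def id_mult_braids pb_inv_id mult_id_braids)

lemma conjugate_cancel:
  assumes g: "g \<in> braids B A"
  shows "w \<in> braids A A \<Longrightarrow> conjugate (pb_inv g) (conjugate g w) = w"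
    "v \<in> braids B B \<Longrightarrow> conjugate g (conjugate (pb_inv g) v) = v"
  using conjugate_conjugate[OF pb_inv_in[OF g] g] conjugate_conjugate[OF g pb_inv_in[OF g]]
    pb_inv_mult[OF g] mult_pb_inv[OF g] by (simp_all add: id_conjugate)

lemma conjugate_inv:
  assumes g: "g \<in> braids B A" and w: "w \<in> braids A A"
  shows "conjugate g (pb_inv w) = pb_inv (conjugate g w)"
proof (rule sym, rule pb_inv_unique[OF conjugate_in[OF g w] conjugate_in[OF g pb_inv_in[OF w]]])
  show "conjugate g w \<star> conjugate g (pb_inv w) = id_braid B"
    using conjugate_mult[OF g w pb_inv_in[OF w]] mult_pb_inv[OF w] conjugate_id[OF g] by simp
qed

text \<open>The transport of a normal subgroup of the braid group to another domain of the same size; for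
  normal \<open>N\<close> it does not depend on \<open>g\<close>, and it is empty unless \<open>card A = p\<close>.\<close>

definition twist :: "nat \<Rightarrow> pbraid set \<Rightarrow> nat set \<Rightarrow> pbraid set" where
  "twist p N A = {w \<in> braids A A. \<exists>g\<in>braids {1..p} A. conjugate g w \<in> N}"

lemma twistD: "w \<in> twist p N A \<Longrightarrow> w \<in> braids A A"
  by (simp add: twist_def)

text \<open>Two choices of \<open>g\<close> differ by an element of the braid group, and
  \<open>N\<close> is invariant under conjugation by it.\<close>

lemma twist_iff:
  assumes N: "N \<lhd> braid_group p" and g: "g \<in> braids {1..p} A" and w: "w \<in> braids A A"
  shows "w \<in> twist p N A \<longleftrightarrow> conjugate g w \<in> N"
proof
  assume "w \<in> twist p N A"
  then obtain h where h: "h \<in> braids {1..p} A" "conjugate h w \<in> N" by (auto simp: twist_def)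
  have k: "g \<star> pb_inv h \<in> braids {1..p} {1..p}" by (rule mult_braids[OF g pb_inv_in[OF h(1)]])
  have "g \<star> pb_inv h \<star> h = g" by (rule mult_inv_cancel(4)[OF h(1)]) (simp_all add: braidsD(1,3)[OF g])
  then have "conjugate g w = conjugate (g \<star> pb_inv h) (conjugate h w)"
    using conjugate_conjugate[OF k h(1) w] by simp
  also have "\<dots> \<in> N" using N k h(2) unfolding normal_braid_group_iff conjugate_def by blast
  finally show "conjugate g w \<in> N" .
qed (use g w in \<open>auto simp: twist_def\<close>)

lemma twist_mult:
  assumes N: "N \<lhd> braid_group p" and w: "w \<in> twist p N A" and v: "v \<in> twist p N A"
  shows "w \<star> v \<in> twist p N A"
proof -
  obtain g where g: "g \<in> braids {1..p} A" "conjugate g w \<in> N" using w by (auto simp: twist_def)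
  have "conjugate g v \<in> N" using twist_iff[OF N g(1) twistD[OF v]] v by blast
  then have "conjugate g w \<star> conjugate g v \<in> N" using g(2) N unfolding normal_braid_group_iff by blast
  then show ?thesis
    using twist_iff[OF N g(1) mult_braids[OF twistD[OF w] twistD[OF v]]]
      conjugate_mult[OF g(1) twistD[OF w] twistD[OF v]] by simp
qed

lemma twist_inv:
  assumes N: "N \<lhd> braid_group p" and w: "w \<in> twist p N A"
  shows "pb_inv w \<in> twist p N A"
proof -
  obtain g where g: "g \<in> braids {1..p} A" "conjugate g w \<in> N" using w by (auto simp: twist_def)
  then have "pb_inv (conjugate g w) \<in> N" using N unfolding normal_braid_group_iff by blast
  then show ?thesis
    using twist_iff[OF N g(1) pb_inv_in[OF twistD[OF w]]] conjugate_inv[OF g(1) twistD[OF w]] by simp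
qed

lemma twist_conjugate:
  assumes w: "w \<in> twist p N A" and h: "h \<in> braids D A"
  shows "conjugate h w \<in> twist p N D"
proof -
  obtain g where g: "g \<in> braids {1..p} A" "conjugate g w \<in> N" using w by (auto simp: twist_def)
  have k: "g \<star> pb_inv h \<in> braids {1..p} D" by (rule mult_braids[OF g(1) pb_inv_in[OF h]])
  have "g \<star> pb_inv h \<star> h = g" by (rule mult_inv_cancel(4)[OF h]) (simp_all add: braidsD(1,3)[OF g(1)])
  then have "conjugate (g \<star> pb_inv h) (conjugate h w) = conjugate g w"
    using conjugate_conjugate[OF k h twistD[OF w]] by simp
  then have "conjugate (g \<star> pb_inv h) (conjugate h w) \<in> N" using g(2) by simp
  then show ?thesis using k conjugate_in[OF h twistD[OF w]] unfolding twist_def by blast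
qed

lemma twist_mult_braids:
  assumes "w \<in> twist p N (pb_dom y)" "y \<in> partial_braids"
  shows "w \<star> y \<in> partial_braids" "pb_dom (w \<star> y) = pb_dom y" "pb_codom (w \<star> y) = pb_codom y"
  using braidsD(1-3)[OF mult_braids[OF twistD[OF assms(1)] braidsI[OF assms(2)]]] by simp_all

section \<open>The relation of a single normal subgroup\<close>

lemma IB_arrow_iff: "(m, x, n) \<in> arrows (IB C) \<longleftrightarrow> m \<in> C \<and> n \<in> C \<and> x \<in> partial_braids \<and> pb_dom x \<subseteq> {1..m} \<and> pb_codom x \<subseteq> {1..n}"
  by (auto simp: IB_def IB_hom_def)

lemma normal_in_braids: "N \<lhd> braid_group p \<Longrightarrow> X \<in> N \<Longrightarrow> X \<in> braids {1..p} {1..p}"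
  unfolding normal_braid_group_iff by blast

text \<open>Turns two-sided translates of pairs from \<open>N\<close> into left multiplication by
  transported elements of \<open>N\<close>. From left to right, \<open>a\<close> and
  \<open>b\<close> are truncated to invertible \<open>g\<close> and \<open>h\<close>, and the
  multiplier is the conjugate of X Y^{-1} by \<open>g\<close>. From right to left, the conjugate of
  \<open>w\<close> and the identity of the braid group are translated by \<open>pb_inv g\<close> and
  \<open>g \<star> y\<close>.\<close>

lemma nu_iff:
  assumes N: "N \<lhd> braid_group p" and k: "nq p \<in> C" "p \<le> nq p"
  shows "(u, v) \<in> nu C nq p N \<longleftrightarrow>
    (\<exists>m n x y. u = (m, x, n) \<and> v = (m, y, n) \<and> m \<in> C \<and> n \<in> C \<and> y \<in> partial_braids \<and> pb_dom y \<subseteq> {1..m} \<and>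
      pb_codom y \<subseteq> {1..n} \<and> card (pb_dom y) = p \<and> (\<exists>w\<in>twist p N (pb_dom y). x = w \<star> y))"
    (is "?L \<longleftrightarrow> ?R")
proof
    let ?P = "{1..p}"
    note NP = normal_in_braids[OF N]
    assume ?L
    then have "\<exists>x y a b. u = cmp (IB C) (cmp (IB C) a x) b \<and> v = cmp (IB C) (cmp (IB C) a y) b \<and>
        x \<in> natural_copy nq p N \<and> y \<in> natural_copy nq p N \<and>
        a \<in> arrows (IB C) \<and> b \<in> arrows (IB C) \<and> tgt (IB C) a = nq p \<and> src (IB C) b = nq p \<and>
        cmp (IB C) (cmp (IB C) a x) b \<in> D_class C p \<and> cmp (IB C) (cmp (IB C) a y) b \<in> D_class C p"
      by (simp only: nu_def mem_Collect_eq prod.inject conj_assoc)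
    then obtain x y a b where e: "u = cmp (IB C) (cmp (IB C) a x) b" "v = cmp (IB C) (cmp (IB C) a y) b"
      "x \<in> natural_copy nq p N" "y \<in> natural_copy nq p N"
      "a \<in> arrows (IB C)" "b \<in> arrows (IB C)" "tgt (IB C) a = nq p" "src (IB C) b = nq p"
      "cmp (IB C) (cmp (IB C) a x) b \<in> D_class C p" by (elim exE conjE)
    obtain X where X: "x = (nq p, X, nq p)" "X \<in> N" using e(3) by (auto simp: natural_copy_def)
    obtain Y where Y: "y = (nq p, Y, nq p)" "Y \<in> N" using e(4) by (auto simp: natural_copy_def)
    obtain m \<alpha> where al: "a = (m, \<alpha>, nq p)" using e(7) by (cases a) (auto simp: IB_def)
    obtain n \<beta> where be: "b = (nq p, \<beta>, n)" using e(8) by (cases b) (auto simp: IB_def)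
    have cmp: "cmp (IB C) (m1, x1, n1) (m2, x2, n2) = (m1, x1 \<star> x2, n2)" for m1 x1 n1 m2 x2 n2
      by (simp add: IB_def)
    have uv: "u = (m, \<alpha> \<star> X \<star> \<beta>, n)" "v = (m, \<alpha> \<star> Y \<star> \<beta>, n)"
      unfolding e(1,2) al be X Y cmp by simp_all
    have XY: "X \<in> N" "Y \<in> N" by fact+
    have ab: "(m, \<alpha>, nq p) \<in> arrows (IB C)" "(nq p, \<beta>, n) \<in> arrows (IB C)" using e(5,6) al be by simp_all
    have c: "card (pb_dom (\<alpha> \<star> X \<star> \<beta>)) = p"
      using e(9) unfolding al be X cmp D_class_def arrow_rank_def pb_rank_def by simp
    note a = ab(1)[unfolded IB_arrow_iff] and b = ab(2)[unfolded IB_arrow_iff]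
    \<comment> \<open>Elements of \<open>N\<close> have only the strings \<open>1..p\<close>, so
      cutting the outer factors down to these positions leaves the products unchanged.\<close>
    define g where "g = \<alpha> \<star> id_braid ?P"
    define h where "h = id_braid ?P \<star> \<beta>"
    have aB: "\<alpha> \<in> partial_braids" and bB: "\<beta> \<in> partial_braids" using a b by auto
    have P: "positions ?P" by simp
    have eP: "id_braid ?P \<in> partial_braids" by simp
    have gB: "g \<in> partial_braids" "h \<in> partial_braids" using aB bB by (simp_all add: g_def h_def)
    have eq: "\<alpha> \<star> Z \<star> \<beta> = g \<star> Z \<star> h" if "Z \<in> N" for Z
    proof -
      note Z = braidsD(1)[OF NP[OF that]]
      have "g \<star> Z \<star> h = \<alpha> \<star> (id_braid ?P \<star> (Z \<star> id_braid ?P) \<star> \<beta>)"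
        using aB bB Z eP by (simp add: g_def h_def pb_mult_assoc del: One_nat_def)
      also have "\<dots> = \<alpha> \<star> Z \<star> \<beta>"
        unfolding mult_id_braids[OF NP[OF that]] id_mult_braids[OF NP[OF that]]
        by (rule pb_mult_assoc[OF aB Z bB, symmetric])
      finally show ?thesis by simp
    qed
    note X = NP[OF XY(1)] and Y = NP[OF XY(2)]
    have gX: "g \<star> X \<in> partial_braids" using gB braidsD(1)[OF X] by simp
    have c': "card (pb_dom (g \<star> X \<star> h)) = p" using c eq[OF XY(1)] by simp
    \<comment> \<open>A product of rank \<open>p\<close> cannot pass through a factor of smaller
      rank, so the truncated factors involve all of \<open>1..p\<close>.\<close>
    have "p \<le> card (pb_dom g)"
      using card_pb_dom_mult(1)[OF gX gB(2)] card_pb_dom_mult(1)[OF gB(1) braidsD(1)[OF X]] c' by simp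
    then have "p \<le> card (pb_codom g)" using card_pb_codom[OF gB(1)] by simp
    moreover have "pb_codom g \<subseteq> ?P" unfolding g_def mult_id_restrict(2)[OF P aB] by blast
    ultimately have "pb_codom g = ?P" using card_seteq[of ?P "pb_codom g"] by simp
    then have g: "g \<in> braids (pb_dom g) ?P" using braidsI[OF gB(1)] by simp
    have "p \<le> card (pb_dom h)" using card_pb_dom_mult(2)[OF gX gB(2)] c' by simp
    moreover have "pb_dom h \<subseteq> ?P" unfolding h_def id_mult_restrict(1)[OF P bB] by blast
    ultimately have "pb_dom h = ?P" using card_seteq[of ?P "pb_dom h"] by simp
    then have h: "h \<in> braids ?P (pb_codom h)" using braidsI[OF gB(2)] by simp
    have y: "g \<star> Y \<star> h \<in> braids (pb_dom g) (pb_codom h)" by (rule mult_braids[OF mult_braids[OF g Y] h])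
    define V where "V = X \<star> pb_inv Y"
    have VN: "V \<in> N" using N XY unfolding normal_braid_group_iff V_def by blast
    note V = NP[OF VN]
    have w: "conjugate g V \<in> twist p N (pb_dom g)"
    proof -
      have "V \<in> twist p N ?P"
        using twist_iff[OF N id_in_braids[OF P] V] id_conjugate[OF V] VN by simp
      then show ?thesis by (rule twist_conjugate[OF _ g])
    qed
    have "conjugate g V \<star> (g \<star> Y \<star> h) = g \<star> X \<star> h"
    proof -
      note mem = braidsD(1)[OF g] braidsD(1)[OF h] braidsD(1)[OF X] braidsD(1)[OF Y] braidsD(1)[OF V]
        braidsD(1)[OF pb_inv_in[OF g]] braidsD(1)[OF pb_inv_in[OF Y]]
      have 1: "pb_inv g \<star> (g \<star> (Y \<star> h)) = Y \<star> h"
        by (rule mult_inv_cancel(1)[OF g]) (simp_all add: braidsD(1,2)[OF mult_braids[OF Y h]])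
      have 2: "pb_inv Y \<star> (Y \<star> h) = h"
        by (rule mult_inv_cancel(1)[OF Y]) (simp_all add: braidsD(1,2)[OF h])
      show ?thesis unfolding conjugate_def using 1 2 by (simp add: pb_mult_assoc mem V_def)
    qed
    moreover have "pb_dom (g \<star> Y \<star> h) = pb_dom g" "pb_codom (g \<star> Y \<star> h) = pb_codom h"
      "g \<star> Y \<star> h \<in> partial_braids" using braidsD[OF y] by auto
    moreover have "card (pb_dom g) = p" using braidsD(6)[OF g] by simp
    moreover have "pb_dom g \<subseteq> {1..m}" using pb_dom_mult_subset[OF aB eP] a unfolding g_def by blast
    moreover have "pb_codom h \<subseteq> {1..n}" using pb_codom_mult_subset[OF eP bB] b unfolding h_def by blast
    ultimately show ?R
      using uv eq[OF XY(1)] eq[OF XY(2)] a b w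
      by (intro exI[of _ m] exI[of _ n] exI[of _ "g \<star> X \<star> h"] exI[of _ "g \<star> Y \<star> h"]) (simp, metis)
next
    let ?P = "{1..p}"
    note NP = normal_in_braids[OF N]
    assume ?R
    then obtain m n y w where uv: "u = (m, w \<star> y, n)" "v = (m, y, n)" and mn: "m \<in> C" "n \<in> C"
      and y: "y \<in> partial_braids" "pb_dom y \<subseteq> {1..m}" "pb_codom y \<subseteq> {1..n}" "card (pb_dom y) = p"
      and w: "w \<in> twist p N (pb_dom y)" by blast
    obtain g where g: "g \<in> braids ?P (pb_dom y)" "conjugate g w \<in> N" using w by (auto simp: twist_def)
    define X where "X = conjugate g w"
    note yB = braidsI[OF y(1)] and gi = pb_inv_in[OF g(1)]
    note gy = mult_braids[OF g(1) yB]
    have X: "X \<in> N" "id_braid ?P \<in> N" using g(2) N by (simp_all add: X_def normal_braid_group_iff)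
    have "pb_inv g \<star> X \<star> g = conjugate (pb_inv g) X" unfolding conjugate_def pb_inv_inv[OF g(1)] ..
    then have "pb_inv g \<star> X \<star> g = w" using conjugate_cancel(1)[OF g(1) twistD[OF w]] by (simp add: X_def)
    moreover have "pb_inv g \<star> X \<star> (g \<star> y) = pb_inv g \<star> X \<star> g \<star> y"
      by (rule braids_assoc[OF mult_braids[OF gi NP[OF X(1)]] g(1) yB, symmetric])
    ultimately have 1: "pb_inv g \<star> X \<star> (g \<star> y) = w \<star> y" by simp
    have 2: "pb_inv g \<star> id_braid ?P \<star> (g \<star> y) = y"
      unfolding mult_id_braids[OF gi] by (rule mult_inv_cancel(1)[OF g(1) y(1)]) simp
    have P: "?P \<subseteq> {1..nq p}" using k(2) by auto
    have a: "(m, pb_inv g, nq p) \<in> arrows (IB C)" "(nq p, g \<star> y, n) \<in> arrows (IB C)"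
      unfolding IB_arrow_iff using mn k(1) y P braidsD(1-3)[OF gi] braidsD(1-3)[OF gy] by auto
    have d: "(m, w \<star> y, n) \<in> D_class C p" "(m, y, n) \<in> D_class C p"
      unfolding D_class_def mem_Collect_eq IB_arrow_iff arrow_rank_def pb_rank_def
      using mn y twist_mult_braids[OF w y(1)] by simp_all
    show ?L
      unfolding nu_def mem_Collect_eq
      by (rule exI[of _ "(nq p, X, nq p)"], rule exI[of _ "(nq p, id_braid ?P, nq p)"],
          rule exI[of _ "(m, pb_inv g, nq p)"], rule exI[of _ "(nq p, g \<star> y, n)"])
         (use X a d 1 2 uv in \<open>simp add: natural_copy_def IB_def\<close>)
qed

section \<open>The relation of a sequence of normal subgroups is a congruence\<close>

locale normal_sequence =
  fixes C :: "nat set" and nq :: "nat \<Rightarrow> nat" and r :: enat and q :: nat and N :: "nat \<Rightarrow> pbraid set"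
  assumes nq: "\<And>p. enat p \<le> r \<Longrightarrow> nq p \<in> C \<and> p \<le> nq p"
    and q_less: "enat q < r"
    and normal: "\<And>p. q + 1 \<le> p \<Longrightarrow> enat p \<le> r \<Longrightarrow> N p \<lhd> braid_group p"
    and pure: "\<And>p. q + 2 \<le> p \<Longrightarrow> enat p \<le> r \<Longrightarrow> N p \<subseteq> pure_braids p"
    and restrict: "\<And>p. q + 2 \<le> p \<Longrightarrow> enat p \<le> r \<Longrightarrow> pb_restrict (p - 1) ` N p \<subseteq> N (p - 1)"
begin

text \<open>The last strings are deleted one at a time. While strings remain to be deleted the
  current rank exceeds \<open>k\<close>, hence is at least \<open>q + 2\<close>, and
  \<open>restrict\<close> applies.\<close>

lemma restrict_iterate:
  assumes "n \<in> N p" "q + 1 \<le> k" "k \<le> p" "enat p \<le> r"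
  shows "id_braid {1..k} \<star> n \<in> N k"
  using assms
proof (induction p arbitrary: n)
  case 0
  then show ?case by simp
next
  case (Suc p)
  have N: "N (Suc p) \<lhd> braid_group (Suc p)" using normal Suc.prems by simp
  have n: "n \<in> braids {1..Suc p} {1..Suc p}" by (rule normal_in_braids[OF N Suc.prems(1)])
  show ?case
  proof (cases "k = Suc p")
    case True
    then show ?thesis using id_mult_braids[OF n] Suc.prems(1) by simp
  next
    case False
    then have k: "k \<le> p" "q + 2 \<le> Suc p" using Suc.prems by auto
    have "enat p \<le> enat (Suc p)" by simp
    then have p: "enat p \<le> r" using Suc.prems(4) order_trans by blast
    have nB: "n \<in> partial_braids" by (rule braidsD(1)[OF n])
    have "pb_restrict p n \<in> N p" using restrict[OF k(2) Suc.prems(4)] Suc.prems(1) by auto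
    then have "id_braid {1..p} \<star> n \<in> N p" using pb_restrict_eq[OF nB] by simp
    then have "id_braid {1..k} \<star> (id_braid {1..p} \<star> n) \<in> N k" using Suc.IH Suc.prems(2) k(1) p by blast
    moreover have "id_braid {1..k} \<star> (id_braid {1..p} \<star> n) = id_braid {1..k} \<star> id_braid {1..p} \<star> n"
      using nB by (simp add: pb_mult_assoc)
    moreover have "id_braid {1..k} \<star> id_braid {1..p} = id_braid {1..k}"
      using k(1) by (intro mult_id) auto
    ultimately show ?thesis by simp
  qed
qed

text \<open>The restriction condition for an arbitrary set \<open>A'\<close> of strings. A braid
  \<open>g\<close> that takes the first \<open>k\<close> positions onto \<open>A'\<close> reduces
  the claim to the first \<open>k\<close> strings of a pure braid, where it is
  \<open>restrict_iterate\<close>.\<close>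

lemma twist_restrict:
  assumes w: "w \<in> twist p (N p) A" and sub: "A' \<subseteq> A" and p: "enat p \<le> r" and k: "q + 1 \<le> card A'"
  shows "id_braid A' \<star> w \<in> twist (card A') (N (card A')) A'" "w \<star> id_braid A' = id_braid A' \<star> w"
proof -
  define k where "k = card A'"
  note wB = twistD[OF w]
  note wD = braidsD[OF wB]
  obtain g0 where g0: "g0 \<in> braids {1..p} A" using w by (auto simp: twist_def)
  have cA: "card A = p" using braidsD(6)[OF g0] by simp
  have pA: "positions A" "positions A'" using wD(4) positions_subset[OF _ sub] by auto
  then have fA: "finite A" "finite A'" by (simp_all add: positions_def)
  have kp: "k \<le> p" using card_mono[OF fA(1) sub] cA by (simp add: k_def)
  have qp: "q + 1 \<le> p" using k kp by (simp add: k_def)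
  note Np = normal[OF qp p]
  have "id_braid A' \<star> w \<in> twist k (N k) A' \<and> w \<star> id_braid A' = id_braid A' \<star> w"
  proof (cases "k = p")
    \<comment> \<open>The rank \<open>p = q + 1\<close>, for which purity is not assumed, occurs
      only here, since \<open>k\<close> is at least \<open>q + 1\<close>; nothing is
      deleted.\<close>
    case True
    then have "A' = A" using card_subset_eq[OF fA(1) sub] cA by (simp add: k_def)
    then show ?thesis using w id_mult_braids[OF wB] mult_id_braids[OF wB] True by simp
  next
    case False
    then have qp2: "q + 2 \<le> p" using k kp by (simp add: k_def)
    let ?P = "{1..p}" and ?K = "{1..k}"
    have KP: "?K \<subseteq> ?P" using kp by auto
    obtain f1 where f1: "bij_betw f1 ?K A'" using finite_same_card_bij[of ?K A'] fA by (auto simp: k_def)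
    have "card (?P - ?K) = card (A - A')" using card_Diff_subset[of ?K ?P] card_Diff_subset[OF fA(2) sub] KP cA by (simp add: k_def)
    then obtain f2 where f2: "bij_betw f2 (?P - ?K) (A - A')" using finite_same_card_bij[of "?P - ?K" "A - A'"] fA by auto
    \<comment> \<open>Two bijections are glued so that \<open>g\<close> respects the splitting of
      \<open>A\<close> into kept and deleted strings.\<close>
    define f where "f i = (if i \<in> ?K then f1 i else f2 i)" for i
    have "bij_betw f (?K \<union> (?P - ?K)) (A' \<union> (A - A'))"
      unfolding f_def[abs_def] by (rule bij_betw_disjoint_Un[OF f1 f2]) auto
    then have fb: "bij_betw f ?P A" using KP sub by (simp add: Un_absorb1)
    obtain g where g: "g \<in> braids ?P A" "\<And>i. i \<in> ?P \<Longrightarrow> braid_perm g i = f i"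
      using braid_of_bijection[OF positions_interval(1) pA(1) fb] by blast
    have fK: "f i \<in> A' \<longleftrightarrow> i \<in> ?K" if "i \<in> ?P" for i
      using bij_betwE[OF f1] bij_betwE[OF f2] that by (auto simp: f_def)
    note gi = pb_inv_in[OF g(1)]
    note gB = braidsD(1)[OF g(1)] and giB = braidsD(1)[OF gi]
    define n where "n = conjugate g w"
    have nN: "n \<in> N p" using twist_iff[OF Np g(1) wB] w by (simp add: n_def)
    have n: "n \<in> braids ?P ?P" by (rule normal_in_braids[OF Np nN])
    note nB = braidsD(1)[OF n]
    have np: "braid_perm n i = i" if "i \<in> ?P" for i
      using pure[OF qp2 p] nN that unfolding pure_braids_iff by (meson subsetD pure_braids_iff)
    let ?e = "id_braid ?K" and ?e' = "id_braid A'"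
    have eB: "?e \<in> partial_braids" "?e' \<in> partial_braids" using pA(2) by simp_all
    have ee: "?e \<star> ?e = ?e" "?e' \<star> ?e' = ?e'" using pA(2) by (simp_all add: id_mult)
    \<comment> \<open>Purity enters here: the strings of \<open>n\<close> that end in the first
      \<open>k\<close> positions are those that start there.\<close>
    have ne: "n \<star> ?e = ?e \<star> n"
    proof -
      have "pb_dom (n \<star> ?e) = ?K"
        unfolding mult_id_restrict(1)[OF positions_interval(1) nB] braidsD(2)[OF n] using np KP by auto
      then show ?thesis using mult_id_restrict_commute[OF positions_interval(1) nB, of k] by simp
    qed
    have ge: "g \<star> ?e' = ?e \<star> g"
    proof -
      have "pb_dom (g \<star> ?e') = ?K"
        unfolding mult_id_restrict(1)[OF pA(2) gB] braidsD(2)[OF g(1)] using g(2) fK KP by auto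
      then show ?thesis using mult_id_restrict_commute[OF pA(2) gB] by simp
    qed
    have gie: "pb_inv g \<star> ?e = ?e' \<star> pb_inv g"
    proof -
      have "pb_inv g \<star> (g \<star> (?e' \<star> pb_inv g)) = ?e' \<star> pb_inv g"
        by (rule mult_inv_cancel(1)[OF g(1)]) (use eB giB pb_dom_mult_subset[OF eB(2) giB] pA(2) sub in auto)
      moreover have "g \<star> (?e' \<star> pb_inv g) = ?e \<star> (g \<star> pb_inv g)"
        using ge gB giB eB by (simp flip: pb_mult_assoc)
      moreover have "?e \<star> (g \<star> pb_inv g) = ?e"
        unfolding mult_pb_inv[OF g(1)] by (rule mult_id) (use KP in auto)
      ultimately show ?thesis by simp
    qed
    have wn: "w = pb_inv g \<star> (n \<star> g)"
      using conjugate_cancel(1)[OF g(1) wB] pb_mult_assoc[OF giB nB gB]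
      unfolding n_def[symmetric] conjugate_def[of "pb_inv g"] pb_inv_inv[OF g(1)] by simp
    have we: "w \<star> ?e' = ?e' \<star> w"
    proof -
      have "w \<star> ?e' = pb_inv g \<star> (n \<star> (g \<star> ?e'))" unfolding wn using giB nB gB eB by (simp add: pb_mult_assoc)
      also have "\<dots> = pb_inv g \<star> (n \<star> ?e \<star> g)" unfolding ge using giB nB gB eB by (simp add: pb_mult_assoc)
      also have "\<dots> = pb_inv g \<star> ?e \<star> (n \<star> g)" unfolding ne using giB nB gB eB by (simp add: pb_mult_assoc)
      also have "\<dots> = ?e' \<star> w" unfolding gie wn using giB nB gB eB by (simp add: pb_mult_assoc)
      finally show ?thesis .
    qed
    \<comment> \<open>The truncation of \<open>g\<close> identifies the first \<open>k\<close>
      positions with \<open>A'\<close>; it serves as the witness that transports \<open>N k\<close>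
      to \<open>A'\<close>.\<close>
    have g1: "?e \<star> g \<in> braids ?K A'"
    proof -
      have "pb_dom (?e \<star> g) = ?K"
        unfolding id_mult_restrict(1)[OF positions_interval(1) gB] braidsD(2)[OF g(1)] using KP by blast
      moreover have "pb_codom (?e \<star> g) = A'"
        unfolding ge[symmetric] mult_id_restrict(2)[OF pA(2) gB] braidsD(3)[OF g(1)] using sub by blast
      ultimately show ?thesis using braidsI[of "?e \<star> g"] gB eB by simp
    qed
    have g1i: "pb_inv (?e \<star> g) = pb_inv g \<star> ?e"
    proof (rule pb_inv_unique[OF g1])
      have "pb_dom (pb_inv g \<star> ?e) = A'"
        unfolding gie id_mult_restrict(1)[OF pA(2) giB] braidsD(2)[OF gi] using sub by blast
      moreover have "pb_codom (pb_inv g \<star> ?e) = ?K"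
        unfolding mult_id_restrict(2)[OF positions_interval(1) giB] braidsD(3)[OF gi] using KP by blast
      ultimately show "pb_inv g \<star> ?e \<in> braids A' ?K" using braidsI[of "pb_inv g \<star> ?e"] giB eB by simp
      have "?e \<star> g \<star> (pb_inv g \<star> ?e) = ?e \<star> (g \<star> (pb_inv g \<star> ?e))" by (rule pb_mult_assoc) (use gB giB eB in auto)
      also have "g \<star> (pb_inv g \<star> ?e) = ?e" by (rule mult_inv_cancel(2)[OF g(1) eB(1)]) (use KP in simp)
      finally show "?e \<star> g \<star> (pb_inv g \<star> ?e) = ?e" using ee by simp
    qed
    have "?e' \<star> w \<in> braids A' A'"
    proof -
      have "pb_dom (?e' \<star> w) = A'"
        unfolding id_mult_restrict(1)[OF pA(2) wD(1)] wD(2) using sub by blast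
      moreover have "pb_codom (?e' \<star> w) = A'"
        unfolding we[symmetric] mult_id_restrict(2)[OF pA(2) wD(1)] wD(3) using sub by blast
      ultimately show ?thesis using braidsI[of "?e' \<star> w"] wD(1) eB by simp
    qed
    moreover have "conjugate (?e \<star> g) (?e' \<star> w) = ?e \<star> n"
    proof -
      have "conjugate (?e \<star> g) (?e' \<star> w) = g \<star> ?e' \<star> (?e' \<star> w) \<star> (pb_inv g \<star> ?e)"
        unfolding conjugate_def g1i ge ..
      also have "\<dots> = g \<star> (?e' \<star> ?e') \<star> (w \<star> (pb_inv g \<star> ?e))"
        using gB giB eB wD(1) by (simp add: pb_mult_assoc)
      also have "\<dots> = ?e \<star> (g \<star> w \<star> pb_inv g) \<star> ?e"
        unfolding ee ge using gB giB eB wD(1) by (simp add: pb_mult_assoc)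
      also have "\<dots> = ?e \<star> (n \<star> ?e)"
        unfolding n_def conjugate_def using gB giB eB wD(1) by (simp add: pb_mult_assoc)
      also have "\<dots> = ?e \<star> ?e \<star> n" unfolding ne using nB eB by (simp add: pb_mult_assoc)
      finally show ?thesis using ee by simp
    qed
    moreover have "?e \<star> n \<in> N k" by (rule restrict_iterate[OF nN _ kp p]) (use k in \<open>simp add: k_def\<close>)
    ultimately have "?e' \<star> w \<in> braids A' A'" "conjugate (?e \<star> g) (?e' \<star> w) \<in> N k" by simp_all
    then have "?e' \<star> w \<in> twist k (N k) A'" using g1 unfolding twist_def by blast
    then show ?thesis using we by simp
  qed
  then show "id_braid A' \<star> w \<in> twist (card A') (N (card A')) A'" "w \<star> id_braid A' = id_braid A' \<star> w"
    by (simp_all add: k_def)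
qed

text \<open>The three disjuncts are the diagonal, the Rees part and the union of the relations
  \<open>nu\<close>. In the last one, \<open>w\<close> is an invertible braid on the domain of
  \<open>y\<close>, so \<open>w \<star> y\<close> has the same domain and codomain as
  \<open>y\<close>.\<close>

definition related :: "pbraid \<Rightarrow> pbraid \<Rightarrow> bool" where
  "related x y \<longleftrightarrow> x = y \<or> card (pb_dom x) \<le> q \<and> card (pb_dom y) \<le> q \<or>
     q + 1 \<le> card (pb_dom y) \<and> (\<exists>w\<in>twist (card (pb_dom y)) (N (card (pb_dom y))) (pb_dom y). x = w \<star> y)"

lemma related_cases:
  assumes "related x y"
  obtains "x = y" | "card (pb_dom x) \<le> q" "card (pb_dom y) \<le> q"
    | w where "q + 1 \<le> card (pb_dom y)" "w \<in> twist (card (pb_dom y)) (N (card (pb_dom y))) (pb_dom y)" "x = w \<star> y"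
  using assms unfolding related_def by blast

lemma related_twist:
  assumes "q + 1 \<le> card (pb_dom y)" "w \<in> twist (card (pb_dom y)) (N (card (pb_dom y))) (pb_dom y)"
  shows "related (w \<star> y) y"
  using assms unfolding related_def by blast

lemma related_sym:
  assumes "related x y" "y \<in> ideal_homs r m n" shows "related y x"
  using assms(1)
proof (cases rule: related_cases)
  case (3 w)
  note y = ideal_homsD[OF assms(2)]
  note N = normal[OF 3(1) y(4)]
  note x = twist_mult_braids[OF 3(2) y(1), folded 3(3)]
  have "pb_inv w \<star> x = y" unfolding 3(3)
    by (rule mult_inv_cancel(1)[OF twistD[OF 3(2)] y(1)]) simp
  moreover have "pb_inv w \<in> twist (card (pb_dom x)) (N (card (pb_dom x))) (pb_dom x)"
    using twist_inv[OF N 3(2)] x by simp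
  ultimately show ?thesis using related_twist[of x "pb_inv w"] 3(1) x by simp
qed (auto simp: related_def)

lemma related_trans:
  assumes "related x y" "related y z" "z \<in> ideal_homs r m n" shows "related x z"
  using assms(1)
proof (cases rule: related_cases)
  case 1 then show ?thesis using assms(2) by simp
next
  case 2
  note z = ideal_homsD[OF assms(3)]
  show ?thesis using assms(2)
  proof (cases rule: related_cases)
    case (3 v)
    then show ?thesis using 2 twist_mult_braids[OF 3(2) z(1)] by simp
  qed (use 2 in \<open>auto simp: related_def\<close>)
next
  case (3 w)
  note z = ideal_homsD[OF assms(3)]
  show ?thesis using assms(2)
  proof (cases rule: related_cases)
    case 1 then show ?thesis using assms(1) by simp
  next
    case 2 then show ?thesis using 3 by simp
  next
    case v: (3 v)
    note y = twist_mult_braids[OF v(2) z(1), folded v(3)]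
    note N = normal[OF v(1) z(4)]
    have w: "w \<in> twist (card (pb_dom z)) (N (card (pb_dom z))) (pb_dom z)" using 3(2) y by simp
    have "x = w \<star> v \<star> z"
      unfolding 3(3) v(3)
      by (rule braids_assoc[OF twistD[OF w] twistD[OF v(2)] z(5), symmetric])
    then show ?thesis using related_twist[OF v(1) twist_mult[OF N w v(2)]] by simp
  qed
qed

text \<open>\<open>a\<close> acts on \<open>y\<close> only through its part \<open>a1\<close> that
  ends in the domain of \<open>y\<close>. Moving \<open>w\<close> past \<open>a1\<close> replaces it
  by the conjugate under \<open>a1\<close> of its restriction to the codomain of \<open>a1\<close>,
  and this restriction is again admissible by \<open>twist_restrict\<close>.\<close>

lemma related_left:
  assumes "related x y" "x \<in> ideal_homs r m n" "y \<in> ideal_homs r m n" "a \<in> ideal_homs r k m"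
  shows "related (a \<star> x) (a \<star> y)"
  using assms(1)
proof (cases rule: related_cases)
  case 2
  note x = ideal_homsD[OF assms(2)] and y = ideal_homsD[OF assms(3)] and a = ideal_homsD[OF assms(4)]
  show ?thesis using card_pb_dom_mult(2)[OF a(1) x(1)] card_pb_dom_mult(2)[OF a(1) y(1)] 2
    by (simp add: related_def)
next
  case (3 w)
  note x = ideal_homsD[OF assms(2)] and y = ideal_homsD[OF assms(3)] and a = ideal_homsD[OF assms(4)]
  define A where "A = pb_dom y"
  define D where "D = pb_dom (a \<star> y)"
  have dx: "pb_dom x = A" using twist_mult_braids(2)[OF 3(2) y(1)] 3(3) by (simp add: A_def)
  have D: "D = {i \<in> pb_dom a. braid_perm a i \<in> A}" unfolding D_def A_def by (rule pb_dom_mult[OF a(1) y(1)])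
  have D': "pb_dom (a \<star> x) = D" using pb_dom_mult[OF a(1) x(1)] by (simp add: dx D)
  show ?thesis
  proof (cases "card D \<le> q")
    case True
    then show ?thesis by (simp add: related_def D' D_def[symmetric])
  next
    case False
    have pA: "positions A" using y(1) by (simp add: A_def)
    define A' where "A' = pb_codom a \<inter> A"
    have pA': "positions A'" by (rule positions_subset[OF pA]) (simp add: A'_def)
    \<comment> \<open>Unlike \<open>a\<close>, this part maps its domain bijectively onto a subset
      of \<open>A\<close>, so that conjugation by it makes sense.\<close>
    define a1 where "a1 = a \<star> id_braid A"
    have a1: "a1 \<in> braids D A'"
      using mult_id_restrict[OF pA a(1)] a(1) pA by (simp add: braids_def a1_def D A'_def)
    have card: "card D = card A'" by (rule braidsD(6)[OF a1])
    have w: "w \<in> twist (card A) (N (card A)) A" using 3(2) by (simp add: A_def)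
    have cA: "enat (card A) \<le> r" using y(4) by (simp add: A_def)
    note tr = twist_restrict[OF w _ cA, of A']
    have sub: "A' \<subseteq> A" and k: "q + 1 \<le> card A'" using False card by (auto simp: A'_def)
    define w1 where "w1 = id_braid A' \<star> w"
    have w1: "w1 \<in> twist (card D) (N (card D)) A'" using tr(1)[OF sub k] card by (simp add: w1_def)
    note w1B = braidsD(1)[OF twistD[OF w1]] and wB = braidsD(1)[OF twistD[OF w]] and a1B = braidsD(1)[OF a1]
      and aiB = braidsD(1)[OF pb_inv_in[OF a1]]
    have eA: "id_braid A' \<in> partial_braids" "id_braid A \<in> partial_braids" using pA pA' by auto
    have ay: "a \<star> y = a1 \<star> y"
      unfolding a1_def using pb_mult_assoc[OF a(1) eA(2) y(1)] id_mult[OF pA y(1)] by (simp add: A_def)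
    have "conjugate a1 w1 \<star> (a \<star> y) = a1 \<star> (w1 \<star> (pb_inv a1 \<star> a1) \<star> y)"
      unfolding ay conjugate_def using w1B a1B aiB y(1) by (simp add: pb_mult_assoc)
    also have "\<dots> = a1 \<star> (w1 \<star> y)"
      unfolding pb_inv_mult[OF a1] using mult_id_braids[OF twistD[OF w1]] by simp
    also have "\<dots> = (a1 \<star> id_braid A') \<star> (w \<star> y)"
      unfolding w1_def using wB a1B y(1) eA by (simp add: pb_mult_assoc)
    also have "\<dots> = a1 \<star> (w \<star> y)" unfolding mult_id_braids[OF a1] ..
    also have "\<dots> = a \<star> (id_braid A \<star> w \<star> y)"
      unfolding a1_def using wB a(1) y(1) eA by (simp add: pb_mult_assoc)
    also have "\<dots> = a \<star> x" unfolding id_mult_braids[OF twistD[OF w]] 3(3) ..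
    finally have "a \<star> x = conjugate a1 w1 \<star> (a \<star> y)" by simp
    moreover have "conjugate a1 w1 \<in> twist (card D) (N (card D)) D" by (rule twist_conjugate[OF w1 a1])
    ultimately show ?thesis using related_twist[of "a \<star> y" "conjugate a1 w1"] False by (simp add: D_def)
  qed
qed (simp add: related_def)

text \<open>\<open>x \<star> b\<close> equals \<open>w \<star> z\<close>, where \<open>w\<close> may
  have more strings than \<open>z\<close>. Because \<open>w\<close> commutes with the identity on
  the domain of \<open>z\<close>, the surplus strings can be removed from \<open>w\<close>
  itself.\<close>

lemma related_right:
  assumes "related x y" "x \<in> ideal_homs r m n" "y \<in> ideal_homs r m n" "b \<in> ideal_homs r n k"
  shows "related (x \<star> b) (y \<star> b)"
  using assms(1)
proof (cases rule: related_cases)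
  case 2
  note x = ideal_homsD[OF assms(2)] and y = ideal_homsD[OF assms(3)] and b = ideal_homsD[OF assms(4)]
  show ?thesis using card_pb_dom_mult(1)[OF x(1) b(1)] card_pb_dom_mult(1)[OF y(1) b(1)] 2
    by (simp add: related_def)
next
  case (3 w)
  note x = ideal_homsD[OF assms(2)] and y = ideal_homsD[OF assms(3)] and b = ideal_homsD[OF assms(4)]
  define A where "A = pb_dom y"
  define z where "z = y \<star> b"
  define A' where "A' = pb_dom z"
  have zB: "z \<in> partial_braids" using y(1) b(1) by (simp add: z_def)
  have sub: "A' \<subseteq> A" unfolding A'_def z_def A_def by (rule pb_dom_mult_subset[OF y(1) b(1)])
  have w: "w \<in> twist (card A) (N (card A)) A" using 3(2) by (simp add: A_def)
  have cA: "enat (card A) \<le> r" using y(4) by (simp add: A_def)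
  note wB = braidsD(1)[OF twistD[OF w]]
  have xb: "x \<star> b = w \<star> z" unfolding 3(3) z_def by (rule pb_mult_assoc[OF wB y(1) b(1)])
  have pA': "positions A'" using zB by (simp add: A'_def)
  show ?thesis
  proof (cases "card A' \<le> q")
    case True
    then show ?thesis using card_pb_dom_mult(2)[OF wB zB] unfolding xb z_def[symmetric] related_def A'_def by simp
  next
    case False
    then have k: "q + 1 \<le> card A'" by simp
    note tr = twist_restrict[OF w sub cA k]
    have "w \<star> z = w \<star> (id_braid A' \<star> z)" using id_mult[OF pA' zB] by (simp add: A'_def)
    also have "\<dots> = w \<star> id_braid A' \<star> z" using wB zB pA' by (simp add: pb_mult_assoc)
    also have "\<dots> = id_braid A' \<star> w \<star> z" unfolding tr(2) ..
    finally have "x \<star> b = id_braid A' \<star> w \<star> z" unfolding xb .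
    then show ?thesis
      using related_twist[of z "id_braid A' \<star> w"] k tr(1) unfolding A'_def z_def[symmetric] by simp
  qed
qed (simp add: related_def)

lemma R_cong_iff:
  "(u, v) \<in> R_cong C nq r q N \<longleftrightarrow> (\<exists>m n x y. u = (m, x, n) \<and> v = (m, y, n) \<and> m \<in> C \<and> n \<in> C \<and>
     x \<in> ideal_homs r m n \<and> y \<in> ideal_homs r m n \<and> related x y)"
  (is "_ \<longleftrightarrow> ?R u v")
proof -
  have rees: "(u, v) \<in> rees_congruence (IB_ideal C r) (rank_ideal C (enat q)) \<longleftrightarrow>
    (\<exists>m n x y. u = (m, x, n) \<and> v = (m, y, n) \<and> m \<in> C \<and> n \<in> C \<and> x \<in> ideal_homs r m n \<and> y \<in> ideal_homs r m n \<and>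
      (x = y \<or> card (pb_dom x) \<le> q \<and> card (pb_dom y) \<le> q))"
  proof -
    have e1: "(IB_ideal C r)\<lparr>arrows := rank_ideal C (enat q)\<rparr> = IB_ideal C (enat q)" by (simp add: IB_ideal_def)
    have e2: "x \<in> ideal_homs (enat q) m n \<longleftrightarrow> x \<in> ideal_homs r m n \<and> card (pb_dom x) \<le> q" for x m n
      using q_less by (auto simp: ideal_homs_def intro: order_trans[of _ "enat q"])
    show ?thesis
      unfolding rees_congruence_def IB_ideal_simps(1) Un_iff e1 universal_congruence_iff Id_on_iff e2
      by (cases u; cases v) (auto simp: rank_ideal_iff)
  qed
  have nu: "(u, v) \<in> nu C nq p (N p) \<longleftrightarrow>
    (\<exists>m n x y. u = (m, x, n) \<and> v = (m, y, n) \<and> m \<in> C \<and> n \<in> C \<and> x \<in> ideal_homs r m n \<and> y \<in> ideal_homs r m n \<and>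
      card (pb_dom y) = p \<and> (\<exists>w\<in>twist p (N p) (pb_dom y). x = w \<star> y))"
    if p: "q + 1 \<le> p" "enat p \<le> r" for p
  proof -
    note iff = nu_iff[where nq = nq and p = p and N = "N p",
        OF normal[OF p] conjunct1[OF nq[OF p(2)]] conjunct2[OF nq[OF p(2)]]]
    show ?thesis
    proof
      assume "(u, v) \<in> nu C nq p (N p)"
      then obtain m n y w where *: "u = (m, w \<star> y, n)" "v = (m, y, n)" "m \<in> C" "n \<in> C"
        "y \<in> partial_braids" "pb_dom y \<subseteq> {1..m}" "pb_codom y \<subseteq> {1..n}"
        "card (pb_dom y) = p" "w \<in> twist p (N p) (pb_dom y)" unfolding iff by blast
      have "w \<star> y \<in> ideal_homs r m n" "y \<in> ideal_homs r m n"
        using *(5-8) p(2) twist_mult_braids[OF *(9,5)] by (simp_all add: ideal_homs_def)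
      with * show "\<exists>m n x y. u = (m, x, n) \<and> v = (m, y, n) \<and> m \<in> C \<and> n \<in> C \<and>
          x \<in> ideal_homs r m n \<and> y \<in> ideal_homs r m n \<and>
          card (pb_dom y) = p \<and> (\<exists>w\<in>twist p (N p) (pb_dom y). x = w \<star> y)" by blast
    next
      assume "\<exists>m n x y. u = (m, x, n) \<and> v = (m, y, n) \<and> m \<in> C \<and> n \<in> C \<and>
          x \<in> ideal_homs r m n \<and> y \<in> ideal_homs r m n \<and>
          card (pb_dom y) = p \<and> (\<exists>w\<in>twist p (N p) (pb_dom y). x = w \<star> y)"
      then obtain m n x y where *: "u = (m, x, n)" "v = (m, y, n)" "m \<in> C" "n \<in> C" "y \<in> ideal_homs r m n"
        "card (pb_dom y) = p" "\<exists>w\<in>twist p (N p) (pb_dom y). x = w \<star> y" by blast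
      then show "(u, v) \<in> nu C nq p (N p)" unfolding iff using ideal_homsD(1-3)[OF *(5)] by blast
    qed
  qed
  have "(u, v) \<in> R_cong C nq r q N \<longleftrightarrow> (u, v) \<in> rees_congruence (IB_ideal C r) (rank_ideal C (enat q)) \<or>
      (\<exists>p. q + 1 \<le> p \<and> enat p \<le> r \<and> (u, v) \<in> nu C nq p (N p))"
    unfolding R_cong_def by blast
  also have "\<dots> \<longleftrightarrow> ?R u v"
  proof
    assume "(u, v) \<in> rees_congruence (IB_ideal C r) (rank_ideal C (enat q)) \<or>
      (\<exists>p. q + 1 \<le> p \<and> enat p \<le> r \<and> (u, v) \<in> nu C nq p (N p))"
    then show "?R u v"
    proof (elim disjE exE conjE)
      assume "(u, v) \<in> rees_congruence (IB_ideal C r) (rank_ideal C (enat q))"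
      then show ?thesis unfolding rees related_def by blast
    next
      fix p assume p: "q + 1 \<le> p" "enat p \<le> r" "(u, v) \<in> nu C nq p (N p)"
      then show ?thesis unfolding nu[OF p(1,2)] related_def by blast
    qed
  next
    assume "?R u v"
    then obtain m n x y where R: "u = (m, x, n)" "v = (m, y, n)" "m \<in> C" "n \<in> C"
      "x \<in> ideal_homs r m n" "y \<in> ideal_homs r m n" "related x y" by blast
    from R(7) show "(u, v) \<in> rees_congruence (IB_ideal C r) (rank_ideal C (enat q)) \<or>
      (\<exists>p. q + 1 \<le> p \<and> enat p \<le> r \<and> (u, v) \<in> nu C nq p (N p))"
    proof (cases rule: related_cases)
      case 1
      then show ?thesis unfolding rees using R(1-6) by blast
    next
      case 2
      then show ?thesis unfolding rees using R(1-6) by blast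
    next
      case (3 w)
      note p = ideal_homsD(4)[OF R(6)]
      have "(u, v) \<in> nu C nq (card (pb_dom y)) (N (card (pb_dom y)))"
        unfolding nu[OF 3(1) p] using R(1-6) 3(2,3) by blast
      then show ?thesis using 3(1) p by blast
    qed
  qed
  finally show ?thesis .
qed

lemma is_congruence_R_cong: "is_congruence (IB_ideal C r) (R_cong C nq r q N)"
  by (rule is_congruenceI[OF R_cong_iff]) (auto simp: related_def[of x x for x] intro: related_sym related_trans related_left related_right)

end

section \<open>The classification\<close>

context ideal_congruence
begin

text \<open>For \<open>q\<close> at least \<open>r\<close> this says that the whole congruence is
  universal.\<close>

definition collapsed :: "nat \<Rightarrow> bool" where
  "collapsed q \<longleftrightarrow> (\<forall>m\<in>C. \<forall>n\<in>C. \<forall>x\<in>ideal_homs r m n. \<forall>y\<in>ideal_homs r m n.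
     card (pb_dom x) \<le> q \<longrightarrow> card (pb_dom y) \<le> q \<longrightarrow> rel m n x y)"

lemma collapsedD:
  "collapsed q \<Longrightarrow> m \<in> C \<Longrightarrow> n \<in> C \<Longrightarrow> x \<in> ideal_homs r m n \<Longrightarrow> y \<in> ideal_homs r m n \<Longrightarrow>
   card (pb_dom x) \<le> q \<Longrightarrow> card (pb_dom y) \<le> q \<Longrightarrow> rel m n x y"
  unfolding collapsed_def by blast

text \<open>Each hom set contains the empty braid as its only element of rank 0.\<close>

lemma collapsed_0: "collapsed 0"
  unfolding collapsed_def
proof (intro ballI impI)
  fix m n x y
  assume *: "m \<in> C" "n \<in> C" "x \<in> ideal_homs r m n" "y \<in> ideal_homs r m n" "card (pb_dom x) \<le> 0" "card (pb_dom y) \<le> 0"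
  have e: "z = id_braid {}" if "z \<in> ideal_homs r m n" "card (pb_dom z) \<le> 0" for z
  proof (rule empty_partial_braid)
    show "z \<in> partial_braids" by (rule ideal_homsD(1)[OF that(1)])
    then show "pb_dom z = {}" using that(2) finite_pb_dom[of z] by simp
  qed
  show "rel m n x y" using e[OF *(3,5)] e[OF *(4,6)] rel_refl[OF *(1-3)] by simp
qed

text \<open>By \<open>collapse\<close>, a related pair with different ends would make the congruence
  universal up to the larger of its two ranks, which is at least \<open>q + 1\<close>. The two
  arguments are first ordered by rank.\<close>

lemma rel_same_ends:
  assumes not: "\<not> collapsed (Suc q)" and xy: "rel m n x y" "q < card (pb_dom x) \<or> q < card (pb_dom y)"
  shows "pb_dom x = pb_dom y \<and> pb_codom x = pb_codom y"
proof (rule ccontr)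
  assume ne: "\<not> ?thesis"
  obtain x' y' where r: "rel m n x' y'" "card (pb_dom y') \<le> card (pb_dom x')" "q < card (pb_dom x')"
    "pb_dom x' \<noteq> pb_dom y' \<or> pb_codom x' \<noteq> pb_codom y'"
  proof (cases "card (pb_dom y) \<le> card (pb_dom x)")
    case True
    then have "q < card (pb_dom x)" using xy(2) by auto
    with True show thesis using that xy(1) ne by blast
  next
    case False
    then have "card (pb_dom x) \<le> card (pb_dom y)" "q < card (pb_dom y)" using xy(2) by auto
    moreover have "pb_dom y \<noteq> pb_dom x \<or> pb_codom y \<noteq> pb_codom x" using ne by metis
    ultimately show thesis using that rel_sym[OF xy(1)] by blast
  qed
  have "collapsed (Suc q)"
    unfolding collapsed_def using collapse[OF r(1,2,4)] r(3) by simp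
  then show False using not by blast
qed

lemma congruence_classification:
  assumes nq: "\<And>p. enat p \<le> r \<Longrightarrow> nq p \<in> C \<and> p \<le> nq p" and ne: "\<sigma> \<noteq> universal_congruence (IB_ideal C r)"
  obtains q N where "normal_sequence C nq r q N" "\<sigma> = R_cong C nq r q N"
proof -
  \<comment> \<open>Otherwise any two parallel arrows would be related, at the larger of their two
    finite ranks; this covers an infinite \<open>r\<close> as well.\<close>
  have "\<exists>q. \<not> collapsed q"
  proof (rule ccontr)
    assume "\<not> ?thesis"
    then have all: "collapsed q" for q by blast
    have "universal_congruence (IB_ideal C r) \<subseteq> \<sigma>"
    proof (rule subrelI)
      fix u v assume "(u, v) \<in> universal_congruence (IB_ideal C r)"
      then obtain m n x y where *: "u = (m, x, n)" "v = (m, y, n)" "m \<in> C" "n \<in> C"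
        "x \<in> ideal_homs r m n" "y \<in> ideal_homs r m n" unfolding universal_congruence_iff by blast
      have "rel m n x y"
        by (rule collapsedD[OF all *(3-6), of "max (card (pb_dom x)) (card (pb_dom y))"]) simp_all
      then show "(u, v) \<in> \<sigma>" using * by (simp add: rel_def)
    qed
    then show False using sigma_subset_universal ne by blast
  qed
  \<comment> \<open>The least rank that is not collapsed is positive by \<open>collapsed_0\<close>;
    \<open>q\<close> is its predecessor.\<close>
  then obtain q' where q': "\<not> collapsed q'" "\<And>q. q < q' \<Longrightarrow> collapsed q"
    unfolding exists_least_iff[of "\<lambda>q. \<not> collapsed q"] by blast
  then obtain q where q: "q' = Suc q" using collapsed_0 by (cases q') auto
  have cq: "collapsed q" and ncq: "\<not> collapsed (Suc q)" using q' q by auto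
  \<comment> \<open>If \<open>r\<close> were at most \<open>q\<close>, the ideal would have no arrow
    of rank \<open>q + 1\<close>, and the next rank would be collapsed too.\<close>
  have q_less: "enat q < r"
  proof (rule ccontr)
    assume "\<not> enat q < r"
    then have "card (pb_dom x) \<le> q" if "x \<in> ideal_homs r m n" for x m n
      using ideal_homsD(4)[OF that] by (metis enat_ord_simps(1) leI order_trans)
    then have "collapsed (Suc q)" using cq unfolding collapsed_def by blast
    then show False using ncq by blast
  qed
  note same = rel_same_ends[OF ncq]
  \<comment> \<open>The subgroup is read off at the vertex \<open>nq p\<close>;
    \<open>rel_conjugate\<close> compares all other hom sets with this one.\<close>
  define N where "N p = {n \<in> braids {1..p} {1..p}. rel (nq p) (nq p) n (id_braid {1..p})}" for p
  have ND: "n \<in> braids {1..p} {1..p}" "rel (nq p) (nq p) n (id_braid {1..p})" if "n \<in> N p" for n p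
    using that by (simp_all add: N_def)
  have bh: "x \<in> ideal_homs r (nq p) (nq p)" if "x \<in> braids {1..p} {1..p}" "enat p \<le> r" for x p
    using nq[OF that(2)] that(2) by (intro braids_ideal_homs[OF that(1)]) auto
  have eP: "id_braid {1..p} \<in> braids {1..p} {1..p}" for p by simp
  interpret N: normal_sequence C nq r q N
  proof (rule normal_sequence.intro)
    show "nq p \<in> C \<and> p \<le> nq p" if "enat p \<le> r" for p by (rule nq[OF that])
    show "enat q < r" by (rule q_less)
  next
    fix p assume p: "q + 1 \<le> p" "enat p \<le> r"
    have C: "nq p \<in> C" using nq[OF p(2)] by blast
    show "N p \<lhd> braid_group p" unfolding normal_braid_group_iff
    proof (intro conjI ballI)
      show "N p \<subseteq> braids {1..p} {1..p}" by (auto simp: N_def)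
      show "id_braid {1..p} \<in> N p" unfolding N_def using rel_refl[OF C C bh[OF eP p(2)]] eP by blast
      fix x assume x: "x \<in> N p"
      note xi = pb_inv[OF ND(1)[OF x]]
      have "rel (nq p) (nq p) (pb_inv x \<star> x) (pb_inv x \<star> id_braid {1..p})"
        by (rule rel_left[OF ND(2)[OF x] C bh[OF xi(1) p(2)]])
      then have "rel (nq p) (nq p) (id_braid {1..p}) (pb_inv x)" unfolding xi(3) mult_id_braids[OF xi(1)] .
      then show "pb_inv x \<in> N p" using rel_sym xi(1) by (simp add: N_def)
      show "x \<star> y \<in> N p" if y: "y \<in> N p" for y
      proof -
        have "rel (nq p) (nq p) (x \<star> y) (id_braid {1..p} \<star> y)"
          by (rule rel_right[OF ND(2)[OF x] C bh[OF ND(1)[OF y] p(2)]])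
        then have "rel (nq p) (nq p) (x \<star> y) (id_braid {1..p})"
          unfolding id_mult_braids[OF ND(1)[OF y]] by (rule rel_trans[OF _ ND(2)[OF y]])
        then show ?thesis using mult_braids[OF ND(1)[OF x] ND(1)[OF y]] by (simp add: N_def)
      qed
    next
      fix g x assume g: "g \<in> braids {1..p} {1..p}" and x: "x \<in> N p"
      note gi = pb_inv[OF g]
      have "rel (nq p) (nq p) (g \<star> x \<star> pb_inv g) (g \<star> id_braid {1..p} \<star> pb_inv g)"
        by (rule rel_right[OF rel_left[OF ND(2)[OF x] C bh[OF g p(2)]] C bh[OF gi(1) p(2)]])
      then have "rel (nq p) (nq p) (g \<star> x \<star> pb_inv g) (id_braid {1..p})"
        unfolding mult_id_braids[OF g] gi(2) .
      then show "g \<star> x \<star> pb_inv g \<in> N p"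
        using mult_braids[OF mult_braids[OF g ND(1)[OF x]] gi(1)] by (simp add: N_def)
    qed
  next
    fix p assume p: "q + 2 \<le> p" "enat p \<le> r"
    have C: "nq p \<in> C" and le: "p \<le> nq p" using nq[OF p(2)] by auto
    show pure: "N p \<subseteq> pure_braids p"
    proof (rule subsetI, unfold pure_braids_iff, intro conjI ballI)
      fix n assume n: "n \<in> N p"
      note nB = ND(1)[OF n]
      show "n \<in> braids {1..p} {1..p}" by (rule nB)
      fix i assume i: "i \<in> {1..p}"
      \<comment> \<open>Deleting string \<open>i\<close> leaves rank at least \<open>q + 1\<close>,
        where related partial braids share codomains. So \<open>n\<close> permutes the positions
        other than \<open>i\<close> among themselves and must fix \<open>i\<close>.\<close>
      define A where "A = {1..p} - {i}"
      have pA: "positions A" by (rule positions_subset[OF positions_interval(1)[of p]]) (simp add: A_def)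
      have AP: "A \<subseteq> {1..p}" by (auto simp: A_def)
      have "card A = p - 1" using i by (simp add: A_def)
      then have cA: "q < card A" "enat (card A) \<le> r" using p order_trans[of "enat (p - 1)" "enat p" r] by auto
      have "A \<subseteq> {1..nq p}" using AP le by auto
      then have "id_braid A \<in> ideal_homs r (nq p) (nq p)"
        using braids_ideal_homs[OF id_in_braids[OF pA] _ _ cA(2)] by blast
      then have "rel (nq p) (nq p) (id_braid A \<star> n) (id_braid A \<star> id_braid {1..p})"
        by (rule rel_left[OF ND(2)[OF n] C])
      moreover have "id_braid A \<star> id_braid {1..p} = id_braid A" using pA AP by (intro mult_id) simp_all
      ultimately have "rel (nq p) (nq p) (id_braid A \<star> n) (id_braid A)" by simp
      then have "pb_codom (id_braid A \<star> n) = A" using same[of "nq p" "nq p" "id_braid A \<star> n" "id_braid A"] pA cA(1) by simp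
      then have im: "braid_perm n ` A = A"
        using id_mult_restrict(2)[OF pA braidsD(1)[OF nB]] braidsD(2)[OF nB] AP by (simp add: Int_absorb2)
      have inj: "inj_on (braid_perm n) {1..p}" using inj_on_braid_perm[OF braidsD(1)[OF nB]] braidsD(2)[OF nB] by simp
      have img: "braid_perm n ` {1..p} = {1..p}"
        using pb_codom_eq[OF braidsD(1)[OF nB]] unfolding braidsD(2,3)[OF nB] by (rule sym)
      have "braid_perm n i \<notin> braid_perm n ` A"
        using inj i AP unfolding inj_on_def A_def by blast
      moreover have "braid_perm n i \<in> {1..p}" using img i by blast
      ultimately show "braid_perm n i = i" unfolding im by (simp add: A_def)
    qed
    define k where "k = p - 1"
    have k: "q + 1 \<le> k" "k \<le> p" "enat k \<le> r" using p order_trans[of "enat (p - 1)" "enat p" r] by (auto simp: k_def)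
    have Ck: "nq k \<in> C" "k \<le> nq k" using nq[OF k(3)] by auto
    have "pb_restrict k n \<in> N k" if n: "n \<in> N p" for n
    proof -
      note nB = ND(1)[OF n]
      have perm: "braid_perm n i = i" if "i \<in> {1..p}" for i
        using pure n that pure_braids_iff by blast
      let ?e = "id_braid {1..k}"
      have eB: "?e \<in> braids {1..k} {1..k}" by simp
      have K: "positions {1..k}" by simp
      \<comment> \<open>The same idempotent is used as an arrow between the two vertices, in both
        directions: it deletes the last string and carries the relation from \<open>nq p\<close> to
        \<open>nq k\<close>.\<close>
      have eh: "?e \<in> ideal_homs r (nq k) (nq p)" "?e \<in> ideal_homs r (nq p) (nq k)"
      proof -
        have "{1..k} \<subseteq> {1..nq k}" "{1..k} \<subseteq> {1..nq p}" "enat (card {1..k}) \<le> r" using k Ck le by auto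
        then show "?e \<in> ideal_homs r (nq k) (nq p)" "?e \<in> ideal_homs r (nq p) (nq k)"
          using braids_ideal_homs[OF eB] by blast+
      qed
      define n1 where "n1 = ?e \<star> n"
      have n1: "n1 \<in> braids {1..k} {1..k}"
      proof -
        have I: "{1..k} \<inter> {1..p} = {1..k}" using k(2) by auto
        have "braid_perm n ` {1..k} = (\<lambda>i. i) ` {1..k}"
          by (rule image_cong[OF refl]) (use perm k(2) in auto)
        then have im: "braid_perm n ` {1..k} = {1..k}" by simp
        have "n1 \<in> partial_braids" using braidsD(1)[OF nB] braidsD(1)[OF eB] by (simp add: n1_def)
        moreover have "pb_dom n1 = {1..k}"
          unfolding n1_def id_mult_restrict(1)[OF K braidsD(1)[OF nB]] braidsD(2)[OF nB] by (rule I)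
        moreover have "pb_codom n1 = {1..k}"
          unfolding n1_def id_mult_restrict(2)[OF K braidsD(1)[OF nB]] braidsD(2)[OF nB] I by (rule im)
        ultimately show ?thesis unfolding braids_def by blast
      qed
      have ee: "?e \<star> id_braid {1..p} = ?e" "?e \<star> ?e = ?e"
        using mult_id[of "{1..p}" ?e] mult_id[of "{1..k}" ?e] k(2) by simp_all
      have "rel (nq k) (nq k) (?e \<star> n \<star> ?e) (?e \<star> id_braid {1..p} \<star> ?e)"
        by (rule rel_right[OF rel_left[OF ND(2)[OF n] Ck(1) eh(1)] Ck(1) eh(2)])
      then have "rel (nq k) (nq k) n1 ?e" unfolding ee n1_def[symmetric] mult_id_braids[OF n1] .
      then show ?thesis using n1 pb_restrict_eq[OF braidsD(1)[OF nB]] by (simp add: N_def n1_def)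
    qed
    then show "pb_restrict (p - 1) ` N p \<subseteq> N (p - 1)" unfolding k_def by blast
  qed
  \<comment> \<open>Above rank \<open>q\<close>, the relation in every hom set is expressed by the
    subgroups recorded at the chosen vertices.\<close>
  have twist_rel: "rel m n (w \<star> y) y \<longleftrightarrow> w \<in> twist (card (pb_dom y)) (N (card (pb_dom y))) (pb_dom y)"
    if y: "m \<in> C" "n \<in> C" "y \<in> ideal_homs r m n" "q < card (pb_dom y)" and w: "w \<in> braids (pb_dom y) (pb_dom y)"
    for m n w y
  proof -
    define p where "p = card (pb_dom y)"
    have p: "q + 1 \<le> p" "enat p \<le> r" using y(4) ideal_homsD(4)[OF y(3)] by (simp_all add: p_def)
    have "positions (pb_dom y)" using ideal_homsD(1)[OF y(3)] by simp
    then obtain g where g: "g \<in> braids {1..p} (pb_dom y)"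
      using braids_nonempty[OF positions_interval(1)[of p], of "pb_dom y"] by (auto simp: p_def)
    have k: "nq p \<in> C" "p \<le> nq p" using nq[OF p(2)] by auto
    have "rel m n (w \<star> y) y \<longleftrightarrow> conjugate g w \<in> N p"
      using rel_conjugate[OF y(1-3) w g k] conjugate_in[OF g w] by (simp add: N_def conjugate_def)
    then show ?thesis using twist_iff[OF N.normal[OF p] g w] by (simp add: p_def)
  qed
  have rel_iff: "rel m n x y \<longleftrightarrow> N.related x y"
    if xy: "m \<in> C" "n \<in> C" "x \<in> ideal_homs r m n" "y \<in> ideal_homs r m n" for m n x y
  proof
    assume rel: "rel m n x y"
    show "N.related x y"
    proof (cases "q < card (pb_dom x) \<or> q < card (pb_dom y)")
      case False
      then show ?thesis by (simp add: N.related_def)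
    next
      case True
      note s = same[OF rel True]
      note x = ideal_homsD[OF xy(3)] and y = ideal_homsD[OF xy(4)]
      have lt: "q < card (pb_dom y)" using True s by simp
      have xb: "x \<in> braids (pb_dom y) (pb_codom y)" using x(5) s by simp
      \<comment> \<open>Since \<open>x\<close> and \<open>y\<close> share both ends, their quotient
        is a braid on the domain of \<open>y\<close>, to which \<open>twist_rel\<close>
        applies.\<close>
      define w where "w = x \<star> pb_inv y"
      have w: "w \<in> braids (pb_dom y) (pb_dom y)" unfolding w_def by (rule mult_braids[OF xb pb_inv_in[OF y(5)]])
      have wy: "w \<star> y = x" unfolding w_def by (rule mult_inv_cancel(4)[OF y(5) x(1)]) (simp add: s)
      have "w \<in> twist (card (pb_dom y)) (N (card (pb_dom y))) (pb_dom y)"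
        using twist_rel[OF xy(1,2,4) lt w] rel wy by simp
      then show ?thesis using N.related_twist[of y w] lt wy by simp
    qed
  next
    assume "N.related x y"
    then show "rel m n x y"
    proof (cases rule: N.related_cases)
      case 1
      then show ?thesis using rel_refl[OF xy(1-3)] by simp
    next
      case 2
      then show ?thesis using collapsedD[OF cq xy] by blast
    next
      case (3 w)
      then show ?thesis using twist_rel[OF xy(1,2,4) _ twistD[OF 3(2)]] by simp
    qed
  qed
  have "\<sigma> = R_cong C nq r q N"
  proof (rule Set.set_eqI)
    fix z :: "pb_arrow \<times> pb_arrow"
    obtain u v where z: "z = (u, v)" by (cases z)
    show "z \<in> \<sigma> \<longleftrightarrow> z \<in> R_cong C nq r q N"
    proof
      assume "z \<in> \<sigma>"
      then obtain m n x y where *: "u = (m, x, n)" "v = (m, y, n)" "m \<in> C" "n \<in> C"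
        "x \<in> ideal_homs r m n" "y \<in> ideal_homs r m n"
        using subsetD[OF sigma_subset_universal, of z] unfolding z universal_congruence_iff by blast
      then have "N.related x y" using \<open>z \<in> \<sigma>\<close> rel_iff[OF *(3-6)] by (simp add: rel_def z)
      then show "z \<in> R_cong C nq r q N" unfolding z N.R_cong_iff using * by blast
    next
      assume "z \<in> R_cong C nq r q N"
      then obtain m n x y where *: "u = (m, x, n)" "v = (m, y, n)" "m \<in> C" "n \<in> C"
        "x \<in> ideal_homs r m n" "y \<in> ideal_homs r m n" "N.related x y" unfolding z N.R_cong_iff by blast
      then show "z \<in> \<sigma>" using rel_iff[OF *(3-6)] by (simp add: rel_def z)
    qed
  qed
  then show thesis using that[OF N.normal_sequence_axioms] by blast
qed

end

theorem theorem12p7: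
  fixes C :: "nat set" and nq :: "nat \<Rightarrow> nat" and r :: enat
  assumes "C \<noteq> {}"
    and "\<And>q. enat q < xi C \<Longrightarrow> nq q \<in> C \<and> q \<le> nq q"
    and "r < xi C \<or> (r = \<infinity> \<and> xi C = \<infinity>)"
  shows "{\<sigma>. is_congruence (IB_ideal C r) \<sigma>} =
    {universal_congruence (IB_ideal C r)} \<union>
    {R_cong C nq r q N | q N.
       enat q < r \<and>
       (\<forall>p. q + 1 \<le> p \<and> enat p \<le> r \<longrightarrow> N p \<lhd> braid_group p) \<and>
       (\<forall>p. q + 2 \<le> p \<and> enat p \<le> r \<longrightarrow> N p \<subseteq> pure_braids p) \<and>
       (\<forall>p. q + 2 \<le> p \<and> enat p \<le> r \<longrightarrow> pb_restrict (p - 1) ` N p \<subseteq> N (p - 1))}"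
proof -
  \<comment> \<open>An index \<open>p\<close> with \<open>enat p \<le> r\<close> is finite, so it
    lies below \<open>xi C\<close> also when both \<open>r\<close> and \<open>xi C\<close> are
    infinite.\<close>
  have nq: "nq p \<in> C \<and> p \<le> nq p" if "enat p \<le> r" for p
  proof (rule assms(2))
    show "enat p < xi C"
      using assms(3)
    proof
      assume "r < xi C"
      with that show ?thesis by (rule le_less_trans)
    qed simp
  qed
  have sequence_iff: "normal_sequence C nq r q N \<longleftrightarrow> enat q < r \<and>
       (\<forall>p. q + 1 \<le> p \<and> enat p \<le> r \<longrightarrow> N p \<lhd> braid_group p) \<and>
       (\<forall>p. q + 2 \<le> p \<and> enat p \<le> r \<longrightarrow> N p \<subseteq> pure_braids p) \<and>
       (\<forall>p. q + 2 \<le> p \<and> enat p \<le> r \<longrightarrow> pb_restrict (p - 1) ` N p \<subseteq> N (p - 1))" (is "_ \<longleftrightarrow> ?R q N") for q N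
  proof
    assume "normal_sequence C nq r q N"
    then interpret normal_sequence C nq r q N .
    show "?R q N"
      using q_less normal pure restrict by (intro conjI allI impI) (elim conjE; assumption | blast)+
  next
    assume *: "?R q N"
    show "normal_sequence C nq r q N"
    proof (rule normal_sequence.intro)
      show "nq p \<in> C \<and> p \<le> nq p" if "enat p \<le> r" for p by (rule nq[OF that])
    qed (use * in \<open>elim conjE; simp\<close>)+
  qed
  have iff: "is_congruence (IB_ideal C r) \<sigma> \<longleftrightarrow> \<sigma> = universal_congruence (IB_ideal C r) \<or>
      (\<exists>q N. \<sigma> = R_cong C nq r q N \<and> normal_sequence C nq r q N)" for \<sigma>
  proof
    assume c: "is_congruence (IB_ideal C r) \<sigma>"
    interpret ideal_congruence C r \<sigma> by (rule ideal_congruence.intro[OF c])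
    show "\<sigma> = universal_congruence (IB_ideal C r) \<or> (\<exists>q N. \<sigma> = R_cong C nq r q N \<and> normal_sequence C nq r q N)"
    proof (cases "\<sigma> = universal_congruence (IB_ideal C r)")
      case False
      obtain q N where "normal_sequence C nq r q N" "\<sigma> = R_cong C nq r q N"
        by (rule congruence_classification[OF nq False])
      then show ?thesis by blast
    qed simp
  next
    assume "\<sigma> = universal_congruence (IB_ideal C r) \<or> (\<exists>q N. \<sigma> = R_cong C nq r q N \<and> normal_sequence C nq r q N)"
    then show "is_congruence (IB_ideal C r) \<sigma>"
      using is_congruence_universal normal_sequence.is_congruence_R_cong by blast
  qed
  show ?thesis
    by (rule Set.set_eqI) (simp only: mem_Collect_eq Un_iff singleton_iff iff sequence_iff)
qed

end
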